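(* Let $\tau\sim\mathrm{IPH}(\boldsymbol{\alpha},\boldsymbol{S}(t))$, where the entries of $\boldsymbol{S}(t)$ are uniformly bounded, be the absorption time of the process $\mathcal{J}$ constructed in the context. Then there exists a sequence of random variables $\{\tau^{(n)}\}_{n\ge\lambda_0}$ such that $\tau^{(n)}\to\tau$ in probability as $n\to\infty$, where each $\tau^{(n)}$, conditionally on $\mathcal{N}^{(n)}$, follows an infinite-dimensional phase-type distribution with initial distribution $\boldsymbol{\alpha}^{(n)}=(\boldsymbol{\alpha},\boldsymbol{0},\boldsymbol{0},\dots)$ and subintensity matrix $$\boldsymbol{S}^{(n)}=\begin{pmatrix}-n\boldsymbol{I}&n\boldsymbol{Q}^{(n)}_1& &&\\ &-n\boldsymbol{I}&n\boldsymbol{Q}^{(n)}_2& &\\ &&-n\boldsymbol{I}&n\boldsymbol{Q}^{(n)}_3&\\ &&&\ddots&\ddots\end{pmatrix},\qquad \boldsymbol{Q}^{(n)}_\ell=\boldsymbol{I}+\frac1n\boldsymbol{S}(\chi^{(n)}_\ell).$$ Furthermore, the rate of convergence of $\tau^{(n)}$ to $\tau$ is given, for all $q>0$ and all $\varepsilon\in(0,1)$, by $$\mathbb{P}\left(|\tau-\tau^{(n)}|>\kappa(q,\varepsilon)(\log n)n^{-1/2+\varepsilon/2}\right)= o(n^{-q})+\mathbb{P}\left(\tau>(1-\varepsilon)n^{\varepsilon}\right)\quad\text{as } n\to\infty.$$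
   Context: Let $p\ge1$, $\mathcal{E}=\{1,\dots,p\}$, and let $\boldsymbol{S}(t)=\{S_{ij}(t)\}_{i,j\in\mathcal{E}}$, $t\ge0$, be a subintensity matrix function: Borel measurable, integrable over compact intervals, with $S_{ii}(t)\le0$, $S_{ij}(t)\ge0$ for $i\ne j$, and $\sum_jS_{ij}(t)\le0$. Let $\boldsymbol{\alpha}=(\alpha_i)_{i\in\mathcal{E}}$ be a probability vector and $\lambda_0=\lceil\sup_{i\in\mathcal{E},t\ge0}|S_{ii}(t)|\rceil$ (finite under the boundedness hypothesis; positive, as it is a Poisson intensity). The probability space $(\Omega,\mathcal{F},\mathbb{P})$ supports the following independent components: two independent Poisson processes $\mathcal{N},\mathcal{M}$ of intensity $\lambda_0$; two independent sequences of independent Poisson processes $\{\widehat{\mathcal{N}}^{(k)}\}_{k\ge\lambda_0+1}$ and $\{\widehat{\mathcal{M}}^{(k)}\}_{k\ge\lambda_0+1}$ of intensity $1$; and i.i.d. $\mathrm{U}(0,1)$ variables $\{U_\ell\}_{\ell\ge0}$. Process $\mathcal{J}=\{J(t)\}_{t\ge0}$ on $\mathcal{E}\cup\{\star\}$: let $J(0)=i$ if $U_0\in[\sum_{j<i}\alpha_j,\sum_{j\le i}\alpha_j)$. Let $\chi_0=0$ and let $\chi_1<\chi_2<\cdots$ be the arrival times of $\mathcal{N}$; $J$ is constant on each $[\chi_\ell,\chi_{\ell+1})$. On $\{J(\chi_\ell-)=i\}$, $i\in\mathcal{E}$, set $J(\chi_\ell)=k\in\mathcal{E}$ if $U_\ell\in[\sum_{j<k}(\lambda_0^{-1}S_{ij}(\chi_\ell)+\delta_{ij}),\sum_{j\le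 k}(\lambda_0^{-1}S_{ij}(\chi_\ell)+\delta_{ij}))$, where $\delta_{ij}$ is the Kronecker delta, and $J$ moves forever to the absorbing state $\star\notin\mathcal{E}$ if $U_\ell\in[1+\sum_{j\in\mathcal{E}}\lambda_0^{-1}S_{ij}(\chi_\ell),1)$. Then $\mathcal{J}$ is a time-inhomogeneous Markov jump process with initial distribution $\boldsymbol{\alpha}$ and intensity matrix function $\boldsymbol{S}(\cdot)$ on $\mathcal{E}$, with exit rates $\boldsymbol{s}(t)=-\boldsymbol{S}(t)\boldsymbol{e}$ to $\star$ ($\boldsymbol{e}$ the vector of ones). The process is assumed transient on $\mathcal{E}$, i.e. absorbed in $\star$ in almost surely finite time. The law of $\tau=\inf\{t>0:J(t)=\star\}$ is called inhomogeneous phase-type, $\tau\sim\mathrm{IPH}(\boldsymbol{\alpha},\boldsymbol{S}(t))$. For $n\ge\lambda_0$, $\mathcal{N}^{(n)}$ is the superposition of $\mathcal{N},\widehat{\mathcal{N}}^{(\lambda_0+1)},\dots,\widehat{\mathcal{N}}^{(n)}$ and $\mathcal{M}^{(n)}$ is the superposition of $\mathcal{M},\widehat{\mathcal{M}}^{(\lambda_0+1)},\dots,\widehat{\mathcal{M}}^{(n)}$, with arrival times $\{\chi^{(n)}_\ell\}_{\ell\ge0}$ and $\{\theta^{(n)}_\ell\}_{\ell\ge0}$ respectively, $\chi^{(n)}_0=\theta^{(n)}_0=0$. For $q>0$ and $\varepsilon\in(0,1)$, $\kappa(q,\varepsilon)>0$ denotes a constant (one exists) such that $\mathbb{P}\big(\max_{1\le\ell\le\lfloor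 n^{1+\varepsilon}\rfloor}|\theta^{(n)}_\ell-\chi^{(n)}_\ell|\ge\kappa(q,\varepsilon)(\log n)n^{-1/2+\varepsilon/2}\big)=o(n^{-q})$ as $n\to\infty$. An infinite-dimensional phase-type distribution with initial distribution $\boldsymbol{\beta}$ and subintensity matrix $\boldsymbol{B}$ is the law of the termination time of a time-homogeneous Markov jump process on a countable state space with that initial distribution and subintensity matrix (termination rates being minus the row sums of $\boldsymbol{B}$).
   Formalization: The rate is proved as an upper bound: P(|τ−τ⁽ⁿ⁾|>κ(log n)n^{-1/2+ε/2}) ≤ o(n^{-q}) + P(τ>(1−ε)n^ε). Two-sided equality up to o(n^{-q}) fails, e.g. for p=1, S(t)=−c/(1+t), 0<c<1. *)

theory Defs
  imports "HOL-Probability.Probability" "HOL-Library.Landau_Symbols"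
begin

text \<open>A Poisson process is represented by its counting function \<open>N t \<omega>\<close>, \<open>t \<ge> 0\<close>;
  values at negative times are never used.  By monotonicity of the paths the natural-number
  subtraction in the increments does not truncate.\<close>

definition poisson_process :: "'a measure \<Rightarrow> real \<Rightarrow> (real \<Rightarrow> 'a \<Rightarrow> nat) \<Rightarrow> bool" where
  "poisson_process M rate N \<longleftrightarrow>
     0 < rate \<and>
     (\<forall>t\<ge>0. N t \<in> measurable M (count_space UNIV)) \<and>
     (\<forall>\<omega>\<in>space M. N 0 \<omega> = 0 \<and> mono_on {0..} (\<lambda>t. N t \<omega>) \<and>
        (\<forall>t\<ge>0. continuous (at_right t) (\<lambda>s. N s \<omega>))) \<and>
     (\<forall>s t. 0 \<le> s \<and> s < t \<longrightarrow>
        distr M (count_space UNIV) (\<lambda>\<omega>. N t \<omega> - N s \<omega>)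
          = measure_pmf (poisson_pmf (rate * (t - s)))) \<and>
     (\<forall>t::nat \<Rightarrow> real. 0 \<le> t 0 \<and> mono t \<longrightarrow>
        prob_space.indep_vars M (\<lambda>_. count_space UNIV)
          (\<lambda>i \<omega>. N (t (Suc i)) \<omega> - N (t i) \<omega>) UNIV)"

definition natural_sigma :: "'a measure \<Rightarrow> (real \<Rightarrow> 'a \<Rightarrow> nat) \<Rightarrow> 'a measure" where
  "natural_sigma M N =
     sigma (space M) {N t -` A \<inter> space M | t A. 0 \<le> t}"

text \<open>For \<open>l = 0\<close> this is \<open>0\<close>.  The set is empty only when the path has fewer than
  \<open>l\<close> arrivals, a null event for a Poisson process.\<close>

definition arrival :: "(real \<Rightarrow> 'a \<Rightarrow> nat) \<Rightarrow> nat \<Rightarrow> 'a \<Rightarrow> real" where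
  "arrival N l \<omega> = Inf {t. 0 \<le> t \<and> l \<le> N t \<omega>}"

definition superpose ::
  "(real \<Rightarrow> 'a \<Rightarrow> nat) \<Rightarrow> (nat \<Rightarrow> real \<Rightarrow> 'a \<Rightarrow> nat) \<Rightarrow> nat \<Rightarrow> nat \<Rightarrow> real \<Rightarrow> 'a \<Rightarrow> nat"
where
  "superpose N Nh l0 n t \<omega> = N t \<omega> + (\<Sum>k\<in>{l0 + 1..n}. Nh k t \<omega>)"

datatype source = Src_N | Src_M | Src_Nh nat | Src_Mh nat | Src_U nat

primrec source_events ::
  "'a measure \<Rightarrow> (real \<Rightarrow> 'a \<Rightarrow> nat) \<Rightarrow> (real \<Rightarrow> 'a \<Rightarrow> nat) \<Rightarrow>
   (nat \<Rightarrow> real \<Rightarrow> 'a \<Rightarrow> nat) \<Rightarrow> (nat \<Rightarrow> real \<Rightarrow> 'a \<Rightarrow> nat) \<Rightarrow> (nat \<Rightarrow> 'a \<Rightarrow> real) \<Rightarrow>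
   source \<Rightarrow> 'a set set"
where
  "source_events P N M Nh Mh U Src_N = sets (natural_sigma P N)"
| "source_events P N M Nh Mh U Src_M = sets (natural_sigma P M)"
| "source_events P N M Nh Mh U (Src_Nh k) = sets (natural_sigma P (Nh k))"
| "source_events P N M Nh Mh U (Src_Mh k) = sets (natural_sigma P (Mh k))"
| "source_events P N M Nh Mh U (Src_U l) = sets (vimage_algebra (space P) (U l) borel)"

definition independent_sources ::
  "'a measure \<Rightarrow> nat \<Rightarrow> (real \<Rightarrow> 'a \<Rightarrow> nat) \<Rightarrow> (real \<Rightarrow> 'a \<Rightarrow> nat) \<Rightarrow>
   (nat \<Rightarrow> real \<Rightarrow> 'a \<Rightarrow> nat) \<Rightarrow> (nat \<Rightarrow> real \<Rightarrow> 'a \<Rightarrow> nat) \<Rightarrow> (nat \<Rightarrow> 'a \<Rightarrow> real) \<Rightarrow> bool"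
where
  "independent_sources P l0 N M Nh Mh U \<longleftrightarrow>
     poisson_process P (real l0) N \<and> poisson_process P (real l0) M \<and>
     (\<forall>k\<ge>l0 + 1. poisson_process P 1 (Nh k) \<and> poisson_process P 1 (Mh k)) \<and>
     (\<forall>l. U l \<in> borel_measurable P \<and>
          distr P borel (U l) = uniform_measure lborel {0<..<1}) \<and>
     prob_space.indep_sets P (source_events P N M Nh Mh U)
       ({Src_N, Src_M} \<union> Src_Nh ` {l0 + 1..} \<union> Src_Mh ` {l0 + 1..} \<union> range Src_U)"

text \<open>The state space is \<open>{1..p}\<close>; \<open>S t i j\<close> is the \<open>(i, j)\<close> entry at time \<open>t \<ge> 0\<close>.\<close>

definition subintensity_function :: "nat \<Rightarrow> (real \<Rightarrow> nat \<Rightarrow> nat \<Rightarrow> real) \<Rightarrow> bool" where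
  "subintensity_function p S \<longleftrightarrow>
     (\<forall>i\<in>{1..p}. \<forall>j\<in>{1..p}.
        (\<lambda>t. S t i j) \<in> borel_measurable (restrict_space borel {0..}) \<and>
        (\<forall>a b. 0 \<le> a \<longrightarrow> set_integrable lborel {a..b} (\<lambda>t. S t i j))) \<and>
     (\<forall>t\<ge>0. \<forall>i\<in>{1..p}.
        S t i i \<le> 0 \<and> (\<forall>j\<in>{1..p}. i \<noteq> j \<longrightarrow> 0 \<le> S t i j) \<and> (\<Sum>j\<in>{1..p}. S t i j) \<le> 0)"

definition uniformly_bounded :: "nat \<Rightarrow> (real \<Rightarrow> nat \<Rightarrow> nat \<Rightarrow> real) \<Rightarrow> bool" where
  "uniformly_bounded p S \<longleftrightarrow>
     (\<exists>C. \<forall>t\<ge>0. \<forall>i\<in>{1..p}. \<forall>j\<in>{1..p}. \<bar>S t i j\<bar> \<le> C)"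

definition lambda0 :: "nat \<Rightarrow> (real \<Rightarrow> nat \<Rightarrow> nat \<Rightarrow> real) \<Rightarrow> nat" where
  "lambda0 p S = nat \<lceil>SUP (i, t)\<in>{1..p} \<times> {0..}. \<bar>S t i i\<bar>\<rceil>"

definition probability_vector :: "nat \<Rightarrow> (nat \<Rightarrow> real) \<Rightarrow> bool" where
  "probability_vector p w \<longleftrightarrow> (\<forall>i\<in>{1..p}. 0 \<le> w i) \<and> (\<Sum>i\<in>{1..p}. w i) = 1"

text \<open>\<open>sample p w u\<close> is the state \<open>k\<close> with \<open>u \<in> [\<Sum>j<k. w j, \<Sum>j\<le>k. w j)\<close>, and \<open>None\<close>
  (the absorbing state) if there is none.  When \<open>w\<close> has nonnegative entries these intervals are
  disjoint, and the part of \<open>[0, 1)\<close> they leave uncovered is \<open>[\<Sum>j\<in>{1..p}. w j, 1)\<close>.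
  A uniform variable lies outside \<open>[0, 1)\<close> with probability zero.\<close>

definition sample :: "nat \<Rightarrow> (nat \<Rightarrow> real) \<Rightarrow> real \<Rightarrow> nat option" where
  "sample p w u =
     (if \<exists>k\<in>{1..p}. u \<in> {(\<Sum>j\<in>{1..<k}. w j)..<(\<Sum>j\<in>{1..k}. w j)}
      then Some (THE k. k \<in> {1..p} \<and> u \<in> {(\<Sum>j\<in>{1..<k}. w j)..<(\<Sum>j\<in>{1..k}. w j)})
      else None)"

primrec jump_chain ::
  "nat \<Rightarrow> (nat \<Rightarrow> real) \<Rightarrow> (real \<Rightarrow> nat \<Rightarrow> nat \<Rightarrow> real) \<Rightarrow> (real \<Rightarrow> 'a \<Rightarrow> nat) \<Rightarrow>
   (nat \<Rightarrow> 'a \<Rightarrow> real) \<Rightarrow> nat \<Rightarrow> 'a \<Rightarrow> nat option"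
where
  "jump_chain p \<alpha> S N U 0 \<omega> = sample p \<alpha> (U 0 \<omega>)"
| "jump_chain p \<alpha> S N U (Suc l) \<omega> =
     (case jump_chain p \<alpha> S N U l \<omega> of
        None \<Rightarrow> None
      | Some i \<Rightarrow>
          sample p
            (\<lambda>j. S (arrival N (Suc l) \<omega>) i j / real (lambda0 p S) + (if i = j then 1 else 0))
            (U (Suc l) \<omega>))"

text \<open>\<open>N t \<omega>\<close> is the index \<open>l\<close> of the interval between the \<open>l\<close>-th and the next arrival
  containing \<open>t\<close>.\<close>

definition J_process ::
  "nat \<Rightarrow> (nat \<Rightarrow> real) \<Rightarrow> (real \<Rightarrow> nat \<Rightarrow> nat \<Rightarrow> real) \<Rightarrow> (real \<Rightarrow> 'a \<Rightarrow> nat) \<Rightarrow>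
   (nat \<Rightarrow> 'a \<Rightarrow> real) \<Rightarrow> real \<Rightarrow> 'a \<Rightarrow> nat option"
where
  "J_process p \<alpha> S N U t \<omega> = jump_chain p \<alpha> S N U (N t \<omega>) \<omega>"

text \<open>Only meaningful on paths that are absorbed.\<close>

definition absorption_time :: "(real \<Rightarrow> 'a \<Rightarrow> 's option) \<Rightarrow> 'a \<Rightarrow> real" where
  "absorption_time X \<omega> = Inf {t. 0 < t \<and> X t \<omega> = None}"

definition subintensity_matrix :: "'s set \<Rightarrow> ('s \<Rightarrow> 's \<Rightarrow> real) \<Rightarrow> bool" where
  "subintensity_matrix E B \<longleftrightarrow>
     (\<forall>i\<in>E. B i i \<le> 0 \<and> (\<forall>j\<in>E. i \<noteq> j \<longrightarrow> 0 \<le> B i j) \<and>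
        B i summable_on E \<and> (\<Sum>\<^sub>\<infinity>j\<in>E. B i j) \<le> 0)"

text \<open>The intensities on the state space extended by the termination state \<open>None\<close>.\<close>

fun full_intensity :: "'s set \<Rightarrow> ('s \<Rightarrow> 's \<Rightarrow> real) \<Rightarrow> 's option \<Rightarrow> 's option \<Rightarrow> real" where
  "full_intensity E B (Some i) (Some j) = B i j"
| "full_intensity E B (Some i) None = - (\<Sum>\<^sub>\<infinity>j\<in>E. B i j)"
| "full_intensity E B None y = 0"

text \<open>Paths have right and left limits in the discrete topology, i.e. finitely many jumps on
  compact time intervals.  \<open>T h x y\<close> is the probability of a transition from \<open>x\<close> to \<open>y\<close> within
  time \<open>h\<close>; it depends on the elapsed time only.\<close>

definition markov_jump_process ::
  "'w measure \<Rightarrow> (real \<Rightarrow> 'w \<Rightarrow> 's option) \<Rightarrow> 's set \<Rightarrow> ('s \<Rightarrow> real) \<Rightarrow> ('s \<Rightarrow> 's \<Rightarrow> real) \<Rightarrow> bool"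
where
  "markov_jump_process W X E \<beta> B \<longleftrightarrow>
     prob_space W \<and> countable E \<and> subintensity_matrix E B \<and>
     (\<forall>t\<ge>0. X t \<in> measurable W (count_space UNIV)) \<and>
     (\<forall>\<omega>\<in>space W.
        (\<forall>t\<ge>0. X t \<omega> \<in> insert None (Some ` E)) \<and>
        (\<forall>t\<ge>0. \<forall>\<^sub>F s in at_right t. X s \<omega> = X t \<omega>) \<and>
        (\<forall>t>0. \<exists>x. \<forall>\<^sub>F s in at_left t. X s \<omega> = x)) \<and>
     (\<forall>i\<in>E. measure W {\<omega>\<in>space W. X 0 \<omega> = Some i} = \<beta> i) \<and>
     (\<exists>T :: real \<Rightarrow> 's option \<Rightarrow> 's option \<Rightarrow> real.
        (\<forall>k (t :: nat \<Rightarrow> real) x. 0 \<le> t 0 \<and> (\<forall>i\<le>k. t i < t (Suc i)) \<longrightarrow>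
           measure W {\<omega>\<in>space W. \<forall>i\<le>Suc k. X (t i) \<omega> = x i} =
           measure W {\<omega>\<in>space W. \<forall>i\<le>k. X (t i) \<omega> = x i}
             * T (t (Suc k) - t k) (x k) (x (Suc k))) \<and>
        (\<forall>x\<in>insert None (Some ` E). \<forall>y\<in>insert None (Some ` E).
           ((\<lambda>h. (T h x y - (if x = y then 1 else 0)) / h) \<longlongrightarrow> full_intensity E B x y)
             (at_right 0)))"

text \<open>The underlying probability space is quantified over the type of paths: every process can
  be transferred to its path space, so this does not restrict the class of laws.\<close>

definition phase_type ::
  "'s set \<Rightarrow> ('s \<Rightarrow> real) \<Rightarrow> ('s \<Rightarrow> 's \<Rightarrow> real) \<Rightarrow> real measure \<Rightarrow> bool"
where
  "phase_type E \<beta> B \<mu> \<longleftrightarrow>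
     (\<exists>(W :: (real \<Rightarrow> 's option) measure) X.
        markov_jump_process W X E \<beta> B \<and>
        (AE \<omega> in W. \<exists>t\<ge>0. X t \<omega> = None) \<and>
        \<mu> = distr W borel (\<lambda>\<omega>. Inf {t. 0 \<le> t \<and> X t \<omega> = None}))"

text \<open>States of the block matrix are pairs (block, state within the block), blocks being
  numbered from 1.\<close>

definition block_states :: "nat \<Rightarrow> (nat \<times> nat) set" where
  "block_states p = {1..} \<times> {1..p}"

fun block_initial :: "(nat \<Rightarrow> real) \<Rightarrow> nat \<times> nat \<Rightarrow> real" where
  "block_initial \<alpha> (l, i) = (if l = 1 then \<alpha> i else 0)"

definition Q_matrix ::
  "(real \<Rightarrow> nat \<Rightarrow> nat \<Rightarrow> real) \<Rightarrow> nat \<Rightarrow> (nat \<Rightarrow> real) \<Rightarrow> nat \<Rightarrow> nat \<Rightarrow> nat \<Rightarrow> real"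
where
  "Q_matrix S n c l i j = (if i = j then 1 else 0) + 1 / real n * S (c l) i j"

fun block_matrix ::
  "(real \<Rightarrow> nat \<Rightarrow> nat \<Rightarrow> real) \<Rightarrow> nat \<Rightarrow> (nat \<Rightarrow> real) \<Rightarrow> nat \<times> nat \<Rightarrow> nat \<times> nat \<Rightarrow> real"
where
  "block_matrix S n c (l, i) (m, j) =
     (if m = l then (if i = j then - real n else 0)
      else if m = Suc l then real n * Q_matrix S n c l i j
      else 0)"

definition regular_conditional_law ::
  "'a measure \<Rightarrow> 'a measure \<Rightarrow> ('a \<Rightarrow> real) \<Rightarrow> ('a \<Rightarrow> real measure) \<Rightarrow> bool"
where
  "regular_conditional_law M G Z K \<longleftrightarrow>
     K \<in> measurable G (prob_algebra borel) \<and>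
     (\<forall>C\<in>sets G. \<forall>A\<in>sets borel.
        emeasure M (C \<inter> (Z -` A \<inter> space M)) = (\<integral>\<^sup>+\<omega>\<in>C. emeasure (K \<omega>) A \<partial>M))"

definition tendsto_in_probability ::
  "'a measure \<Rightarrow> (nat \<Rightarrow> 'a \<Rightarrow> real) \<Rightarrow> ('a \<Rightarrow> real) \<Rightarrow> bool"
where
  "tendsto_in_probability M Z Y \<longleftrightarrow>
     (\<forall>e>0. (\<lambda>n. measure M {\<omega>\<in>space M. \<bar>Z n \<omega> - Y \<omega>\<bar> > e}) \<longlonglongrightarrow> 0)"

definition rate_threshold :: "real \<Rightarrow> real \<Rightarrow> nat \<Rightarrow> real" where
  "rate_threshold \<kappa> \<epsilon> n = \<kappa> * ln (real n) * real n powr (- 1 / 2 + \<epsilon> / 2)"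

end

theory Submission
  imports Defs "HOL-Real_Asymp.Real_Asymp"
begin

text \<open>Let \<open>\<N>\<close> be the clock of the process \<open>J\<close>, of intensity \<open>\<lambda>\<^sub>0\<close>, let \<open>\<N>\<^sup>n\<close> and \<open>\<M>\<^sup>n\<close> be the two
  superposed clocks of intensity \<open>n\<close>, and let \<open>\<chi>\<^sub>l\<close> and \<open>\<theta>\<^sub>l\<close> be their arrival times.

  \<open>J\<close> jumps only at arrivals of \<open>\<N>\<close>, and these are arrivals of \<open>\<N>\<^sup>n\<close>.  Hence
  \<open>\<tau> = \<chi>\<^sub>L\<close> for the random index \<open>L = \<N>\<^sup>n(\<tau>)\<close> (\<open>first_passage_of_component\<close>), and the
  approximation is \<open>\<tau>\<^sup>n = \<theta>\<^sub>L\<close>: the same index, read on the other clock.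

  By construction \<open>\<bar>\<tau> - \<tau>\<^sup>n\<bar> = \<bar>\<theta>\<^sub>L - \<chi>\<^sub>L\<bar>\<close>.  This is at most the maximum of
  \<open>\<bar>\<theta>\<^sub>l - \<chi>\<^sub>l\<bar>\<close> over \<open>1 \<le> l \<le> n powr (1 + \<epsilon>)\<close>, unless \<open>L > n powr (1 + \<epsilon>)\<close>.  In the latter case
  either \<open>\<tau> > (1 - \<epsilon>) n powr \<epsilon>\<close>, or \<open>\<N>\<^sup>n\<close> has more than \<open>n powr (1 + \<epsilon>)\<close> arrivals in an interval
  where it expects \<open>(1 - \<epsilon>) n powr (1 + \<epsilon>)\<close> of them, which by Chernoff's inequality has an
  exponentially small probability (\<open>approximation_error\<close>, \<open>poisson_excess_bound\<close>).
  Convergence in probability follows because \<open>\<tau>\<close> is finite.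

  Given \<open>\<N>\<^sup>n\<close>, each of its arrivals belongs to \<open>\<N>\<close> independently with
  probability \<open>\<lambda>\<^sub>0 / n\<close>.  The chain obtained by observing \<open>J\<close> at the arrivals of \<open>\<N>\<^sup>n\<close> therefore moves
  in its \<open>l\<close>-th step with the kernel \<open>I + S(\<chi>\<^sub>l) / \<lambda>\<^sub>0\<close> with probability \<open>\<lambda>\<^sub>0 / n\<close> and rests otherwise, so
  its kernel is the mixture \<open>I + S(\<chi>\<^sub>l) / n = Q\<^sub>l\<close>, and \<open>L\<close> is the index at which it is absorbed.
  As \<open>\<M>\<^sup>n\<close> is a Poisson process independent of everything that determines \<open>L\<close>, the time \<open>\<tau>\<^sup>n = \<theta>\<^sub>L\<close>
  is the absorption time of a chain with kernels \<open>Q\<^sub>1, Q\<^sub>2, \<dots>\<close> run at the arrivals of an independent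
  Poisson process of intensity \<open>n\<close>.  Together with the number of steps made, this chain is a
  time-homogeneous jump process whose intensity matrix is the block bidiagonal one
  (\<open>subordinated_chain_phase_type\<close>).

  The conditioning on a path is carried out with integrals.  Independence enters through
  \<open>decoupling\<close>, which replaces one of two independent arguments by a copy.  That the arrivals
  of \<open>\<N>\<^sup>n\<close> are marked independently is expressed by \<open>thinning_path_law\<close>: the pair formed by \<open>\<N>\<close> and
  the remaining arrivals has the law of a Poisson process of intensity \<open>n\<close> split by Bernoulli
  marks.  Integrals over paths are moved to the latter representation, where the average over the
  marks can be computed (\<open>marked_occupation_average\<close>), and back (\<open>occupation_transport\<close>).\<close>

section \<open>Counting paths and their arrival times\<close>

definition counting_path :: "(real \<Rightarrow> nat) \<Rightarrow> bool" where
  "counting_path x \<longleftrightarrow> x 0 = 0 \<and> mono_on {0..} x \<and> (\<forall>t\<ge>0. continuous (at_right t) x)"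

text \<open>The arrival times of a fixed path.  The infimum is over the empty set, hence an unspecified constant,
  if the path stays below \<open>l\<close>.\<close>

definition arrival_time :: "(real \<Rightarrow> nat) \<Rightarrow> nat \<Rightarrow> real" where
  "arrival_time x l = Inf {t. 0 \<le> t \<and> l \<le> x t}"

lemma arrival_eq_arrival_time: "arrival N l \<omega> = arrival_time (\<lambda>t. N t \<omega>) l"
  by (simp add: arrival_def arrival_time_def)

lemma counting_path_mono: "counting_path x \<Longrightarrow> 0 \<le> s \<Longrightarrow> s \<le> t \<Longrightarrow> x s \<le> x t"
  by (auto simp: counting_path_def mono_on_def)

lemma continuous_nat_iff_eventually_const:
  "continuous (at_right t) x \<longleftrightarrow> (\<forall>\<^sub>F s in at_right t. x s = (x t :: nat))" for t :: real
  by (simp add: continuous_within tendsto_discrete)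

lemma counting_path_add:
  "counting_path x \<Longrightarrow> counting_path y \<Longrightarrow> counting_path (\<lambda>t. x t + y t)"
  unfolding counting_path_def continuous_nat_iff_eventually_const mono_on_def
proof (intro conjI allI impI ballI)
  assume *: "x 0 = 0 \<and> (\<forall>r s. r \<in> {0..} \<and> s \<in> {0..} \<and> r \<le> s \<longrightarrow> x r \<le> x s) \<and>
      (\<forall>t\<ge>0. \<forall>\<^sub>F s in at_right t. x s = x t)"
    "y 0 = 0 \<and> (\<forall>r s. r \<in> {0..} \<and> s \<in> {0..} \<and> r \<le> s \<longrightarrow> y r \<le> y s) \<and>
      (\<forall>t\<ge>0. \<forall>\<^sub>F s in at_right t. y s = y t)"
  show "x 0 + y 0 = 0" using * by simp
  show "x r + y r \<le> x s + y s" if "r \<in> {0..} \<and> s \<in> {0..} \<and> r \<le> s" for r s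
    using * that by (intro add_mono) blast+
  show "\<forall>\<^sub>F s in at_right t. x s + y s = x t + y t" if "0 \<le> t" for t
  proof -
    have "\<forall>\<^sub>F s in at_right t. x s = x t" "\<forall>\<^sub>F s in at_right t. y s = y t" using * that by blast+
    then show ?thesis by eventually_elim simp
  qed
qed

lemma counting_path_zero: "counting_path (\<lambda>t. 0)"
  by (simp add: counting_path_def mono_on_def)

lemma counting_path_comp:
  assumes "counting_path x" "mono f" "f 0 = 0"
  shows "counting_path (\<lambda>t. f (x t))"
  unfolding counting_path_def continuous_nat_iff_eventually_const
proof (intro conjI allI impI)
  show "f (x 0) = 0" using assms by (simp add: counting_path_def)
  show "mono_on {0..} (\<lambda>t. f (x t))"
    using assms by (auto simp: counting_path_def mono_on_def intro!: monoD[OF assms(2)])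
  fix t :: real assume "0 \<le> t"
  then have "\<forall>\<^sub>F s in at_right t. x s = x t"
    using assms by (simp add: counting_path_def continuous_nat_iff_eventually_const)
  then show "\<forall>\<^sub>F s in at_right t. f (x s) = f (x t)" by eventually_elim simp
qed

lemma arrival_time_nonneg:
  assumes "\<exists>t\<ge>0. l \<le> x t" shows "0 \<le> arrival_time x l"
  unfolding arrival_time_def using assms by (intro cInf_greatest) auto

lemma arrival_time_0 [simp]: "arrival_time x 0 = 0"
proof -
  have "{t. 0 \<le> t \<and> 0 \<le> x t} = {0..}" by auto
  then show ?thesis by (simp add: arrival_time_def)
qed

text \<open>Right-continuity makes the infimum in the definition of \<open>arrival_time\<close> a minimum, so that the
  level is reached at the arrival time itself.\<close>

lemma arrival_time_le_iff:
  assumes x: "counting_path x" and ex: "\<exists>s\<ge>0. l \<le> x s" and t: "0 \<le> t"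
  shows "arrival_time x l \<le> t \<longleftrightarrow> l \<le> x t"
proof
  assume "l \<le> x t"
  then show "arrival_time x l \<le> t"
    unfolding arrival_time_def using t by (intro cInf_lower) (auto intro!: bdd_belowI[of _ 0])
next
  assume le: "arrival_time x l \<le> t"
  have "\<forall>\<^sub>F s in at_right t. x s = x t"
    using x t by (auto simp: counting_path_def continuous_nat_iff_eventually_const)
  then obtain b where b: "b > t" "\<And>s. t < s \<Longrightarrow> s < b \<Longrightarrow> x s = x t"
    by (auto simp: eventually_at_right_field)
  have "Inf {t. 0 \<le> t \<and> l \<le> x t} < b" using le b by (simp add: arrival_time_def)
  then obtain s where s: "0 \<le> s" "l \<le> x s" "s < b"
    using cInf_lessD[of "{t. 0 \<le> t \<and> l \<le> x t}" b] ex by auto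
  show "l \<le> x t"
  proof (cases "s \<le> t")
    case True
    then show ?thesis using counting_path_mono[OF x s(1) True] s by simp
  next
    case False
    then show ?thesis using b(2)[of s] s by simp
  qed
qed

lemma le_at_arrival_time:
  assumes "counting_path x" "\<exists>s\<ge>0. l \<le> x s"
  shows "l \<le> x (arrival_time x l)"
  using arrival_time_le_iff[OF assms arrival_time_nonneg[OF assms(2)]] by simp

text \<open>Poisson paths almost surely have infinitely many arrivals, no two of them simultaneous.  The latter
  says that no level is skipped.\<close>

definition simple_path :: "(real \<Rightarrow> nat) \<Rightarrow> bool" where
  "simple_path x \<longleftrightarrow>
     counting_path x \<and> (\<forall>l. (\<exists>t\<ge>0. l \<le> x t) \<and> x (arrival_time x l) = l)"

lemma simple_pathD:
  assumes "simple_path x"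
  shows "counting_path x" "\<exists>t\<ge>0. l \<le> x t" "x (arrival_time x l) = l" "0 \<le> arrival_time x l"
  using assms by (auto simp: simple_path_def intro!: arrival_time_nonneg)

lemma simple_path_arrival_time_le_iff:
  "simple_path x \<Longrightarrow> 0 \<le> t \<Longrightarrow> arrival_time x l \<le> t \<longleftrightarrow> l \<le> x t"
  using arrival_time_le_iff simple_pathD by blast

lemma simple_path_arrival_time_mono:
  assumes "simple_path x" shows "arrival_time x k \<le> arrival_time x l \<longleftrightarrow> k \<le> l"
  using simple_path_arrival_time_le_iff[OF assms simple_pathD(4)[OF assms], of k l]
  by (simp add: simple_pathD(3)[OF assms])

context
  fixes x y z :: "real \<Rightarrow> nat"
  assumes x: "counting_path x" and y: "counting_path y"
    and z: "simple_path z" and sum: "\<And>t. 0 \<le> t \<Longrightarrow> z t = x t + y t"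
begin

lemma component_eq_if_sum_eq:
  assumes "0 \<le> s" "s \<le> t" "z s = z t"
  shows "x s = x t"
proof -
  have "x s \<le> x t" "y s \<le> y t" using assms counting_path_mono x y by auto
  then show ?thesis using assms sum[of s] sum[of t] by simp
qed

text \<open>Between two successive arrivals the sum of two counting paths grows by one, so at most one of the
  summands grows, and if \<open>x\<close> does, then it does so exactly at the later arrival.\<close>

lemma component_step:
  fixes l
  defines "\<eta> \<equiv> \<lambda>l. x (arrival_time z l)"
  shows "\<eta> (Suc l) = \<eta> l \<or>
    (\<eta> (Suc l) = Suc (\<eta> l) \<and> arrival_time x (Suc (\<eta> l)) = arrival_time z (Suc l))"
proof -
  let ?s = "arrival_time z l" and ?t = "arrival_time z (Suc l)"
  have st: "0 \<le> ?s" "?s < ?t"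
    using simple_pathD(4)[OF z] simple_path_arrival_time_mono[OF z, of "Suc l" l] by auto
  have zs: "z ?s = l" "z ?t = Suc l" using simple_pathD(3)[OF z] by auto
  have "x ?s \<le> x ?t" "y ?s \<le> y ?t" using counting_path_mono x y st by auto
  then have le: "\<eta> (Suc l) = \<eta> l \<or> \<eta> (Suc l) = Suc (\<eta> l)"
    using zs sum[of ?s] sum[of ?t] st unfolding \<eta>_def by linarith
  moreover have "arrival_time x (Suc (\<eta> l)) = ?t" if eq: "\<eta> (Suc l) = Suc (\<eta> l)"
  proof -
    have ex: "\<exists>s\<ge>0. Suc (\<eta> l) \<le> x s"
      using eq st by (auto simp: \<eta>_def intro!: exI[of _ ?t])
    have "arrival_time x (Suc (\<eta> l)) \<le> ?t"
      using arrival_time_le_iff[OF x ex, of ?t] eq st by (simp add: \<eta>_def)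
    moreover have "\<not> arrival_time x (Suc (\<eta> l)) < ?t"
    proof
      let ?u = "arrival_time x (Suc (\<eta> l))"
      assume lt: "?u < ?t"
      have u: "0 \<le> ?u" using arrival_time_nonneg[of "Suc (\<eta> l)" x] ex by simp
      have xu: "Suc (\<eta> l) \<le> x ?u" using le_at_arrival_time[OF x ex] .
      have "?s \<le> ?u"
      proof (rule ccontr)
        assume "\<not> ?s \<le> ?u"
        then have "x ?u \<le> x ?s" using counting_path_mono[OF x u] by simp
        then show False using xu by (simp add: \<eta>_def)
      qed
      moreover have "z ?u < Suc l"
        using simple_path_arrival_time_le_iff[OF z u, of "Suc l"] lt by simp
      moreover have "z ?s \<le> z ?u"
        using counting_path_mono[OF simple_pathD(1)[OF z] st(1) \<open>?s \<le> ?u\<close>] .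
      ultimately have "z ?s = z ?u" using zs by simp
      then have "x ?s = x ?u" using component_eq_if_sum_eq[OF st(1) \<open>?s \<le> ?u\<close>] by simp
      then show False using xu by (simp add: \<eta>_def)
    qed
    ultimately show ?thesis by simp
  qed
  ultimately show ?thesis by auto
qed

text \<open>The time at which a component reaches a level is an arrival time of the sum, and its index is the
  first one at which the component is seen to have reached that level.  This is what turns the
  absorption time into an arrival time of the faster clock.\<close>

lemma first_passage_of_component:
  assumes ex: "\<exists>s\<ge>0. k \<le> x s"
  defines "l \<equiv> z (arrival_time x k)"
  shows "k \<le> x (arrival_time z l)" "arrival_time z l = arrival_time x k"
    "\<And>m. m < l \<Longrightarrow> x (arrival_time z m) < k"
proof -
  let ?T = "arrival_time x k"
  have T: "0 \<le> ?T" "k \<le> x ?T"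
    using ex arrival_time_nonneg le_at_arrival_time x by auto
  have le: "arrival_time z l \<le> ?T"
    using simple_path_arrival_time_le_iff[OF z T(1)] l_def by simp
  have "x (arrival_time z l) = x ?T"
    using component_eq_if_sum_eq[OF simple_pathD(4)[OF z] le] simple_pathD(3)[OF z] l_def by simp
  then show 1: "k \<le> x (arrival_time z l)" using T by simp
  then have "?T \<le> arrival_time z l"
    using arrival_time_le_iff[OF x ex simple_pathD(4)[OF z]] by simp
  then show 2: "arrival_time z l = ?T" using le by simp
  fix m assume "m < l"
  then have "arrival_time z m < ?T"
    using simple_path_arrival_time_mono[OF z, of l m] 2 by simp
  then show "x (arrival_time z m) < k"
    using arrival_time_le_iff[OF x ex simple_pathD(4)[OF z, of m]] by simp
qed

end

section \<open>Measurability of arrival times\<close>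

definition counting_process :: "'a measure \<Rightarrow> (real \<Rightarrow> 'a \<Rightarrow> nat) \<Rightarrow> bool" where
  "counting_process F X \<longleftrightarrow>
     (\<forall>t\<ge>0. X t \<in> measurable F (count_space UNIV)) \<and>
     (\<forall>\<omega>\<in>space F. counting_path (\<lambda>t. X t \<omega>))"

lemma counting_process_measurable:
  "counting_process F X \<Longrightarrow> 0 \<le> t \<Longrightarrow> X t \<in> measurable F (count_space UNIV)"
  by (simp add: counting_process_def)

lemma counting_process_path:
  "counting_process F X \<Longrightarrow> \<omega> \<in> space F \<Longrightarrow> counting_path (\<lambda>t. X t \<omega>)"
  by (simp add: counting_process_def)

lemma measurable_nat_add:
  assumes [measurable]: "X \<in> measurable F (count_space UNIV)" "Y \<in> measurable F (count_space UNIV)"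
  shows "(\<lambda>\<omega>. X \<omega> + Y \<omega> :: nat) \<in> measurable F (count_space UNIV)"
  by measurable

lemma counting_process_add:
  "counting_process F X \<Longrightarrow> counting_process F Y \<Longrightarrow> counting_process F (\<lambda>t \<omega>. X t \<omega> + Y t \<omega>)"
  unfolding counting_process_def by (auto intro: counting_path_add measurable_nat_add)

lemma counting_process_sum:
  assumes "finite K" "\<And>k. k \<in> K \<Longrightarrow> counting_process F (X k)"
  shows "counting_process F (\<lambda>t \<omega>. \<Sum>k\<in>K. X k t \<omega>)"
  using assms
proof (induction K rule: finite_induct)
  case empty
  show ?case by (simp add: counting_process_def counting_path_zero)
next
  case (insert k K)
  then show ?case by (simp add: counting_process_add)
qed

lemma counting_process_subalgebra:
  assumes "counting_process F X" "subalgebra P F"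
  shows "counting_process P X"
  using assms measurable_from_subalg[OF assms(2)]
  unfolding counting_process_def subalgebra_def by auto

lemma reached_iff_nat:
  assumes "counting_path x"
  shows "(\<exists>t\<ge>0. l \<le> x t) \<longleftrightarrow> (\<exists>k::nat. l \<le> x (real k))"
proof
  assume "\<exists>t\<ge>0. l \<le> x t"
  then obtain t where "0 \<le> t" "l \<le> x t" by auto
  then have "l \<le> x (real (nat \<lceil>t\<rceil>))"
    using counting_path_mono[OF assms, of t "real (nat \<lceil>t\<rceil>)"] by linarith
  then show "\<exists>k::nat. l \<le> x (real k)" by auto
qed (use of_nat_0_le_iff in blast)

lemma measurable_reached:
  assumes X: "counting_process F X"
  shows "Measurable.pred F (\<lambda>\<omega>. \<exists>t\<ge>0. l \<le> X t \<omega>)"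
proof -
  have [measurable]: "X (real k) \<in> measurable F (count_space UNIV)" for k
    using X by (simp add: counting_process_def)
  have "Measurable.pred F (\<lambda>\<omega>. \<exists>k::nat. l \<le> X (real k) \<omega>)" by measurable
  then show ?thesis
    by (rule measurable_cong[THEN iffD1, rotated])
       (simp add: reached_iff_nat[OF counting_process_path[OF X]])
qed

lemma measurable_arrival:
  assumes X: "counting_process F X"
  shows "arrival X l \<in> borel_measurable F"
proof (rule borel_measurableI_le)
  fix a :: real
  have [measurable]: "Measurable.pred F (\<lambda>\<omega>. \<exists>t\<ge>0. l \<le> X t \<omega>)"
    by (rule measurable_reached[OF X])
  have [measurable]: "X (max 0 a) \<in> measurable F (count_space UNIV)"
    using X by (simp add: counting_process_def)
  have "Measurable.pred F (\<lambda>\<omega>. if \<exists>t\<ge>0. l \<le> X t \<omega> then 0 \<le> a \<and> l \<le> X (max 0 a) \<omega>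
      else Inf ({}::real set) \<le> a)"
    by measurable
  moreover have "arrival X l \<omega> \<le> a \<longleftrightarrow>
      (if \<exists>t\<ge>0. l \<le> X t \<omega> then 0 \<le> a \<and> l \<le> X (max 0 a) \<omega> else Inf ({}::real set) \<le> a)"
    if \<omega>: "\<omega> \<in> space F" for \<omega>
  proof (cases "\<exists>t\<ge>0. l \<le> X t \<omega>")
    case True
    show ?thesis
      using True arrival_time_le_iff[OF counting_process_path[OF X \<omega>] True, of a]
        arrival_time_nonneg[OF True]
      by (cases "0 \<le> a") (auto simp: arrival_eq_arrival_time)
  next
    case False
    then have "{t. 0 \<le> t \<and> l \<le> X t \<omega>} = {}" by auto
    then show ?thesis by (simp only: arrival_def False if_False)
  qed
  ultimately have "Measurable.pred F (\<lambda>\<omega>. arrival X l \<omega> \<le> a)"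
    by (simp cong: measurable_cong)
  then show "{\<omega>\<in>space F. arrival X l \<omega> \<le> a} \<in> sets F" by simp
qed

text \<open>The events \<open>l \<le> X (T \<omega>) \<omega>\<close> and \<open>arrival X l \<omega> \<le> T \<omega>\<close> agree, up to the case that the level \<open>l\<close> is
  never reached.  Hence measurability of the arrival times is all that is required.\<close>

lemma measurable_at_random_time:
  assumes X: "counting_process F X" and T [measurable]: "T \<in> borel_measurable F"
    and T0: "\<And>\<omega>. \<omega> \<in> space F \<Longrightarrow> 0 \<le> T \<omega>"
  shows "(\<lambda>\<omega>. X (T \<omega>) \<omega>) \<in> measurable F (count_space UNIV)"
proof -
  have [measurable]: "Measurable.pred F (\<lambda>\<omega>. \<exists>t\<ge>0. l \<le> X t \<omega>)" for l
    by (rule measurable_reached[OF X])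
  have [measurable]: "arrival X l \<in> borel_measurable F" for l
    by (rule measurable_arrival[OF X])
  have *: "l \<le> X (T \<omega>) \<omega> \<longleftrightarrow> (\<exists>t\<ge>0. l \<le> X t \<omega>) \<and> arrival X l \<omega> \<le> T \<omega>"
    if "\<omega> \<in> space F" for l \<omega>
    using arrival_time_le_iff[OF counting_process_path[OF X that] _ T0[OF that], of l] T0[OF that]
    by (auto simp: arrival_eq_arrival_time)
  have "Measurable.pred F (\<lambda>\<omega>. l \<le> X (T \<omega>) \<omega>)" for l
    by (simp add: * cong: measurable_cong)
  then have [measurable]: "{\<omega>\<in>space F. l \<le> X (T \<omega>) \<omega>} \<in> sets F" for l by simp
  have "{\<omega>\<in>space F. X (T \<omega>) \<omega> = l} =
      {\<omega>\<in>space F. l \<le> X (T \<omega>) \<omega>} - {\<omega>\<in>space F. Suc l \<le> X (T \<omega>) \<omega>}" for l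
    by auto
  then have "(\<lambda>\<omega>. X (T \<omega>) \<omega>) -` {l} \<inter> space F \<in> sets F" for l
    by (simp add: vimage_def Int_def conj_commute)
  then show ?thesis by (simp add: measurable_count_space_eq2_countable)
qed

section \<open>Independent algebras of events and decoupling\<close>

text \<open>Independence of two \<open>\<sigma>\<close>-algebras of events, which are represented by measures of which only the
  measurable sets matter.\<close>

definition indep_algebras :: "'a measure \<Rightarrow> 'a measure \<Rightarrow> 'a measure \<Rightarrow> bool" where
  "indep_algebras P F G \<longleftrightarrow> subalgebra P F \<and> subalgebra P G \<and>
     (\<forall>A\<in>sets F. \<forall>B\<in>sets G. measure P (A \<inter> B) = measure P A * measure P B)"

lemma indep_algebrasD:
  assumes "indep_algebras P F G"
  shows "subalgebra P F" "subalgebra P G"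
    "A \<in> sets F \<Longrightarrow> B \<in> sets G \<Longrightarrow> measure P (A \<inter> B) = measure P A * measure P B"
  using assms by (auto simp: indep_algebras_def)

lemma indep_algebras_sym: "indep_algebras P F G \<Longrightarrow> indep_algebras P G F"
  unfolding indep_algebras_def by (metis Int_commute mult.commute)

context prob_space begin

text \<open>Seen through \<open>F\<close> in the first and through \<open>G\<close> in the second component, the diagonal map is a pair
  of independent random elements, and so its law is the product measure.\<close>

lemma distr_diagonal_eq_pair_measure:
  assumes FG: "indep_algebras M F G"
  shows "distr M (F \<Otimes>\<^sub>M G) (\<lambda>\<omega>. (\<omega>, \<omega>)) = restr_to_subalg M F \<Otimes>\<^sub>M restr_to_subalg M G"
proof -
  note sub = indep_algebrasD(1,2)[OF FG]
  interpret F: prob_space "restr_to_subalg M F"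
    by (rule prob_space_restr_to_subalg[OF sub(1)]) (rule prob_space_axioms)
  interpret G: prob_space "restr_to_subalg M G"
    by (rule prob_space_restr_to_subalg[OF sub(2)]) (rule prob_space_axioms)
  have id: "(\<lambda>\<omega>. \<omega>) \<in> measurable M F" "(\<lambda>\<omega>. \<omega>) \<in> measurable M G"
    using measurable_from_subalg[OF sub(1) measurable_ident]
      measurable_from_subalg[OF sub(2) measurable_ident] by (simp_all add: id_def)
  then have pair: "(\<lambda>\<omega>. (\<omega>, \<omega>)) \<in> measurable M (F \<Otimes>\<^sub>M G)" by measurable
  show ?thesis
  proof (rule sym, rule pair_measure_eqI)
    show "sets (restr_to_subalg M F \<Otimes>\<^sub>M restr_to_subalg M G) =
        sets (distr M (F \<Otimes>\<^sub>M G) (\<lambda>\<omega>. (\<omega>, \<omega>)))"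
      using sub by (simp cong: sets_pair_measure_cong add: sets_restr_to_subalg)
    fix A B assume "A \<in> sets (restr_to_subalg M F)" "B \<in> sets (restr_to_subalg M G)"
    then have A: "A \<in> sets F" and B: "B \<in> sets G"
      using sub by (auto simp: sets_restr_to_subalg)
    have AB: "A \<in> sets M" "B \<in> sets M" using A B sub by (auto simp: subalgebra_def)
    have "(\<lambda>\<omega>. (\<omega>, \<omega>)) -` (A \<times> B) \<inter> space M = A \<inter> B"
      using AB sets.sets_into_space by auto
    then show "emeasure (restr_to_subalg M F) A * emeasure (restr_to_subalg M G) B =
        emeasure (distr M (F \<Otimes>\<^sub>M G) (\<lambda>\<omega>. (\<omega>, \<omega>))) (A \<times> B)"
      using A B AB pair
      by (simp add: emeasure_distr emeasure_restr_to_subalg[OF sub(1)]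
          emeasure_restr_to_subalg[OF sub(2)] emeasure_eq_measure indep_algebrasD(3)[OF FG]
          ennreal_mult)
  qed (rule F.sigma_finite_measure G.sigma_finite_measure)+
qed

text \<open>Fubini's theorem for independent \<open>\<sigma>\<close>-algebras: the second occurrence of the sample point may be
  replaced by an independent copy.  It serves as a substitute for conditioning on \<open>F\<close>.\<close>

lemma decoupling:
  assumes FG: "indep_algebras M F G"
    and f: "(\<lambda>(\<omega>, \<omega>'). f \<omega> \<omega>') \<in> borel_measurable (F \<Otimes>\<^sub>M G)"
  shows "(\<integral>\<^sup>+\<omega>. f \<omega> \<omega> \<partial>M) = (\<integral>\<^sup>+\<omega>. \<integral>\<^sup>+\<omega>'. f \<omega> \<omega>' \<partial>M \<partial>M)"
proof -
  note sub = indep_algebrasD(1,2)[OF FG]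
  interpret F: prob_space "restr_to_subalg M F"
    by (rule prob_space_restr_to_subalg[OF sub(1)]) (rule prob_space_axioms)
  interpret G: prob_space "restr_to_subalg M G"
    by (rule prob_space_restr_to_subalg[OF sub(2)]) (rule prob_space_axioms)
  have id: "(\<lambda>\<omega>. \<omega>) \<in> measurable M F" "(\<lambda>\<omega>. \<omega>) \<in> measurable M G"
    using measurable_from_subalg[OF sub(1) measurable_ident]
      measurable_from_subalg[OF sub(2) measurable_ident] by (simp_all add: id_def)
  then have pair: "(\<lambda>\<omega>. (\<omega>, \<omega>)) \<in> measurable M (F \<Otimes>\<^sub>M G)" by measurable
  have f': "(\<lambda>(\<omega>, \<omega>'). f \<omega> \<omega>') \<in>
      borel_measurable (restr_to_subalg M F \<Otimes>\<^sub>M restr_to_subalg M G)"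
    using f sub
    by (simp add: sets_restr_to_subalg cong: measurable_cong_sets sets_pair_measure_cong)
  have fG: "f \<omega> \<in> borel_measurable G" if "\<omega> \<in> space M" for \<omega>
    using measurable_Pair2[OF f, of \<omega>] that sub by (simp add: subalgebra_def)
  have inner: "(\<integral>\<^sup>+\<omega>'. f \<omega> \<omega>' \<partial>restr_to_subalg M G) = (\<integral>\<^sup>+\<omega>'. f \<omega> \<omega>' \<partial>M)"
    if "\<omega> \<in> space M" for \<omega>
    by (rule nn_integral_subalgebra2[OF sub(2) fG[OF that]])
  have outer: "(\<lambda>\<omega>. \<integral>\<^sup>+\<omega>'. f \<omega> \<omega>' \<partial>restr_to_subalg M G) \<in> borel_measurable F"
    using G.borel_measurable_nn_integral[OF f'] sub
    by (simp add: sets_restr_to_subalg cong: measurable_cong_sets)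
  have "(\<integral>\<^sup>+\<omega>. f \<omega> \<omega> \<partial>M) = (\<integral>\<^sup>+z. (\<lambda>(\<omega>, \<omega>'). f \<omega> \<omega>') z \<partial>distr M (F \<Otimes>\<^sub>M G) (\<lambda>\<omega>. (\<omega>, \<omega>)))"
    using f by (subst nn_integral_distr[OF pair]) simp_all
  also have "\<dots> = (\<integral>\<^sup>+z. (\<lambda>(\<omega>, \<omega>'). f \<omega> \<omega>') z \<partial>(restr_to_subalg M F \<Otimes>\<^sub>M restr_to_subalg M G))"
    by (simp only: distr_diagonal_eq_pair_measure[OF FG])
  also have "\<dots> = (\<integral>\<^sup>+\<omega>. \<integral>\<^sup>+\<omega>'. f \<omega> \<omega>' \<partial>restr_to_subalg M G \<partial>restr_to_subalg M F)"
    by (subst G.nn_integral_fst[OF f', symmetric]) simp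
  also have "\<dots> = (\<integral>\<^sup>+\<omega>. \<integral>\<^sup>+\<omega>'. f \<omega> \<omega>' \<partial>restr_to_subalg M G \<partial>M)"
    by (rule nn_integral_subalgebra2[OF sub(1) outer])
  also have "\<dots> = (\<integral>\<^sup>+\<omega>. \<integral>\<^sup>+\<omega>'. f \<omega> \<omega>' \<partial>M \<partial>M)"
    by (intro nn_integral_cong inner)
  finally show ?thesis .
qed

lemma decoupling_event:
  assumes FG: "indep_algebras M F G"
    and Q: "Measurable.pred (F \<Otimes>\<^sub>M G) (\<lambda>(\<omega>, \<omega>'). Q \<omega> \<omega>')"
  shows "emeasure M {\<omega>\<in>space M. Q \<omega> \<omega>} = (\<integral>\<^sup>+\<omega>. emeasure M {\<omega>'\<in>space M. Q \<omega> \<omega>'} \<partial>M)"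
proof -
  note sub = indep_algebrasD(1,2)[OF FG]
  have id: "(\<lambda>\<omega>. \<omega>) \<in> measurable M F" "(\<lambda>\<omega>. \<omega>) \<in> measurable M G"
    using measurable_from_subalg[OF sub(1) measurable_ident]
      measurable_from_subalg[OF sub(2) measurable_ident] by (simp_all add: id_def)
  then have pair: "(\<lambda>\<omega>. (\<omega>, \<omega>)) \<in> measurable M (F \<Otimes>\<^sub>M G)" by measurable
  have 1: "{\<omega>\<in>space M. Q \<omega> \<omega>} \<in> sets M"
    using measurable_compose[OF pair Q] by (simp add: pred_def)
  have 2: "{\<omega>'\<in>space M. Q \<omega> \<omega>'} \<in> sets M" if "\<omega> \<in> space M" for \<omega>
    using measurable_compose[OF id(2) measurable_Pair2[OF Q, of \<omega>]] that sub
    by (simp add: pred_def subalgebra_def)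
  have Qi: "(\<lambda>(\<omega>, \<omega>'). indicator {z. Q (fst z) (snd z)} (\<omega>, \<omega>') :: ennreal) \<in>
      borel_measurable (F \<Otimes>\<^sub>M G)"
    using Q by (simp add: case_prod_beta' borel_measurable_indicator_iff pred_def Int_def conj_commute
        space_pair_measure)
  have "emeasure M {\<omega>\<in>space M. Q \<omega> \<omega>} =
      (\<integral>\<^sup>+\<omega>. indicator {z. Q (fst z) (snd z)} (\<omega>, \<omega>) \<partial>M)"
    by (subst nn_integral_indicator[OF 1, symmetric]) (auto intro!: nn_integral_cong split: split_indicator)
  also have "\<dots> = (\<integral>\<^sup>+\<omega>. \<integral>\<^sup>+\<omega>'. indicator {z. Q (fst z) (snd z)} (\<omega>, \<omega>') \<partial>M \<partial>M)"
    by (rule decoupling[OF FG Qi])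
  also have "\<dots> = (\<integral>\<^sup>+\<omega>. emeasure M {\<omega>'\<in>space M. Q \<omega> \<omega>'} \<partial>M)"
  proof (rule nn_integral_cong)
    fix \<omega> assume "\<omega> \<in> space M"
    then show "(\<integral>\<^sup>+\<omega>'. indicator {z. Q (fst z) (snd z)} (\<omega>, \<omega>') \<partial>M) =
        emeasure M {\<omega>'\<in>space M. Q \<omega> \<omega>'}"
      by (subst nn_integral_indicator[OF 2, symmetric])
        (auto intro!: nn_integral_cong split: split_indicator)
  qed
  finally show ?thesis .
qed

end

text \<open>The \<open>\<sigma>\<close>-algebra generated by a group of sources of randomness.  Disjoint groups of independent
  sources generate independent \<open>\<sigma>\<close>-algebras.\<close>

definition source_algebra :: "'a measure \<Rightarrow> ('i \<Rightarrow> 'a set set) \<Rightarrow> 'i set \<Rightarrow> 'a measure" where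
  "source_algebra P E A = sigma (space P) (\<Union>i\<in>A. E i)"

lemma space_source_algebra [simp]: "space (source_algebra P E A) = space P"
  by (simp add: source_algebra_def space_measure_of_conv)

lemma (in prob_space) sets_source_algebra:
  assumes "indep_sets E I" "A \<subseteq> I"
  shows "sets (source_algebra M E A) = sigma_sets (space M) (\<Union>i\<in>A. E i)"
proof -
  have "E i \<subseteq> Pow (space M)" if "i \<in> A" for i
  proof -
    have "E i \<subseteq> events" using assms that unfolding indep_sets_def by blast
    then show ?thesis using sets.space_closed by blast
  qed
  then show ?thesis unfolding source_algebra_def by (intro sets_measure_of) blast
qed

lemma (in prob_space) subalgebra_source_algebra:
  assumes "indep_sets E I" "A \<subseteq> I"
  shows "subalgebra M (source_algebra M E A)"
proof -
  have "(\<Union>i\<in>A. E i) \<subseteq> events" using assms by (auto simp: indep_sets_def)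
  then show ?thesis
    by (simp add: subalgebra_def sets_source_algebra[OF assms] sets.sigma_sets_subset)
qed

lemma (in prob_space) indep_algebras_source_algebra:
  assumes E: "indep_sets E I" and stable: "\<And>i. i \<in> I \<Longrightarrow> Int_stable (E i)"
    and AB: "A \<subseteq> I" "B \<subseteq> I" "A \<inter> B = {}"
  shows "indep_algebras M (source_algebra M E A) (source_algebra M E B)"
proof -
  define J where "J b = (if b then A else B)" for b
  have "indep_sets E (\<Union>b\<in>UNIV. J b)"
    by (rule indep_sets_mono_index[OF _ E]) (use AB in \<open>auto simp: J_def split: if_splits\<close>)
  then have *: "indep_sets (\<lambda>b. sigma_sets (space M) (\<Union>i\<in>J b. E i)) UNIV"
    by (rule indep_sets_collect_sigma)
      (use AB stable in \<open>auto simp: J_def disjoint_family_on_def split: if_splits\<close>)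
  show ?thesis
    unfolding indep_algebras_def
  proof (intro conjI ballI subalgebra_source_algebra[OF E] AB)
    fix a b assume "a \<in> sets (source_algebra M E A)" "b \<in> sets (source_algebra M E B)"
    then have "\<forall>c\<in>UNIV. (if c then a else b) \<in> sigma_sets (space M) (\<Union>i\<in>J c. E i)"
      by (auto simp: J_def sets_source_algebra[OF E] AB)
    from indep_setsD[OF *, of UNIV "\<lambda>c. if c then a else b", OF _ _ _ this]
    show "prob (a \<inter> b) = prob a * prob b"
      by (simp add: UNIV_bool Int_commute mult.commute)
  qed
qed

lemma source_algebra_mono:
  assumes "A \<subseteq> B" "\<And>i. i \<in> B \<Longrightarrow> E i \<subseteq> Pow (space P)"
  shows "subalgebra (source_algebra P E B) (source_algebra P E A)"
proof -
  have "(\<Union>i\<in>A. E i) \<subseteq> (\<Union>i\<in>B. E i)" "(\<Union>i\<in>B. E i) \<subseteq> Pow (space P)" using assms by blast+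
  then show ?thesis
    unfolding subalgebra_def source_algebra_def
    by (simp add: space_measure_of_conv sigma_sets_mono')
qed

section \<open>Processes with Poisson increments\<close>

definition poisson_weight :: "real \<Rightarrow> nat \<Rightarrow> real" where
  "poisson_weight m d = m ^ d / fact d * exp (- m)"

lemma poisson_weight_nonneg: "0 \<le> m \<Longrightarrow> 0 \<le> poisson_weight m d"
  by (simp add: poisson_weight_def)

lemma poisson_weight_rate_0: "poisson_weight 0 d = (if d = 0 then 1 else 0)"
  by (simp add: poisson_weight_def power_0_left)

lemma poisson_weight_sums: "poisson_weight m sums 1"
proof -
  have "(\<lambda>d. m ^ d /\<^sub>R fact d * exp (- m)) sums (exp m * exp (- m))"
    by (intro sums_mult2 exp_converges)
  then show ?thesis
    by (simp add: poisson_weight_def[abs_def] exp_minus scaleR_conv_of_real divide_inverse mult_ac)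
qed

lemma poisson_weight_convolution:
  "(\<Sum>e\<le>d. poisson_weight a e * poisson_weight b (d - e)) = poisson_weight (a + b) d"
proof -
  have "(\<Sum>e\<le>d. poisson_weight a e * poisson_weight b (d - e)) =
      (\<Sum>e\<le>d. of_nat (d choose e) * a ^ e * b ^ (d - e)) / fact d * exp (- (a + b))"
    unfolding sum_distrib_right sum_divide_distrib
  proof (intro sum.cong refl)
    fix e assume "e \<in> {..d}"
    then have "(of_nat (d choose e) :: real) = fact d / (fact e * fact (d - e))"
      by (simp add: binomial_fact)
    then show "poisson_weight a e * poisson_weight b (d - e) =
        of_nat (d choose e) * a ^ e * b ^ (d - e) / fact d * exp (- (a + b))"
      by (simp add: poisson_weight_def exp_add[symmetric] field_simps)
  qed
  then show ?thesis by (simp add: poisson_weight_def binomial_ring)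
qed

text \<open>Stationary independent Poisson increments, stated for finitely many times that may coincide.
  The rate may be zero, as is needed for the empty superposition when \<open>n = \<lambda>\<^sub>0\<close>.\<close>

definition poisson_increments :: "'a measure \<Rightarrow> real \<Rightarrow> (real \<Rightarrow> 'a \<Rightarrow> nat) \<Rightarrow> bool" where
  "poisson_increments P r X \<longleftrightarrow>
     (\<forall>(k::nat) t d. 0 \<le> t 0 \<and> (\<forall>i<k. t i \<le> t (Suc i)) \<longrightarrow>
        measure P {\<omega>\<in>space P. \<forall>i<k. X (t (Suc i)) \<omega> = X (t i) \<omega> + d i} =
        (\<Prod>i<k. poisson_weight (r * (t (Suc i) - t i)) (d i)))"

lemma poisson_incrementsD:
  assumes "poisson_increments P r X" "0 \<le> t 0" "\<And>i. i < k \<Longrightarrow> t i \<le> t (Suc i)"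
  shows "measure P {\<omega>\<in>space P. \<forall>i<k. X (t (Suc i)) \<omega> = X (t i) \<omega> + d i} =
        (\<Prod>i<k. poisson_weight (r * (t (Suc i) - t i)) (d i))"
  using assms by (simp add: poisson_increments_def)

lemma poisson_process_counting_process:
  "poisson_process P r N \<Longrightarrow> counting_process P N"
  by (simp add: poisson_process_def counting_process_def counting_path_def)

lemma nondecreasing_times_nonneg:
  fixes t :: "nat \<Rightarrow> real"
  assumes "0 \<le> t 0" "\<And>i. i < k \<Longrightarrow> t i \<le> t (Suc i)" "i \<le> k"
  shows "0 \<le> t i"
  using assms(3) by (induction i) (use assms(1,2) in \<open>auto intro: order_trans\<close>)

context prob_space begin

lemma poisson_process_increments:
  assumes N: "poisson_process M r N"
  shows "poisson_increments M r N"
  unfolding poisson_increments_def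
proof (intro allI impI, elim conjE)
  fix k :: nat and t :: "nat \<Rightarrow> real" and d :: "nat \<Rightarrow> nat"
  assume t: "0 \<le> t 0" "\<forall>i<k. t i \<le> t (Suc i)"
  note cp = poisson_process_counting_process[OF N]
  have t0: "0 \<le> t i" if "i \<le> k" for i using nondecreasing_times_nonneg[of t k i] t that by auto
  \<comment> \<open>The definition of a Poisson process speaks of infinitely many times, which may coincide; the given
    times are continued by a constant.\<close>
  define s where "s i = t (min i k)" for i
  have s: "0 \<le> s 0" "mono s"
    using t by (auto simp: s_def min_def mono_iff_le_Suc Suc_le_eq le_Suc_eq)
  define D where "D i \<omega> = N (s (Suc i)) \<omega> - N (s i) \<omega>" for i \<omega>
  have indep: "indep_vars (\<lambda>_. count_space UNIV) D UNIV"
    using N s by (simp add: poisson_process_def D_def[abs_def])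
  have single: "prob (D i -` {d i} \<inter> space M) = poisson_weight (r * (t (Suc i) - t i)) (d i)"
    if i: "i < k" for i
  proof (cases "t i < t (Suc i)")
    case True
    have Di: "D i = (\<lambda>\<omega>. N (t (Suc i)) \<omega> - N (t i) \<omega>)" using i by (simp add: D_def[abs_def] s_def)
    have [measurable]: "D i \<in> measurable M (count_space UNIV)"
      using indep by (auto simp: indep_vars_def)
    have r: "0 < r" using N by (simp add: poisson_process_def)
    have "distr M (count_space UNIV) (D i) = measure_pmf (poisson_pmf (r * (t (Suc i) - t i)))"
      using N True t0[of i] i by (simp add: poisson_process_def Di)
    then have "measure (distr M (count_space UNIV) (D i)) {d i} =
        measure (measure_pmf (poisson_pmf (r * (t (Suc i) - t i)))) {d i}" by simp
    then show ?thesis using True r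
      by (simp add: measure_distr measure_pmf_single poisson_weight_def)
  next
    case False
    then have "t (Suc i) = t i" using t i by force
    then have "D i -` {d i} \<inter> space M = (if d i = 0 then space M else {})"
      using i by (auto simp: D_def s_def)
    then show ?thesis using \<open>t (Suc i) = t i\<close> by (simp add: poisson_weight_rate_0 prob_space)
  qed
  show "prob {\<omega>\<in>space M. \<forall>i<k. N (t (Suc i)) \<omega> = N (t i) \<omega> + d i} =
      (\<Prod>i<k. poisson_weight (r * (t (Suc i) - t i)) (d i))"
  proof (cases "k = 0")
    case True
    then show ?thesis by (simp add: prob_space)
  next
    case False
    have "{\<omega>\<in>space M. \<forall>i<k. N (t (Suc i)) \<omega> = N (t i) \<omega> + d i} =
        (\<Inter>i\<in>{..<k}. D i -` {d i} \<inter> space M)"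
    proof -
      have "N (t (Suc i)) \<omega> = N (t i) \<omega> + d i \<longleftrightarrow> D i \<omega> = d i"
        if "\<omega> \<in> space M" "i < k" for \<omega> i
        using counting_path_mono[OF counting_process_path[OF cp that(1)], of "t i" "t (Suc i)"]
          t t0[of i] that(2)
        by (auto simp: D_def s_def)
      then show ?thesis using False by auto
    qed
    also have "prob \<dots> = (\<Prod>i<k. prob (D i -` {d i} \<inter> space M))"
      using False by (intro indep_varsD[OF indep]) auto
    finally show ?thesis using single by simp
  qed
qed

lemma poisson_increments_zero: "poisson_increments M 0 (\<lambda>t \<omega>. 0)"
  unfolding poisson_increments_def
proof (intro allI impI)
  fix k :: nat and t :: "nat \<Rightarrow> real" and d :: "nat \<Rightarrow> nat"
  have "(\<Prod>i<k. if d i = 0 then 1 else 0 :: real) = (if \<forall>i<k. d i = 0 then 1 else 0)"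
    by (induction k) (auto simp: less_Suc_eq)
  moreover have "{\<omega> \<in> space M. \<forall>i<k. 0 = 0 + d i} = (if \<forall>i<k. d i = 0 then space M else {})"
    by auto
  ultimately show "prob {\<omega> \<in> space M. \<forall>i<k. 0 = 0 + d i} =
      (\<Prod>i<k. poisson_weight (0 * (t (Suc i) - t i)) (d i))"
    by (simp add: poisson_weight_rate_0 prob_space)
qed

lemma pred_eq_add_const:
  assumes [measurable]: "A \<in> measurable F (count_space UNIV)" "B \<in> measurable F (count_space UNIV)"
  shows "Measurable.pred F (\<lambda>\<omega>. A \<omega> = B \<omega> + (d :: nat))"
proof -
  have "Measurable.pred F (\<lambda>\<omega>. \<exists>b. B \<omega> = b \<and> A \<omega> = b + d)" by measurable
  then show ?thesis by simp
qed

lemma pred_ge_add_const: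
  assumes [measurable]: "A \<in> measurable F (count_space UNIV)" "B \<in> measurable F (count_space UNIV)"
  shows "Measurable.pred F (\<lambda>\<omega>. A \<omega> \<ge> B \<omega> + (d :: nat))"
proof -
  have "Measurable.pred F (\<lambda>\<omega>. \<exists>b. B \<omega> = b \<and> A \<omega> \<ge> b + d)" by measurable
  then show ?thesis by simp
qed

lemma counting_process_increment_event:
  assumes X: "counting_process F X"
    and t: "0 \<le> t 0" "\<And>i. i < k \<Longrightarrow> t i \<le> t (Suc i)"
  shows "{\<omega>\<in>space F. \<forall>i<(k::nat). X (t (Suc i)) \<omega> = X (t i) \<omega> + d i} \<in> sets F"
proof -
  have Xt: "X (t i) \<in> measurable F (count_space UNIV)" if "i \<le> k" for i
    by (rule counting_process_measurable[OF X nondecreasing_times_nonneg[OF t that]])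
  have *: "Measurable.pred F (\<lambda>\<omega>. X (t (Suc i)) \<omega> = X (t i) \<omega> + d i)" if "i < k" for i
  proof -
    have [measurable]: "X (t (Suc i)) \<in> measurable F (count_space UNIV)"
      "X (t i) \<in> measurable F (count_space UNIV)"
      using Xt[of "Suc i"] Xt[of i] that by auto
    then show ?thesis by (rule pred_eq_add_const)
  qed
  have "{\<omega>\<in>space F. \<forall>i\<in>{..<k}. X (t (Suc i)) \<omega> = X (t i) \<omega> + d i} \<in> sets F"
    by (rule sets.sets_Collect_finite_All) (use * in \<open>auto simp: pred_def\<close>)
  then show ?thesis by (simp only: Ball_def lessThan_iff)
qed

lemma poisson_increments_joint:
  assumes FG: "indep_algebras M F G"
    and X: "counting_process F X" "poisson_increments M a X"
    and Y: "counting_process G Y" "poisson_increments M b Y"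
    and t: "0 \<le> t 0" "\<And>i. i < k \<Longrightarrow> t i \<le> t (Suc i)"
  shows "prob {\<omega>\<in>space M. \<forall>i<k. X (t (Suc i)) \<omega> = X (t i) \<omega> + d i \<and>
        Y (t (Suc i)) \<omega> = Y (t i) \<omega> + e i} =
      (\<Prod>i<k. poisson_weight (a * (t (Suc i) - t i)) (d i) * poisson_weight (b * (t (Suc i) - t i)) (e i))"
proof -
  let ?A = "{\<omega>\<in>space M. \<forall>i<k. X (t (Suc i)) \<omega> = X (t i) \<omega> + d i}"
  let ?B = "{\<omega>\<in>space M. \<forall>i<k. Y (t (Suc i)) \<omega> = Y (t i) \<omega> + e i}"
  have "space F = space M" "space G = space M"
    using indep_algebrasD(1,2)[OF FG] by (simp_all add: subalgebra_def)
  then have "?A \<in> sets F" "?B \<in> sets G"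
    using counting_process_increment_event[OF X(1) t, where d = d]
      counting_process_increment_event[OF Y(1) t, where d = e] by (simp_all only:)
  then have "prob (?A \<inter> ?B) = prob ?A * prob ?B" by (rule indep_algebrasD(3)[OF FG])
  moreover have "{\<omega>\<in>space M. \<forall>i<k. X (t (Suc i)) \<omega> = X (t i) \<omega> + d i \<and>
        Y (t (Suc i)) \<omega> = Y (t i) \<omega> + e i} = ?A \<inter> ?B" by auto
  ultimately show ?thesis
    by (simp add: poisson_incrementsD[OF X(2) t] poisson_incrementsD[OF Y(2) t] prod.distrib)
qed

text \<open>A prescribed increment of the sum splits in finitely many ways into increments of the summands; the
  probabilities of these disjoint events add up to a convolution of Poisson weights.\<close>

lemma poisson_increments_add:
  assumes FG: "indep_algebras M F G"
    and X: "counting_process F X" "poisson_increments M a X"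
    and Y: "counting_process G Y" "poisson_increments M b Y"
  shows "poisson_increments M (a + b) (\<lambda>t \<omega>. X t \<omega> + Y t \<omega>)"
  unfolding poisson_increments_def
proof (intro allI impI, elim conjE)
  fix k :: nat and t :: "nat \<Rightarrow> real" and d :: "nat \<Rightarrow> nat"
  assume t': "0 \<le> t 0" "\<forall>i<k. t i \<le> t (Suc i)"
  then have t: "0 \<le> t 0" "\<And>i. i < k \<Longrightarrow> t i \<le> t (Suc i)" by auto
  note sub = indep_algebrasD(1,2)[OF FG]
  define A where "A e = {\<omega>\<in>space M. \<forall>i<k. X (t (Suc i)) \<omega> = X (t i) \<omega> + e i \<and>
        Y (t (Suc i)) \<omega> = Y (t i) \<omega> + (d i - e i)}" for e
  define I where "I = PiE {..<k} (\<lambda>i. {..d i})"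
  have A: "A e \<in> sets M" for e
  proof -
    have "A e = {\<omega>\<in>space M. \<forall>i<k. X (t (Suc i)) \<omega> = X (t i) \<omega> + e i} \<inter>
        {\<omega>\<in>space M. \<forall>i<k. Y (t (Suc i)) \<omega> = Y (t i) \<omega> + (d i - e i)}"
      by (auto simp: A_def)
    then show ?thesis
      using sets.Int[OF
          counting_process_increment_event[OF counting_process_subalgebra[OF X(1) sub(1)] t]
          counting_process_increment_event[OF counting_process_subalgebra[OF Y(1) sub(2)] t]]
      by (simp only:)
  qed
  have "{\<omega>\<in>space M. \<forall>i<k. X (t (Suc i)) \<omega> + Y (t (Suc i)) \<omega> = X (t i) \<omega> + Y (t i) \<omega> + d i} =
      (\<Union>e\<in>I. A e)" (is "?L = _")
  proof (intro set_eqI iffI)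
    fix \<omega> assume \<omega>: "\<omega> \<in> ?L"
    define e where "e = restrict (\<lambda>i. X (t (Suc i)) \<omega> - X (t i) \<omega>) {..<k}"
    have "X (t (Suc i)) \<omega> = X (t i) \<omega> + e i \<and> Y (t (Suc i)) \<omega> = Y (t i) \<omega> + (d i - e i) \<and> e i \<le> d i"
      if i: "i < k" for i
    proof -
      have "\<omega> \<in> space F" "\<omega> \<in> space G" using \<omega> sub by (auto simp: subalgebra_def)
      then have "X (t i) \<omega> \<le> X (t (Suc i)) \<omega>" "Y (t i) \<omega> \<le> Y (t (Suc i)) \<omega>"
        using counting_path_mono[OF counting_process_path[OF X(1)], of \<omega> "t i" "t (Suc i)"]
          counting_path_mono[OF counting_process_path[OF Y(1)], of \<omega> "t i" "t (Suc i)"]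
          nondecreasing_times_nonneg[OF t, of i] t(2)[OF i] i by auto
      moreover have "X (t (Suc i)) \<omega> + Y (t (Suc i)) \<omega> = X (t i) \<omega> + Y (t i) \<omega> + d i"
        using \<omega> i by auto
      ultimately show ?thesis using i unfolding e_def restrict_def lessThan_iff if_P[OF i] by linarith
    qed
    then have "\<omega> \<in> A e" "e \<in> I" using \<omega> by (auto simp: A_def I_def e_def)
    then show "\<omega> \<in> (\<Union>e\<in>I. A e)" by auto
  next
    fix \<omega> assume "\<omega> \<in> (\<Union>e\<in>I. A e)"
    then obtain e where e: "e \<in> I" "\<omega> \<in> A e" by auto
    have "e i \<le> d i" if "i < k" for i using e that by (auto simp: I_def PiE_def Pi_def)
    then show "\<omega> \<in> ?L" using e by (force simp: A_def)
  qed
  moreover have "prob (\<Union>e\<in>I. A e) = (\<Sum>e\<in>I. prob (A e))"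
  proof (rule finite_measure_finite_Union)
    show "finite I" unfolding I_def by (intro finite_PiE) auto
    show "A ` I \<subseteq> events" using A by auto
    show "disjoint_family_on A I"
      unfolding disjoint_family_on_def
    proof (intro ballI impI)
      fix e f assume ef: "e \<in> I" "f \<in> I" "e \<noteq> f"
      have "e = f" if "\<omega> \<in> A e \<inter> A f" for \<omega>
      proof (rule PiE_ext)
        show "e \<in> PiE {..<k} (\<lambda>i. {..d i})" "f \<in> PiE {..<k} (\<lambda>i. {..d i})" using ef by (auto simp: I_def)
        show "e i = f i" if "i \<in> {..<k}" for i using \<open>\<omega> \<in> A e \<inter> A f\<close> that by (auto simp: A_def)
      qed
      then show "A e \<inter> A f = {}" using ef by blast
    qed
  qed
  moreover have "(\<Sum>e\<in>I. prob (A e)) =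
      (\<Sum>e\<in>I. \<Prod>i<k. poisson_weight (a * (t (Suc i) - t i)) (e i) *
        poisson_weight (b * (t (Suc i) - t i)) (d i - e i))"
    unfolding A_def by (intro sum.cong refl poisson_increments_joint[OF FG X Y t])
  moreover have "\<dots> = (\<Prod>i<k. \<Sum>e\<le>d i. poisson_weight (a * (t (Suc i) - t i)) e *
        poisson_weight (b * (t (Suc i) - t i)) (d i - e))"
    unfolding I_def by (rule prod_sum_PiE[symmetric]) auto
  ultimately show "prob {\<omega>\<in>space M. \<forall>i<k. X (t (Suc i)) \<omega> + Y (t (Suc i)) \<omega> =
        X (t i) \<omega> + Y (t i) \<omega> + d i} =
      (\<Prod>i<k. poisson_weight ((a + b) * (t (Suc i) - t i)) (d i))"
    by (simp add: poisson_weight_convolution distrib_right)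
qed

lemma poisson_increments_single:
  assumes "poisson_increments M r X" "0 \<le> s" "s \<le> t"
  shows "prob {\<omega>\<in>space M. X t \<omega> = X s \<omega> + d} = poisson_weight (r * (t - s)) d"
  using poisson_incrementsD[OF assms(1), of "\<lambda>i. if i = 0 then s else t" 1 "\<lambda>_. d"] assms by simp

lemma poisson_increments_at:
  assumes "poisson_increments M r X" "counting_process M X" "0 \<le> t"
  shows "prob {\<omega>\<in>space M. X t \<omega> = d} = poisson_weight (r * t) d"
proof -
  have "{\<omega>\<in>space M. X t \<omega> = d} = {\<omega>\<in>space M. X t \<omega> = X 0 \<omega> + d}"
    using counting_process_path[OF assms(2)] by (auto simp: counting_path_def)
  then show ?thesis using poisson_increments_single[OF assms(1), of 0 t d] assms(3) by simp
qed

lemma poisson_reaches_every_level: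
  assumes r: "0 < r" and inc: "poisson_increments M r X" and X: "counting_process M X"
  shows "AE \<omega> in M. \<forall>l. \<exists>t\<ge>0. l \<le> X t \<omega>"
  unfolding AE_all_countable
proof
  fix l
  have [measurable]: "X (real k) \<in> measurable M (count_space UNIV)" for k
    using X by (simp add: counting_process_def)
  \<comment> \<open>Staying below \<open>l\<close> up to time \<open>k\<close> has a probability that vanishes as \<open>k\<close> grows.\<close>
  let ?B = "{\<omega>\<in>space M. \<forall>k::nat. X (real k) \<omega> < l}"
  have B: "?B \<in> sets M" by measurable
  have le: "prob ?B \<le> (\<Sum>d<l. poisson_weight (r * real k) d)" for k
  proof -
    have "prob ?B \<le> prob (\<Union>d<l. {\<omega>\<in>space M. X (real k) \<omega> = d})"
      by (intro finite_measure_mono) auto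
    also have "\<dots> \<le> (\<Sum>d<l. prob {\<omega>\<in>space M. X (real k) \<omega> = d})"
      by (intro finite_measure_subadditive_finite) auto
    also have "\<dots> = (\<Sum>d<l. poisson_weight (r * real k) d)"
      by (simp add: poisson_increments_at[OF inc X])
    finally show ?thesis .
  qed
  have "(\<lambda>k. poisson_weight (r * real k) d) \<longlonglongrightarrow> 0" for d
  proof -
    have "filterlim (\<lambda>k. r * real k) at_top sequentially"
      using r by (intro filterlim_tendsto_pos_mult_at_top[OF tendsto_const]) (auto simp: filterlim_real_sequentially)
    from filterlim_compose[OF tendsto_power_div_exp_0 this, of d]
    have "(\<lambda>k. (r * real k) ^ d / exp (r * real k) / fact d) \<longlonglongrightarrow> 0 / fact d"
      by (intro tendsto_divide) auto
    then show ?thesis by (simp add: poisson_weight_def exp_minus field_simps)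
  qed
  then have "(\<lambda>k. \<Sum>d<l. poisson_weight (r * real k) d) \<longlonglongrightarrow> (\<Sum>d<l. 0)"
    by (rule tendsto_sum)
  then have "prob ?B \<le> 0" by (intro LIMSEQ_le_const[of _ _ "prob ?B"]) (use le in auto)
  then have "emeasure M ?B = 0" by (simp add: emeasure_eq_measure measure_le_0_iff)
  moreover have "{\<omega>\<in>space M. \<not> (\<exists>t\<ge>0. l \<le> X t \<omega>)} \<subseteq> ?B"
    using of_nat_0_le_iff not_le by blast
  ultimately show "AE \<omega> in M. \<exists>t\<ge>0. l \<le> X t \<omega>" using B by (intro AE_I)
qed

lemma poisson_weight_ge_2:
  assumes "0 \<le> x" shows "1 - poisson_weight x 0 - poisson_weight x 1 \<le> x\<^sup>2"
proof -
  have "(1 - x) * (1 + x) \<le> exp (- x) * (1 + x)"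
    using assms exp_ge_add_one_self[of "- x"] by (intro mult_right_mono) auto
  then show ?thesis by (simp add: poisson_weight_def algebra_simps power2_eq_square)
qed

text \<open>A jump of height two or more puts an increment of at least two into some cell of every
  grid; on a grid of mesh \<open>1 / m\<close> over \<open>[0, K]\<close> this has probability at most
  \<open>K m (r / m)\<^sup>2\<close>, which tends to zero.\<close>

lemma poisson_simple_path:
  assumes r: "0 < r" and inc: "poisson_increments M r X" and X: "counting_process M X"
  shows "AE \<omega> in M. simple_path (\<lambda>t. X t \<omega>)"
proof -
  have Xm: "X (real i / real m) \<in> measurable M (count_space UNIV)" for i m
    using X by (simp add: counting_process_def)
  \<comment> \<open>\<open>C i m\<close>: the increment over cell \<open>i\<close> of the grid is at least two; \<open>B K m\<close>: this happens in some cell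
    of \<open>[0, K]\<close>.\<close>
  define C where "C i m = {\<omega>\<in>space M. X (real (Suc i) / real m) \<omega> \<ge> X (real i / real m) \<omega> + 2}"
    for i m :: nat
  define B where "B K m = (\<Union>i<K * m. C i m)" for K m :: nat
  have C: "C i m \<in> sets M" for i m
    using pred_ge_add_const[OF Xm[of "Suc i" m] Xm[of i m]] unfolding C_def pred_def .
  then have B [measurable]: "B K m \<in> sets M" for K m
    unfolding B_def by blast
  have Ble: "prob (B K m) \<le> real K * r\<^sup>2 / real m" if m: "0 < m" for K m
  proof -
    have step: "r * (real (Suc i) / real m - real i / real m) = r / real m" for i
      by (simp add: diff_divide_distrib[symmetric])
    have cell: "prob (C i m) \<le> (r / real m)\<^sup>2" for i
    proof -
      let ?E = "\<lambda>d. {\<omega>\<in>space M. X (real (Suc i) / real m) \<omega> = X (real i / real m) \<omega> + d}"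
      have le: "real i / real m \<le> real (Suc i) / real m" by (simp add: divide_right_mono)
      have E: "?E d \<in> sets M" for d
        using pred_eq_add_const[OF Xm[of "Suc i" m] Xm[of i m]] unfolding pred_def .
      have "C i m = space M - (?E 0 \<union> ?E 1)"
      proof -
        have "X (real i / real m) \<omega> \<le> X (real (Suc i) / real m) \<omega>" if "\<omega> \<in> space M" for \<omega>
          by (rule counting_path_mono[OF counting_process_path[OF X that] _ le]) simp
        then show ?thesis unfolding C_def by force
      qed
      then have "prob (C i m) = prob (space M - (?E 0 \<union> ?E 1))" by (rule arg_cong)
      moreover have "prob (space M - (?E 0 \<union> ?E 1)) = 1 - prob (?E 0 \<union> ?E 1)"
        by (rule prob_compl[OF sets.Un[OF E E]])
      moreover have "prob (?E 0 \<union> ?E 1) = prob (?E 0) + prob (?E 1)"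
        by (rule finite_measure_Union[OF E E]) auto
      moreover have "prob (?E 0) = poisson_weight (r / real m) 0"
        using poisson_increments_single[OF inc _ le, of 0] by (simp only: step) simp
      moreover have "prob (?E 1) = poisson_weight (r / real m) 1"
        using poisson_increments_single[OF inc _ le, of 1] by (simp only: step) simp
      ultimately show ?thesis using poisson_weight_ge_2[of "r / real m"] r by (metis diff_diff_eq zero_le_divide_iff less_eq_real_def of_nat_0_le_iff)
    qed
    have "prob (B K m) \<le> (\<Sum>i<K * m. prob (C i m))"
      unfolding B_def using C by (intro finite_measure_subadditive_finite) auto
    also have "\<dots> \<le> (\<Sum>i<K * m. (r / real m)\<^sup>2)" by (intro sum_mono cell)
    also have "\<dots> = real K * r\<^sup>2 / real m" using m by (simp add: power2_eq_square field_simps)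
    finally show ?thesis .
  qed
  have null: "AE \<omega> in M. \<exists>m. \<omega> \<notin> B K (Suc m)" for K
  proof (rule AE_I)
    show "{\<omega>\<in>space M. \<not> (\<exists>m. \<omega> \<notin> B K (Suc m))} \<subseteq> {\<omega>\<in>space M. \<forall>m. \<omega> \<in> B K (Suc m)}" by auto
    show "{\<omega>\<in>space M. \<forall>m. \<omega> \<in> B K (Suc m)} \<in> sets M" by measurable
    have "prob {\<omega>\<in>space M. \<forall>m. \<omega> \<in> B K (Suc m)} \<le> real K * r\<^sup>2 / real (Suc m)" for m
      by (rule order_trans[OF finite_measure_mono Ble]) auto
    moreover have "(\<lambda>m. real K * r\<^sup>2 / real (Suc m)) \<longlonglongrightarrow> 0"
      by (rule LIMSEQ_Suc[OF lim_const_over_n])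
    ultimately have "prob {\<omega>\<in>space M. \<forall>m. \<omega> \<in> B K (Suc m)} \<le> 0"
      by (intro LIMSEQ_le_const[of _ _ "prob {\<omega>\<in>space M. \<forall>m. \<omega> \<in> B K (Suc m)}"]) auto
    then show "emeasure M {\<omega>\<in>space M. \<forall>m. \<omega> \<in> B K (Suc m)} = 0"
      by (simp add: emeasure_eq_measure measure_le_0_iff)
  qed
  have "AE \<omega> in M. \<forall>K. \<exists>m. \<omega> \<notin> B K (Suc m)" unfolding AE_all_countable using null by blast
  with poisson_reaches_every_level[OF assms] AE_space show ?thesis
  proof eventually_elim
    case (elim \<omega>)
    let ?x = "\<lambda>t. X t \<omega>"
    have x: "counting_path ?x" using counting_process_path[OF X] elim by simp
    have ex: "\<exists>t\<ge>0. l \<le> ?x t" for l using elim by blast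
    have "?x (arrival_time ?x l) = l" for l
    proof (rule ccontr)
      assume ne: "?x (arrival_time ?x l) \<noteq> l"
      let ?T = "arrival_time ?x l"
      have ge: "l \<le> ?x ?T" by (rule le_at_arrival_time[OF x ex])
      have T0: "0 \<le> ?T" by (rule arrival_time_nonneg[OF ex])
      have "l \<noteq> 0"
      proof
        assume "l = 0"
        then show False using ne x by (simp add: counting_path_def)
      qed
      then have "0 < ?T" using T0 ge x by (cases "?T = 0") (auto simp: counting_path_def)
      define K where "K = nat \<lceil>?T\<rceil>"
      have "\<omega> \<in> B K (Suc m)" for m
      proof -
        \<comment> \<open>The cell that contains the skipping jump: \<open>j / (m + 1) < ?T \<le> (j + 1) / (m + 1)\<close>.\<close>
        define j where "j = nat (\<lceil>?T * real (Suc m)\<rceil> - 1)"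
        have pos: "0 < ?T * real (Suc m)" using \<open>0 < ?T\<close> by simp
        then have j: "real j < ?T * real (Suc m)" "?T * real (Suc m) \<le> real (Suc j)"
          unfolding j_def by linarith+
        have 1: "real j / real (Suc m) < ?T" "?T \<le> real (Suc j) / real (Suc m)"
          using j by (simp_all add: divide_less_eq le_divide_eq)
        have "real j < real (K * Suc m)"
        proof -
          have "?T \<le> real K" using T0 by (simp add: K_def)
          then have "?T * real (Suc m) \<le> real K * real (Suc m)" by (intro mult_right_mono) auto
          then show ?thesis using j(1) unfolding of_nat_mult by linarith
        qed
        then have "j < K * Suc m" by linarith
        moreover have "?x (real j / real (Suc m)) < l"
          using arrival_time_le_iff[OF x ex, of "real j / real (Suc m)" l] 1 by simp
        moreover have "?x ?T \<le> ?x (real (Suc j) / real (Suc m))"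
          by (rule counting_path_mono[OF x T0 1(2)])
        ultimately show ?thesis using ge ne elim by (auto simp: B_def C_def intro!: bexI[of _ j])
      qed
      then show False using elim by blast
    qed
    then show ?case using x ex by (simp add: simple_path_def)
  qed
qed

text \<open>Chernoff's inequality: where \<open>c \<le> d\<close>, the Poisson weight of \<open>d\<close> is at most its product with
  \<open>z ^ d * z powr - c\<close>, and these products sum to the right-hand side.\<close>

lemma poisson_tail_bound:
  assumes r: "0 \<le> r" and inc: "poisson_increments M r X" and X: "counting_process M X"
    and t: "0 \<le> t" and z: "1 \<le> z"
  shows "prob {\<omega>\<in>space M. c \<le> real (X t \<omega>)} \<le> z powr (- c) * exp (r * t * (z - 1))"
proof -
  have [measurable]: "X t \<in> measurable M (count_space UNIV)"
    using X t by (simp add: counting_process_def)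
  let ?A = "\<lambda>d. {\<omega>\<in>space M. X t \<omega> = d \<and> c \<le> real d}"
  have "(\<lambda>d. prob (?A d)) sums prob (\<Union>d. ?A d)"
    by (intro finite_measure_UNION) (auto simp: disjoint_family_on_def)
  moreover have "(\<Union>d. ?A d) = {\<omega>\<in>space M. c \<le> real (X t \<omega>)}" by auto
  ultimately have s1: "(\<lambda>d. prob (?A d)) sums prob {\<omega>\<in>space M. c \<le> real (X t \<omega>)}" by simp
  have "(\<lambda>d. z powr (- c) * (exp (- (r * t)) * ((r * t * z) ^ d /\<^sub>R fact d))) sums
      (z powr (- c) * (exp (- (r * t)) * exp (r * t * z)))"
    by (intro sums_mult exp_converges)
  then have s2: "(\<lambda>d. z powr (- c) * z ^ d * poisson_weight (r * t) d) sums
      (z powr (- c) * exp (r * t * (z - 1)))"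
    by (simp add: poisson_weight_def exp_add[symmetric] algebra_simps power_mult_distrib
        scaleR_conv_of_real divide_inverse)
  show ?thesis
  proof (rule sums_le[OF _ s1 s2])
    fix d
    show "prob (?A d) \<le> z powr (- c) * z ^ d * poisson_weight (r * t) d"
    proof (cases "c \<le> real d")
      case True
      have "1 \<le> z powr (real d - c)" using True z by (simp add: ge_one_powr_ge_zero)
      also have "\<dots> = z powr (- c) * z ^ d"
        using z by (simp add: powr_diff powr_minus powr_realpow divide_inverse)
      finally have "1 * poisson_weight (r * t) d \<le> z powr (- c) * z ^ d * poisson_weight (r * t) d"
        using r t by (intro mult_right_mono poisson_weight_nonneg) auto
      then show ?thesis using True by (simp add: poisson_increments_at[OF inc X t])
    next
      case False
      then show ?thesis using r t z by (simp add: poisson_weight_nonneg)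
    qed
  qed
qed

end

section \<open>Sequences of independent uniform variables\<close>

definition variable_algebra :: "'a measure \<Rightarrow> (nat \<Rightarrow> 'a \<Rightarrow> real) \<Rightarrow> nat set \<Rightarrow> 'a measure" where
  "variable_algebra P U I = source_algebra P (\<lambda>l. sets (vimage_algebra (space P) (U l) borel)) I"

text \<open>Independence is required between the \<open>\<sigma>\<close>-algebras of all disjoint index sets, which is the form in
  which it is used.\<close>

definition iid_uniform :: "'a measure \<Rightarrow> (nat \<Rightarrow> 'a \<Rightarrow> real) \<Rightarrow> bool" where
  "iid_uniform P U \<longleftrightarrow>
     (\<forall>l. U l \<in> borel_measurable P \<and> distr P borel (U l) = uniform_measure lborel {0<..<1}) \<and>
     (\<forall>I J. I \<inter> J = {} \<longrightarrow> indep_algebras P (variable_algebra P U I) (variable_algebra P U J))"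

lemma space_variable_algebra [simp]: "space (variable_algebra P U I) = space P"
  by (simp add: variable_algebra_def)

lemma measurable_variable_algebra:
  assumes "l \<in> I" shows "U l \<in> borel_measurable (variable_algebra P U I)"
proof (rule measurableI)
  fix A :: "real set" assume "A \<in> sets borel"
  then have "U l -` A \<inter> space P \<in> sets (vimage_algebra (space P) (U l) borel)"
    by (rule in_vimage_algebra)
  then have "U l -` A \<inter> space P \<in> (\<Union>l\<in>I. sets (vimage_algebra (space P) (U l) borel))"
    using assms by blast
  moreover have "(\<Union>l\<in>I. sets (vimage_algebra (space P) (U l) borel)) \<subseteq> Pow (space P)"
    using sets.space_closed[of "vimage_algebra (space P) (U _) borel"] by fastforce
  ultimately show "U l -` A \<inter> space (variable_algebra P U I) \<in> sets (variable_algebra P U I)"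
    by (simp add: variable_algebra_def source_algebra_def sigma_sets.Basic)
qed simp

lemma iid_uniformD:
  assumes "iid_uniform P U"
  shows "U l \<in> borel_measurable P"
    "I \<inter> J = {} \<Longrightarrow> indep_algebras P (variable_algebra P U I) (variable_algebra P U J)"
    "subalgebra P (variable_algebra P U I)"
  using assms indep_algebrasD(1)[of P "variable_algebra P U I" "variable_algebra P U {}"]
  by (auto simp: iid_uniform_def)

lemma iid_uniform_interval:
  assumes U: "iid_uniform P U" and ab: "0 \<le> a" "a \<le> b" "b \<le> 1"
  shows "measure P {\<omega>\<in>space P. U l \<omega> \<in> {a..<b}} = b - a"
proof -
  have "measure P (U l -` {a..<b} \<inter> space P) = measure (uniform_measure lborel {0<..<1::real}) {a..<b}"
    using U by (metis (no_types, lifting) iid_uniform_def measure_distr atLeastLessThan_borel)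
  also have "\<dots> = measure lborel ({0<..<1} \<inter> {a..<b}) / measure lborel {0<..<1::real}"
    by (rule measure_uniform_measure) auto
  also have "emeasure lborel ({0<..<1} \<inter> {a..<b}) = ennreal (b - a)"
  proof -
    have "emeasure lborel ({0<..<1} \<inter> {a..<b}) = emeasure lborel {a<..<b}"
    proof (rule emeasure_eq_AE)
      show "AE x in lborel. (x \<in> {0<..<1} \<inter> {a..<b}) = (x \<in> {a<..<b})"
        using AE_lborel_singleton[of a] by eventually_elim (use ab in auto)
    qed auto
    then show ?thesis using ab by simp
  qed
  then have "measure lborel ({0<..<1} \<inter> {a..<b}) = b - a" using ab by (simp add: measure_def)
  finally show ?thesis by (simp add: vimage_def Int_def conj_commute)
qed

lemma iid_uniform_less:
  assumes U: "iid_uniform P U" and p: "0 \<le> p" "p \<le> 1"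
  shows "measure P {\<omega>\<in>space P. U l \<omega> < p} = p"
proof -
  have [measurable]: "U l \<in> borel_measurable P" using U by (rule iid_uniformD)
  have "AE x in uniform_measure lborel {0<..<1::real}. 0 \<le> x"
    by (rule AE_uniform_measureI) auto
  moreover have "distr P borel (U l) = uniform_measure lborel {0<..<1}"
    using U by (simp add: iid_uniform_def)
  ultimately have "AE x in distr P borel (U l). 0 \<le> x" by (simp only:)
  then have "AE \<omega> in P. 0 \<le> U l \<omega>" by (subst (asm) AE_distr_iff) auto
  then have "measure P {\<omega>\<in>space P. U l \<omega> < p} = measure P {\<omega>\<in>space P. U l \<omega> \<in> {0..<p}}"
    by (intro measure_eq_AE) auto
  then show ?thesis using iid_uniform_interval[OF U _ p] by simp
qed

section \<open>Counting Bernoulli marks\<close>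

text \<open>The variable \<open>U l\<close> marks the index \<open>l\<close> if it is below \<open>p\<close>, which happens with probability \<open>p\<close>.\<close>

definition hits :: "real \<Rightarrow> (nat \<Rightarrow> 'a \<Rightarrow> real) \<Rightarrow> nat set \<Rightarrow> 'a \<Rightarrow> nat" where
  "hits p U A \<omega> = (\<Sum>j\<in>A. if U j \<omega> < p then 1 else 0)"

definition binomial_weight :: "real \<Rightarrow> nat \<Rightarrow> nat \<Rightarrow> real" where
  "binomial_weight p d a = real (d choose a) * p ^ a * (1 - p) ^ (d - a)"

lemma hits_Suc: "hits p U {..<Suc m} \<omega> = hits p U {..<m} \<omega> + (if U m \<omega> < p then 1 else 0)"
  by (simp add: hits_def)

lemma hits_split: "m \<le> n \<Longrightarrow> hits p U {..<n} \<omega> = hits p U {..<m} \<omega> + hits p U {m..<n} \<omega>"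
  unfolding hits_def by (metis atLeast0LessThan sum.atLeastLessThan_concat zero_le)

lemma hits_le: "finite A \<Longrightarrow> hits p U A \<omega> \<le> card A"
  unfolding hits_def by (rule order_trans[OF sum_bounded_above[of A _ 1]]) auto

lemma mono_hits: "mono (\<lambda>m. hits p U {..<m} \<omega>)"
  by (rule monoI) (metis hits_split le_add1)

lemma mono_misses: "mono (\<lambda>m. m - hits p U {..<m} \<omega>)"
proof (rule monoI)
  fix m n :: nat assume "m \<le> n"
  moreover have "hits p U {m..<n} \<omega> \<le> n - m" using hits_le[of "{m..<n}" p U \<omega>] by simp
  moreover have "hits p U {..<m} \<omega> \<le> m" using hits_le[of "{..<m}" p U \<omega>] by simp
  ultimately show "m - hits p U {..<m} \<omega> \<le> n - hits p U {..<n} \<omega>"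
    using hits_split[OF \<open>m \<le> n\<close>, of p U \<omega>] by simp
qed

lemma measurable_hits:
  assumes "A \<subseteq> I"
  shows "hits p U A \<in> measurable (variable_algebra P U I) (count_space UNIV)"
proof -
  have "(\<lambda>\<omega>. \<Sum>j\<in>A. if U j \<omega> < p then 1 else 0 :: nat) \<in> measurable (variable_algebra P U I) (count_space UNIV)"
  proof (cases "finite A")
    case True
    then show ?thesis using assms
    proof (induction A rule: finite_induct)
      case (insert j A)
      have [measurable]: "U j \<in> borel_measurable (variable_algebra P U I)"
        using insert by (intro measurable_variable_algebra) auto
      have "(\<lambda>\<omega>. if U j \<omega> < p then 1 else 0 :: nat) \<in> measurable (variable_algebra P U I) (count_space UNIV)"
        by measurable
      from measurable_nat_add[OF this insert.IH] show ?case using insert by simp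
    qed simp
  qed simp
  then show ?thesis by (simp add: hits_def[abs_def])
qed

context prob_space begin

lemma hits_law:
  assumes U: "iid_uniform M U" and p: "0 \<le> p" "p \<le> 1" and A: "finite A"
  shows "prob {\<omega>\<in>space M. hits p U A \<omega> = a} = binomial_weight p (card A) a"
  using A
proof (induction A arbitrary: a rule: finite_induct)
  case empty
  then show ?case by (cases a) (simp_all add: hits_def binomial_weight_def prob_space)
next
  case (insert j A)
  let ?H = "\<lambda>a. {\<omega>\<in>space M. hits p U A \<omega> = a}"
  let ?L = "{\<omega>\<in>space M. U j \<omega> < p}"
  have HA: "?H a \<in> sets (variable_algebra M U A)" for a
    using measurable_sets[OF measurable_hits[OF order_refl, of p U A M], of "{a}"]
    by (simp add: vimage_def Int_def conj_commute)
  have [measurable]: "U j \<in> borel_measurable (variable_algebra M U {j})"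
    by (rule measurable_variable_algebra) simp
  have Lj: "?L \<in> sets (variable_algebra M U {j})"
    using measurable_sets[of "U j" "variable_algebra M U {j}" borel "{..<p}"]
    by (simp add: vimage_def Int_def conj_commute)
  then have Lj': "space M - ?L \<in> sets (variable_algebra M U {j})"
    using sets.compl_sets by fastforce
  have ind: "indep_algebras M (variable_algebra M U A) (variable_algebra M U {j})"
    using insert by (intro iid_uniformD[OF U]) auto
  note mult = indep_algebrasD(3)[OF ind HA Lj] indep_algebrasD(3)[OF ind HA Lj']
  have ev: "?H a \<in> events" for a using HA iid_uniformD(3)[OF U] by (auto simp: subalgebra_def)
  have evL: "?L \<in> events" using Lj iid_uniformD(3)[OF U] by (auto simp: subalgebra_def)
  have L: "prob ?L = p" "prob (space M - ?L) = 1 - p"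
    using iid_uniform_less[OF U p] prob_compl[OF evL] by auto
  have hits: "hits p U (insert j A) \<omega> = (if U j \<omega> < p then 1 else 0) + hits p U A \<omega>" for \<omega>
    using insert by (simp add: hits_def)
  have split: "prob {\<omega>\<in>space M. hits p U (insert j A) \<omega> = a} =
      prob (?H a) * (1 - p) + (if a = 0 then 0 else prob (?H (a - 1)) * p)"
  proof -
    have eq: "{\<omega>\<in>space M. hits p U (insert j A) \<omega> = a} =
        (?H a \<inter> (space M - ?L)) \<union> (if a = 0 then {} else ?H (a - 1) \<inter> ?L)"
      by (auto simp: hits split: if_splits)
    have "prob ((?H a \<inter> (space M - ?L)) \<union> (if a = 0 then {} else ?H (a - 1) \<inter> ?L)) =
        prob (?H a \<inter> (space M - ?L)) + prob (if a = 0 then {} else ?H (a - 1) \<inter> ?L)"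
    proof (rule finite_measure_Union)
      show "?H a \<inter> (space M - ?L) \<in> events" using ev evL by auto
      show "(if a = 0 then {} else ?H (a - 1) \<inter> ?L) \<in> events" using ev evL by (cases "a = 0") auto
      show "?H a \<inter> (space M - ?L) \<inter> (if a = 0 then {} else ?H (a - 1) \<inter> ?L) = {}"
        by (cases "a = 0") auto
    qed
    then show ?thesis using mult L by (simp add: eq)
  qed
  have card: "card (insert j A) = Suc (card A)" using insert by simp
  show ?case
  proof (cases a)
    case 0
    then show ?thesis using split insert.IH by (simp add: card binomial_weight_def)
  next
    case (Suc b)
    have "binomial_weight p (card A) (Suc b) * (1 - p) + binomial_weight p (card A) b * p =
        binomial_weight p (Suc (card A)) (Suc b)"
    proof (cases "Suc b \<le> card A")
      case True
      then have "card A - b = Suc (card A - Suc b)" by simp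
      then show ?thesis by (simp add: binomial_weight_def algebra_simps)
    next
      case False
      then have "card A choose Suc b = 0" "card A - b = 0" by (simp_all add: binomial_eq_0)
      then show ?thesis by (simp add: binomial_weight_def mult_ac del: binomial_eq_0_iff)
    qed
    then show ?thesis using Suc split insert.IH by (simp add: card)
  qed
qed

lemma hits_blocks_law:
  assumes U: "iid_uniform M U" and p: "0 \<le> p" "p \<le> 1"
    and c: "\<And>i. i < k \<Longrightarrow> c i \<le> c (Suc i)"
  shows "prob {\<omega>\<in>space M. \<forall>i<k. hits p U {c i..<c (Suc i)} \<omega> = a i} =
      (\<Prod>i<k. binomial_weight p (c (Suc i) - c i) (a i))"
  using c
proof (induction k)
  case 0
  then show ?case by (simp add: prob_space)
next
  case (Suc k)
  let ?A = "{\<omega>\<in>space M. \<forall>i<k. hits p U {c i..<c (Suc i)} \<omega> = a i}"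
  let ?B = "{\<omega>\<in>space M. hits p U {c k..<c (Suc k)} \<omega> = a k}"
  have H: "{\<omega>\<in>space M. hits p U A \<omega> = b} \<in> sets (variable_algebra M U I)" if "A \<subseteq> I" for A b I
    using measurable_sets[OF measurable_hits[OF that, of p U M], of "{b}"]
    by (simp add: vimage_def Int_def conj_commute)
  have c_le: "i \<le> j \<Longrightarrow> j \<le> k \<Longrightarrow> c i \<le> c j" for i j
  proof (induction j)
    case (Suc j)
    then show ?case using \<open>\<And>i. i < Suc k \<Longrightarrow> c i \<le> c (Suc i)\<close>[of j] by (cases "i = Suc j") auto
  qed simp
  have sub: "{c i..<c (Suc i)} \<subseteq> {..<c k}" if "i < k" for i
    using c_le[of "Suc i" k] that by auto
  have "{\<omega>\<in>space (variable_algebra M U {..<c k}). \<forall>i\<in>{..<k}. hits p U {c i..<c (Suc i)} \<omega> = a i}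
      \<in> sets (variable_algebra M U {..<c k})"
    by (rule sets.sets_Collect_finite_All) (use H[OF sub] in auto)
  then have A: "?A \<in> sets (variable_algebra M U {..<c k})"
    by (simp only: Ball_def lessThan_iff space_variable_algebra)
  have B: "?B \<in> sets (variable_algebra M U {c k..<c (Suc k)})" by (rule H) simp
  have "indep_algebras M (variable_algebra M U {..<c k}) (variable_algebra M U {c k..<c (Suc k)})"
    by (rule iid_uniformD[OF U]) auto
  from indep_algebrasD(3)[OF this A B]
  have "prob (?A \<inter> ?B) = prob ?A * prob ?B" .
  moreover have "{\<omega>\<in>space M. \<forall>i<Suc k. hits p U {c i..<c (Suc i)} \<omega> = a i} = ?A \<inter> ?B"
    by (auto simp: less_Suc_eq)
  moreover have "prob ?A = (\<Prod>i<k. binomial_weight p (c (Suc i) - c i) (a i))"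
    using Suc by simp
  moreover have "prob ?B = binomial_weight p (c (Suc k) - c k) (a k)"
    using hits_law[OF U p, of "{c k..<c (Suc k)}"] by simp
  ultimately show ?case by simp
qed

end

text \<open>A Poisson number of Bernoulli trials splits into independent Poisson numbers of hits and misses.\<close>

lemma poisson_weight_thinning:
  assumes "p = \<alpha> / n" "n = \<alpha> + \<beta>" "n \<noteq> 0"
  shows "poisson_weight (n * h) (a + b) * binomial_weight p (a + b) a =
    poisson_weight (\<alpha> * h) a * poisson_weight (\<beta> * h) b"
proof -
  have q: "1 - p = \<beta> / n" using assms by (simp add: field_simps)
  have "real ((a + b) choose a) = fact (a + b) / (fact a * fact b)"
    by (simp add: binomial_fact)
  then have "poisson_weight (n * h) (a + b) * binomial_weight p (a + b) a =
      (n * p * h) ^ a * (n * (1 - p) * h) ^ b / (fact a * fact b) * exp (- (n * h))"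
    by (simp add: poisson_weight_def binomial_weight_def power_add power_mult_distrib)
  also have "n * p = \<alpha>" using assms by simp
  also have "n * (1 - p) = \<beta>" using assms q by simp
  also have "exp (- (n * h)) = exp (- (\<alpha> * h)) * exp (- (\<beta> * h))"
    by (simp add: assms(2) exp_add[symmetric] algebra_simps)
  finally show ?thesis by (simp add: poisson_weight_def)
qed

section \<open>The path law of a pair of counting processes\<close>

text \<open>The two clocks are compared in law as one random element of a space of paths, so that the laws can be
  pushed forward along any measurable functional of both paths.  Its \<open>\<sigma>\<close>-algebra is generated by
  the values at finitely many nonnegative times.\<close>

definition pair_paths :: "(real \<Rightarrow> nat \<times> nat) set" where
  "pair_paths = {x. counting_path (\<lambda>t. fst (x t)) \<and> counting_path (\<lambda>t. snd (x t))}"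

definition path_cylinder :: "real set \<Rightarrow> (real \<Rightarrow> nat \<times> nat) \<Rightarrow> (real \<Rightarrow> nat \<times> nat) set" where
  "path_cylinder J v = {x\<in>pair_paths. \<forall>t\<in>J. x t = v t}"

definition path_cylinders :: "(real \<Rightarrow> nat \<times> nat) set set" where
  "path_cylinders = insert {} {path_cylinder J v |J v. finite J \<and> J \<subseteq> {0..}}"

definition path_algebra :: "(real \<Rightarrow> nat \<times> nat) measure" where
  "path_algebra = sigma pair_paths path_cylinders"

lemma path_cylinders_subset: "path_cylinders \<subseteq> Pow pair_paths"
  by (auto simp: path_cylinders_def path_cylinder_def)

lemma space_path_algebra [simp]: "space path_algebra = pair_paths"
  by (simp add: path_algebra_def space_measure_of_conv)

lemma sets_path_algebra: "sets path_algebra = sigma_sets pair_paths path_cylinders"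
  by (simp add: path_algebra_def path_cylinders_subset)

lemma Int_stable_path_cylinders: "Int_stable path_cylinders"
proof (rule Int_stableI)
  fix A B assume AB: "A \<in> path_cylinders" "B \<in> path_cylinders"
  show "A \<inter> B \<in> path_cylinders"
  proof (cases "A = {} \<or> B = {} \<or> A \<inter> B = {}")
    case True
    then show ?thesis by (auto simp: path_cylinders_def)
  next
    case False
    then obtain J v K w where J: "finite J" "J \<subseteq> {0..}" "A = path_cylinder J v"
      and K: "finite K" "K \<subseteq> {0..}" "B = path_cylinder K w"
      using AB by (auto simp: path_cylinders_def)
    obtain x where x: "x \<in> A \<inter> B" using False by blast
    have "A \<inter> B = path_cylinder (J \<union> K) x"
    proof (intro set_eqI iffI)
      fix y assume "y \<in> A \<inter> B"
      then show "y \<in> path_cylinder (J \<union> K) x" using x J K by (simp add: path_cylinder_def) (metis UnE)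
    next
      fix y assume "y \<in> path_cylinder (J \<union> K) x"
      then show "y \<in> A \<inter> B" using x J K by (simp add: path_cylinder_def)
    qed
    then show ?thesis using J K by (auto simp: path_cylinders_def)
  qed
qed

lemma path_coordinate_event:
  assumes "0 \<le> t" shows "{x\<in>pair_paths. x t = v} \<in> sets path_algebra"
proof -
  have "{x\<in>pair_paths. x t = v} = path_cylinder {t} (\<lambda>_. v)" by (auto simp: path_cylinder_def)
  moreover have "\<dots> \<in> path_cylinders" using assms by (auto simp: path_cylinders_def)
  ultimately show ?thesis by (simp add: sets_path_algebra sigma_sets.Basic)
qed

lemma path_coordinate_measurable:
  assumes "0 \<le> t" shows "(\<lambda>x. x t) \<in> measurable path_algebra (count_space UNIV)"
proof -
  have "(\<lambda>x. x t) -` {v} \<inter> space path_algebra \<in> sets path_algebra" for v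
    using path_coordinate_event[OF assms, of v] by (simp add: vimage_def Int_def conj_commute)
  then show ?thesis by (simp add: measurable_count_space_eq2_countable)
qed

lemma counting_process_fst: "counting_process path_algebra (\<lambda>t x. fst (x t))"
  and counting_process_snd: "counting_process path_algebra (\<lambda>t x. snd (x t))"
  using measurable_compose[OF path_coordinate_measurable, of _ fst "count_space UNIV"]
    measurable_compose[OF path_coordinate_measurable, of _ snd "count_space UNIV"]
  by (auto simp: counting_process_def pair_paths_def)

lemma path_map_measurable:
  assumes X: "counting_process F X" and Y: "counting_process F Y"
  shows "(\<lambda>\<omega> t. (X t \<omega>, Y t \<omega>)) \<in> measurable F path_algebra"
  unfolding path_algebra_def
proof (rule measurable_measure_of[OF path_cylinders_subset])
  show "(\<lambda>\<omega> t. (X t \<omega>, Y t \<omega>)) \<in> space F \<rightarrow> pair_paths"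
    using counting_process_path[OF X] counting_process_path[OF Y] by (auto simp: pair_paths_def)
  then have space: "(\<lambda>t. (X t \<omega>, Y t \<omega>)) \<in> pair_paths" if "\<omega> \<in> space F" for \<omega> using that by auto
  fix A assume "A \<in> path_cylinders"
  then consider "A = {}" | J v where "finite J" "J \<subseteq> {0..}" "A = path_cylinder J v"
    by (auto simp: path_cylinders_def)
  then show "(\<lambda>\<omega> t. (X t \<omega>, Y t \<omega>)) -` A \<inter> space F \<in> sets F"
  proof cases
    case 2
    have "{\<omega>\<in>space F. \<forall>t\<in>J. X t \<omega> = fst (v t) \<and> Y t \<omega> = snd (v t)} \<in> sets F"
    proof (rule sets.sets_Collect_finite_All[OF _ 2(1)])
      fix t assume "t \<in> J"
      then have t: "0 \<le> t" using 2 by auto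
      have "X t -` {fst (v t)} \<inter> space F \<in> sets F" "Y t -` {snd (v t)} \<inter> space F \<in> sets F"
        using measurable_sets[OF counting_process_measurable[OF X t], of "{fst (v t)}"]
          measurable_sets[OF counting_process_measurable[OF Y t], of "{snd (v t)}"] by auto
      from sets.Int[OF this] show "{\<omega>\<in>space F. X t \<omega> = fst (v t) \<and> Y t \<omega> = snd (v t)} \<in> sets F"
        by (rule back_subst[of "\<lambda>A. A \<in> sets F"]) auto
    qed
    moreover have "(\<lambda>\<omega> t. (X t \<omega>, Y t \<omega>)) -` A \<inter> space F =
        {\<omega>\<in>space F. \<forall>t\<in>J. X t \<omega> = fst (v t) \<and> Y t \<omega> = snd (v t)}"
      using space 2 by (auto simp: path_cylinder_def prod_eq_iff)
    ultimately show ?thesis by (simp only:)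
  qed simp
qed

lemma pair_eq_iff: "(a, b) = c \<longleftrightarrow> a = fst c \<and> b = snd c"
  by (cases c) simp

text \<open>A counting path starts at zero, hence its values at an increasing sequence of times starting at zero
  determine and are determined by its increments.\<close>

lemma levels_iff_increments:
  fixes x :: "real \<Rightarrow> nat"
  assumes x: "counting_path x" and t: "t 0 = 0" "\<And>i. i < k \<Longrightarrow> t i \<le> t (Suc i)"
  shows "(\<forall>i\<le>k. x (t i) = c i) \<longleftrightarrow> c 0 = 0 \<and> (\<forall>i<k. c i \<le> c (Suc i)) \<and>
    (\<forall>i<k. x (t (Suc i)) = x (t i) + (c (Suc i) - c i))"
proof (intro iffI conjI allI impI; (elim conjE)?)
  assume *: "\<forall>i\<le>k. x (t i) = c i"
  then have "x (t 0) = c 0" by blast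
  then show "c 0 = 0" using x t by (simp add: counting_path_def)
  fix i assume i: "i < k"
  have "x (t i) \<le> x (t (Suc i))"
    using nondecreasing_times_nonneg[of t k i] t i by (intro counting_path_mono[OF x]) auto
  then show "c i \<le> c (Suc i)" "x (t (Suc i)) = x (t i) + (c (Suc i) - c i)"
    using * i by simp_all
next
  fix i
  assume c: "c 0 = 0" "\<forall>i<k. c i \<le> c (Suc i)" "\<forall>i<k. x (t (Suc i)) = x (t i) + (c (Suc i) - c i)"
  assume "i \<le> k"
  then show "x (t i) = c i"
  proof (induction i)
    case 0
    then show ?case using c x t by (simp add: counting_path_def)
  next
    case (Suc i)
    then show ?case using c by simp
  qed
qed

text \<open>The cylinders form an intersection-stable generator, so a law on paths is determined by the joint
  law of the values at finitely many times, that is, of the increments.\<close>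

lemma (in prob_space) path_law_eqI:
  assumes X: "counting_process M X" and Y: "counting_process M Y"
    and X': "counting_process M X'" and Y': "counting_process M Y'"
    and increments: "\<And>k t a b. t 0 = 0 \<Longrightarrow> (\<And>i. i < k \<Longrightarrow> t i \<le> t (Suc i)) \<Longrightarrow>
      prob {\<omega>\<in>space M. \<forall>i<k. X (t (Suc i)) \<omega> = X (t i) \<omega> + a i \<and> Y (t (Suc i)) \<omega> = Y (t i) \<omega> + b i} =
      prob {\<omega>\<in>space M. \<forall>i<(k::nat). X' (t (Suc i)) \<omega> = X' (t i) \<omega> + (a i :: nat) \<and>
        Y' (t (Suc i)) \<omega> = Y' (t i) \<omega> + b i}"
  shows "distr M path_algebra (\<lambda>\<omega> t. (X t \<omega>, Y t \<omega>)) = distr M path_algebra (\<lambda>\<omega> t. (X' t \<omega>, Y' t \<omega>))"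
    (is "?D = ?D'")
proof -
  have levels: "prob {\<omega>\<in>space M. \<forall>i\<le>k. X (t i) \<omega> = c i \<and> Y (t i) \<omega> = d i} =
      prob {\<omega>\<in>space M. \<forall>i\<le>k. X' (t i) \<omega> = c i \<and> Y' (t i) \<omega> = d i}"
    if t: "t 0 = 0" "\<And>i. i < k \<Longrightarrow> t i \<le> t (Suc i)" for k t c d
  proof -
    have *: "{\<omega>\<in>space M. \<forall>i\<le>k. Z (t i) \<omega> = c i \<and> Z' (t i) \<omega> = d i} =
        (if c 0 = 0 \<and> d 0 = 0 \<and> (\<forall>i<k. c i \<le> c (Suc i) \<and> d i \<le> d (Suc i)) then
          {\<omega>\<in>space M. \<forall>i<k. Z (t (Suc i)) \<omega> = Z (t i) \<omega> + (c (Suc i) - c i) \<and>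
            Z' (t (Suc i)) \<omega> = Z' (t i) \<omega> + (d (Suc i) - d i)} else {})"
      if Z: "counting_process M Z" "counting_process M Z'" for Z Z'
    proof -
      have "(\<forall>i\<le>k. Z (t i) \<omega> = c i \<and> Z' (t i) \<omega> = d i) \<longleftrightarrow>
          (c 0 = 0 \<and> d 0 = 0 \<and> (\<forall>i<k. c i \<le> c (Suc i) \<and> d i \<le> d (Suc i))) \<and>
          (\<forall>i<k. Z (t (Suc i)) \<omega> = Z (t i) \<omega> + (c (Suc i) - c i) \<and>
            Z' (t (Suc i)) \<omega> = Z' (t i) \<omega> + (d (Suc i) - d i))" if "\<omega> \<in> space M" for \<omega>
        using levels_iff_increments[where x = "\<lambda>t. Z t \<omega>", OF counting_process_path[OF Z(1) that] t, where c = c]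
          levels_iff_increments[where x = "\<lambda>t. Z' t \<omega>", OF counting_process_path[OF Z(2) that] t, where c = d]
        by meson
      then show ?thesis by (cases "c 0 = 0 \<and> d 0 = 0 \<and> (\<forall>i<k. c i \<le> c (Suc i) \<and> d i \<le> d (Suc i))") auto
    qed
    show ?thesis
      unfolding *[OF X Y] *[OF X' Y'] by (simp only: if_distrib[of prob] increments[OF t])
  qed
  have cyl: "prob {\<omega>\<in>space M. \<forall>t\<in>J. X t \<omega> = fst (v t) \<and> Y t \<omega> = snd (v t)} =
      prob {\<omega>\<in>space M. \<forall>t\<in>J. X' t \<omega> = fst (v t) \<and> Y' t \<omega> = snd (v t)}"
    if J: "finite J" "J \<subseteq> {0..}" for J v
  proof (cases "0 \<in> J \<and> v 0 \<noteq> (0, 0)")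
    case True
    have "{\<omega>\<in>space M. \<forall>t\<in>J. Z t \<omega> = fst (v t) \<and> Z' t \<omega> = snd (v t)} = {}"
      if "counting_process M Z" "counting_process M Z'" for Z Z'
    proof -
      have "Z 0 \<omega> = 0 \<and> Z' 0 \<omega> = 0" if "\<omega> \<in> space M" for \<omega>
        using counting_process_path[OF \<open>counting_process M Z\<close> that]
          counting_process_path[OF \<open>counting_process M Z'\<close> that]
        by (simp add: counting_path_def)
      then show ?thesis using True by (fastforce simp: prod_eq_iff)
    qed
    then show ?thesis by (simp only: X Y X' Y')
  next
    case False
    \<comment> \<open>Time zero is added, where both paths vanish, so that levels can be expressed by increments.\<close>
    define J0 where "J0 = insert 0 J"
    have J0: "finite J0" "J0 \<subseteq> {0..}" "J0 \<noteq> {}" using J by (auto simp: J0_def)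
    define w where "w = v(0 := (0, 0))"
    define s where "s = sorted_list_of_set J0"
    define t where "t i = s ! i" for i
    define k where "k = length s - 1"
    have s: "set s = J0" "sorted s" using J0 by (auto simp: s_def)
    have len: "0 < length s" using s J0 by auto
    have t0: "t 0 = 0"
    proof -
      obtain i where "i < length s" "s ! i = 0" using s by (metis J0_def in_set_conv_nth insertI1)
      then have "s ! 0 \<le> 0" using sorted_nth_mono[OF s(2), of 0 i] by simp
      moreover have "s ! 0 \<in> J0" using s len by (metis nth_mem)
      ultimately show ?thesis using J0 by (auto simp: t_def)
    qed
    have tm: "t i \<le> t (Suc i)" if "i < k" for i
      using sorted_nth_mono[OF s(2), of i "Suc i"] that by (simp add: t_def k_def)
    have ex: "(\<forall>i\<le>k. Q (t i)) \<longleftrightarrow> (\<forall>u\<in>J0. Q u)" for Q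
    proof -
      have "i \<le> k \<longleftrightarrow> i < length s" for i using len unfolding k_def by linarith
      then show ?thesis unfolding s(1)[symmetric] all_set_conv_all_nth t_def by blast
    qed
    have "{\<omega>\<in>space M. \<forall>t\<in>J. Z t \<omega> = fst (v t) \<and> Z' t \<omega> = snd (v t)} =
        {\<omega>\<in>space M. \<forall>i\<le>k. Z (t i) \<omega> = fst (w (t i)) \<and> Z' (t i) \<omega> = snd (w (t i))}"
      if "counting_process M Z" "counting_process M Z'" for Z Z'
    proof -
      have "(\<forall>t\<in>J. Z t \<omega> = fst (v t) \<and> Z' t \<omega> = snd (v t)) \<longleftrightarrow>
          (\<forall>i\<le>k. Z (t i) \<omega> = fst (w (t i)) \<and> Z' (t i) \<omega> = snd (w (t i)))" if "\<omega> \<in> space M" for \<omega>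
      proof -
        have "Z 0 \<omega> = 0" "Z' 0 \<omega> = 0"
          using counting_process_path[OF \<open>counting_process M Z\<close> that]
            counting_process_path[OF \<open>counting_process M Z'\<close> that]
          by (auto simp: counting_path_def)
        then have "(\<forall>t\<in>J. Z t \<omega> = fst (v t) \<and> Z' t \<omega> = snd (v t)) \<longleftrightarrow>
            (\<forall>t\<in>J0. Z t \<omega> = fst (w t) \<and> Z' t \<omega> = snd (w t))"
          using False by (auto simp: J0_def w_def)
        then show ?thesis using ex[of "\<lambda>u. Z u \<omega> = fst (w u) \<and> Z' u \<omega> = snd (w u)"] by blast
      qed
      then show ?thesis by auto
    qed
    then show ?thesis using X Y X' Y' levels[OF t0 tm] by simp
  qed
  have pre: "(\<lambda>\<omega> t. (Z t \<omega>, Z' t \<omega>)) -` path_cylinder J v \<inter> space M =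
      {\<omega>\<in>space M. \<forall>t\<in>J. Z t \<omega> = fst (v t) \<and> Z' t \<omega> = snd (v t)}"
    if "counting_process M Z" "counting_process M Z'" for Z Z' J v
    using counting_process_path[OF that(1)] counting_process_path[OF that(2)]
    by (auto simp: path_cylinder_def pair_paths_def pair_eq_iff)
  show ?thesis
  proof (rule measure_eqI_generator_eq[OF Int_stable_path_cylinders path_cylinders_subset])
    show "sets ?D = sigma_sets pair_paths path_cylinders" "sets ?D' = sigma_sets pair_paths path_cylinders"
      by (simp_all add: sets_path_algebra)
    show "range (\<lambda>_::nat. path_cylinder {} (\<lambda>_. (0, 0))) \<subseteq> path_cylinders"
      by (auto simp: path_cylinders_def)
    show "(\<Union>i::nat. path_cylinder {} (\<lambda>_. (0, 0))) = pair_paths" by (auto simp: path_cylinder_def)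
    show "emeasure ?D (path_cylinder {} (\<lambda>_. (0, 0))) \<noteq> \<infinity>"
      by (simp add: finite_measure.emeasure_finite[OF finite_measure_distr] path_map_measurable[OF X Y])
    fix A assume A: "A \<in> path_cylinders"
    then have A': "A \<in> sets path_algebra" by (simp add: sets_path_algebra sigma_sets.Basic)
    consider "A = {}" | J v where "finite J" "J \<subseteq> {0..}" "A = path_cylinder J v"
      using A by (auto simp: path_cylinders_def)
    then show "emeasure ?D A = emeasure ?D' A"
    proof cases
      case 2
      then show ?thesis
        using cyl[OF 2(1,2), of v] A' pre[OF X Y, of J v] pre[OF X' Y', of J v]
        by (simp add: emeasure_distr path_map_measurable X Y X' Y' emeasure_eq_measure)
    qed simp
  qed
qed

section \<open>Thinning\<close>

lemma counting_process_mark_counts: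
  assumes Z: "counting_process M Z" and U: "iid_uniform M U"
  shows "counting_process M (\<lambda>t \<omega>. hits p U {..<Z t \<omega>} \<omega>)"
    "counting_process M (\<lambda>t \<omega>. Z t \<omega> - hits p U {..<Z t \<omega>} \<omega>)"
proof -
  have H: "hits p U A \<in> measurable M (count_space UNIV)" for A
    by (rule measurable_from_subalg[OF iid_uniformD(3)[OF U] measurable_hits[OF order_refl]])
  have "(\<lambda>\<omega>. hits p U {..<Z t \<omega>} \<omega>) \<in> measurable M (count_space UNIV)"
    "(\<lambda>\<omega>. Z t \<omega> - hits p U {..<Z t \<omega>} \<omega>) \<in> measurable M (count_space UNIV)" if "0 \<le> t" for t
  proof -
    note Zt = counting_process_measurable[OF Z that]
    show 1: "(\<lambda>\<omega>. hits p U {..<Z t \<omega>} \<omega>) \<in> measurable M (count_space UNIV)"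
      by (rule measurable_compose_countable[OF H Zt])
    show "(\<lambda>\<omega>. Z t \<omega> - hits p U {..<Z t \<omega>} \<omega>) \<in> measurable M (count_space UNIV)"
      by (rule measurable_compose_countable[OF measurable_compose[OF 1] Zt]) simp
  qed
  moreover have "counting_path (\<lambda>t. hits p U {..<Z t \<omega>} \<omega>)"
    "counting_path (\<lambda>t. Z t \<omega> - hits p U {..<Z t \<omega>} \<omega>)" if "\<omega> \<in> space M" for \<omega>
    using counting_path_comp[OF counting_process_path[OF Z that] mono_hits[of p U \<omega>]]
      counting_path_comp[OF counting_process_path[OF Z that] mono_misses[of p U \<omega>]]
    by (simp_all add: hits_def)
  ultimately show "counting_process M (\<lambda>t \<omega>. hits p U {..<Z t \<omega>} \<omega>)"
    "counting_process M (\<lambda>t \<omega>. Z t \<omega> - hits p U {..<Z t \<omega>} \<omega>)"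
    unfolding counting_process_def by blast+
qed

text \<open>Superposing independent Poisson processes \<open>X\<close> and \<open>Y\<close> is inverse to thinning: their joint
  law is that of the marked and the unmarked arrivals of one Poisson process of the total
  intensity, each arrival being marked independently with probability \<open>p\<close>.  Both sides have the
  same increments because a Poisson number of Bernoulli trials splits into independent Poisson
  numbers of hits and misses.\<close>

lemma (in prob_space) thinning_path_law:
  assumes FG: "indep_algebras M F G"
    and X: "counting_process F X" "poisson_increments M \<alpha> X"
    and Y: "counting_process G Y" "poisson_increments M \<beta> Y"
    and HU: "indep_algebras M H (variable_algebra M U UNIV)" and U: "iid_uniform M U"
    and Z: "counting_process H Z" "poisson_increments M (\<alpha> + \<beta>) Z"
    and p: "p = \<alpha> / (\<alpha> + \<beta>)" and rates: "0 < \<alpha>" "0 \<le> \<beta>"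
  shows "distr M path_algebra (\<lambda>\<omega> t. (X t \<omega>, Y t \<omega>)) =
    distr M path_algebra (\<lambda>\<omega> t. (hits p U {..<Z t \<omega>} \<omega>, Z t \<omega> - hits p U {..<Z t \<omega>} \<omega>))"
proof (rule path_law_eqI)
  have p01: "0 \<le> p" "p \<le> 1" using p rates by (auto simp: divide_le_eq_1)
  have ZM: "counting_process M Z" by (rule counting_process_subalgebra[OF Z(1) indep_algebrasD(1)[OF HU]])
  show "counting_process M X" "counting_process M Y"
    using counting_process_subalgebra[OF X(1) indep_algebrasD(1)[OF FG]]
      counting_process_subalgebra[OF Y(1) indep_algebrasD(2)[OF FG]] by auto
  show "counting_process M (\<lambda>t \<omega>. hits p U {..<Z t \<omega>} \<omega>)"
    "counting_process M (\<lambda>t \<omega>. Z t \<omega> - hits p U {..<Z t \<omega>} \<omega>)"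
    by (rule counting_process_mark_counts[OF ZM U])+
  fix k :: nat and t :: "nat \<Rightarrow> real" and a b :: "nat \<Rightarrow> nat"
  assume t: "t 0 = 0" "\<And>i. i < k \<Longrightarrow> t i \<le> t (Suc i)"
  then have t': "0 \<le> t 0" by simp
  \<comment> \<open>\<open>c i\<close> is the number of arrivals up to time \<open>t i\<close> that the prescribed increments entail, so the marks
    of the \<open>i\<close>-th cell are those with indices from \<open>c i\<close> to \<open>c (Suc i)\<close>, exclusive.\<close>
  define c where "c i = (\<Sum>j<i. a j + b j)" for i
  have c: "c 0 = 0" "c (Suc i) = c i + (a i + b i)" for i by (simp_all add: c_def)
  let ?A = "{\<omega>\<in>space M. \<forall>i<k. Z (t (Suc i)) \<omega> = Z (t i) \<omega> + (a i + b i)}"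
  let ?B = "{\<omega>\<in>space M. \<forall>i<k. hits p U {c i..<c (Suc i)} \<omega> = a i}"
  have "{\<omega>\<in>space M. \<forall>i<k.
      hits p U {..<Z (t (Suc i)) \<omega>} \<omega> = hits p U {..<Z (t i) \<omega>} \<omega> + a i \<and>
      Z (t (Suc i)) \<omega> - hits p U {..<Z (t (Suc i)) \<omega>} \<omega> =
        Z (t i) \<omega> - hits p U {..<Z (t i) \<omega>} \<omega> + b i} = ?A \<inter> ?B"
  proof -
    have "(\<forall>i<k. hits p U {..<Z (t (Suc i)) \<omega>} \<omega> = hits p U {..<Z (t i) \<omega>} \<omega> + a i \<and>
        Z (t (Suc i)) \<omega> - hits p U {..<Z (t (Suc i)) \<omega>} \<omega> =
          Z (t i) \<omega> - hits p U {..<Z (t i) \<omega>} \<omega> + b i) \<longleftrightarrow>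
      (\<forall>i<k. Z (t (Suc i)) \<omega> = Z (t i) \<omega> + (a i + b i)) \<and>
      (\<forall>i<k. hits p U {c i..<c (Suc i)} \<omega> = a i)" (is "?L \<longleftrightarrow> ?R1 \<and> ?R2") if \<omega>: "\<omega> \<in> space M" for \<omega>
    proof -
      have le: "hits p U {..<m} \<omega> \<le> m" for m
        using hits_le[of "{..<m}" p U \<omega>] by simp
      have Zc: "Z (t i) \<omega> = c i" if ?R1 "i \<le> k" for i
        using that(2)
      proof (induction i)
        case 0
        then show ?case using counting_process_path[OF ZM \<omega>] t c by (simp add: counting_path_def)
      next
        case (Suc i)
        then show ?case using that(1) c by simp
      qed
      have split: "hits p U {..<c (Suc i)} \<omega> = hits p U {..<c i} \<omega> + hits p U {c i..<c (Suc i)} \<omega>" for i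
        by (rule hits_split) (simp add: c)
      show ?thesis
      proof (intro iffI conjI)
        assume L: ?L
        show R1: ?R1
        proof (intro allI impI)
          fix i assume "i < k"
          then show "Z (t (Suc i)) \<omega> = Z (t i) \<omega> + (a i + b i)"
            using L le[of "Z (t (Suc i)) \<omega>"] le[of "Z (t i) \<omega>"] by force
        qed
        show ?R2
        proof (intro allI impI)
          fix i assume i: "i < k"
          have "Z (t (Suc i)) \<omega> = c (Suc i)" "Z (t i) \<omega> = c i" using Zc[OF R1] i by auto
          then show "hits p U {c i..<c (Suc i)} \<omega> = a i" using L i split[of i] by auto
        qed
      next
        assume R: "?R1 \<and> ?R2"
        show ?L
        proof (intro allI impI)
          fix i assume i: "i < k"
          have Zi: "Z (t (Suc i)) \<omega> = c (Suc i)" "Z (t i) \<omega> = c i" using Zc R i by auto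
          have h: "hits p U {..<c (Suc i)} \<omega> = hits p U {..<c i} \<omega> + a i"
            using R i split[of i] by simp
          show "hits p U {..<Z (t (Suc i)) \<omega>} \<omega> = hits p U {..<Z (t i) \<omega>} \<omega> + a i \<and>
              Z (t (Suc i)) \<omega> - hits p U {..<Z (t (Suc i)) \<omega>} \<omega> =
                Z (t i) \<omega> - hits p U {..<Z (t i) \<omega>} \<omega> + b i"
            unfolding Zi using h c(2)[of i] le[of "c i"] by simp
        qed
      qed
    qed
    then show ?thesis by auto
  qed
  moreover have "prob (?A \<inter> ?B) = prob ?A * prob ?B"
  proof (rule indep_algebrasD(3)[OF HU])
    have "space H = space M" using indep_algebrasD(1)[OF HU] by (simp add: subalgebra_def)
    then show "?A \<in> sets H"
      using counting_process_increment_event[OF Z(1) t' t(2), where d = "\<lambda>i. a i + b i"] by (simp only:)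
    have "{\<omega>\<in>space (variable_algebra M U UNIV). \<forall>i\<in>{..<k}. hits p U {c i..<c (Suc i)} \<omega> = a i}
      \<in> sets (variable_algebra M U UNIV)"
    proof (rule sets.sets_Collect_finite_All)
      fix i
      show "{\<omega>\<in>space (variable_algebra M U UNIV). hits p U {c i..<c (Suc i)} \<omega> = a i}
        \<in> sets (variable_algebra M U UNIV)"
        using measurable_sets[OF measurable_hits[OF subset_UNIV, of p U "{c i..<c (Suc i)}" M], of "{a i}"]
        by (simp add: vimage_def Int_def conj_commute)
    qed simp
    then show "?B \<in> sets (variable_algebra M U UNIV)"
      by (simp only: Ball_def lessThan_iff space_variable_algebra)
  qed
  moreover have "prob ?A = (\<Prod>i<k. poisson_weight ((\<alpha> + \<beta>) * (t (Suc i) - t i)) (a i + b i))"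
    by (rule poisson_incrementsD[OF Z(2) t' t(2)])
  moreover have "prob ?B = (\<Prod>i<k. binomial_weight p (c (Suc i) - c i) (a i))"
    by (rule hits_blocks_law[OF U p01]) (simp add: c)
  moreover have "prob {\<omega>\<in>space M. \<forall>i<k. X (t (Suc i)) \<omega> = X (t i) \<omega> + a i \<and>
      Y (t (Suc i)) \<omega> = Y (t i) \<omega> + b i} =
      (\<Prod>i<k. poisson_weight (\<alpha> * (t (Suc i) - t i)) (a i) * poisson_weight (\<beta> * (t (Suc i) - t i)) (b i))"
    by (rule poisson_increments_joint[OF FG X Y t' t(2)])
  moreover have "poisson_weight ((\<alpha> + \<beta>) * h) (a i + b i) * binomial_weight p (a i + b i) (a i) =
      poisson_weight (\<alpha> * h) (a i) * poisson_weight (\<beta> * h) (b i)" for i h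
    using rates by (intro poisson_weight_thinning p) auto
  ultimately show "prob {\<omega>\<in>space M. \<forall>i<k. X (t (Suc i)) \<omega> = X (t i) \<omega> + a i \<and>
        Y (t (Suc i)) \<omega> = Y (t i) \<omega> + b i} =
      prob {\<omega>\<in>space M. \<forall>i<k.
      hits p U {..<Z (t (Suc i)) \<omega>} \<omega> = hits p U {..<Z (t i) \<omega>} \<omega> + a i \<and>
      Z (t (Suc i)) \<omega> - hits p U {..<Z (t (Suc i)) \<omega>} \<omega> =
        Z (t i) \<omega> - hits p U {..<Z (t i) \<omega>} \<omega> + b i}"
    by (simp add: c(2) prod.distrib[symmetric])
qed

section \<open>Chains sampled from uniform variables\<close>

lemma sample_eq_Some_iff:
  assumes w: "\<And>j. j \<in> {1..p} \<Longrightarrow> 0 \<le> w j"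
  shows "sample p w u = Some k \<longleftrightarrow>
    k \<in> {1..p} \<and> u \<in> {(\<Sum>j\<in>{1..<k}. w j)..<(\<Sum>j\<in>{1..k}. w j)}"
proof -
  let ?P = "\<lambda>k. k \<in> {1..p} \<and> u \<in> {(\<Sum>j\<in>{1..<k}. w j)..<(\<Sum>j\<in>{1..k}. w j)}"
  have "\<not> (?P k \<and> ?P k')" if "k < k'" for k k'
  proof
    assume P: "?P k \<and> ?P k'"
    have "(\<Sum>j\<in>{1..k}. w j) \<le> (\<Sum>j\<in>{1..<k'}. w j)"
      by (rule sum_mono2) (use P that w in auto)
    then show False using P by auto
  qed
  then have uniq: "k = k'" if "?P k" "?P k'" for k k' using that by (metis linorder_neqE_nat)
  show ?thesis
  proof (cases "\<exists>k. ?P k")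
    case True
    then obtain k' where k': "?P k'" by blast
    then have "(THE k. ?P k) = k'" using uniq by blast
    then have "sample p w u = Some k'" unfolding sample_def using k' by auto
    then show ?thesis using k' uniq by (metis option.inject)
  next
    case False
    then have "sample p w u = None" unfolding sample_def by auto
    then show ?thesis using False by auto
  qed
qed

lemma sample_range:
  assumes "\<And>j. j \<in> {1..p} \<Longrightarrow> 0 \<le> w j"
  shows "sample p w u \<in> insert None (Some ` {1..p})"
proof (cases "sample p w u")
  case (Some k)
  then have "k \<in> {1..p}" using sample_eq_Some_iff[of p w u k, OF assms] by blast
  then show ?thesis using Some by blast
qed simp

lemma sample_measurable:
  assumes w [measurable]: "\<And>j. j \<in> {1..p} \<Longrightarrow> (\<lambda>\<omega>. w \<omega> j) \<in> borel_measurable G"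
    and u [measurable]: "u \<in> borel_measurable G"
  shows "(\<lambda>\<omega>. sample p (w \<omega>) (u \<omega>)) \<in> measurable G (count_space UNIV)"
proof -
  define K where "K \<omega> = {k\<in>{1..p}. u \<omega> \<in> {(\<Sum>j\<in>{1..<k}. w \<omega> j)..<(\<Sum>j\<in>{1..k}. w \<omega> j)}}" for \<omega>
  define f where "f A = (if A \<noteq> {} then Some (THE k. k \<in> A) else None)" for A :: "nat set"
  have "sample p (w \<omega>) (u \<omega>) = f (K \<omega>)" for \<omega>
  proof -
    have "K \<omega> \<noteq> {} \<longleftrightarrow>
        (\<exists>k\<in>{1..p}. u \<omega> \<in> {(\<Sum>j\<in>{1..<k}. w \<omega> j)..<(\<Sum>j\<in>{1..k}. w \<omega> j)})" by (auto simp: K_def)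
    then show ?thesis unfolding sample_def f_def by (simp only: K_def mem_Collect_eq)
  qed
  moreover have "K \<in> measurable G (count_space (Pow {1..p}))"
  proof (rule measurable_count_space_eq2[THEN iffD2], simp, safe)
    show "x \<in> {1..p}" if "x \<in> K \<omega>" for x \<omega> using that by (simp add: K_def)
    fix A assume A: "A \<subseteq> {1..p}"
    have "Measurable.pred G (\<lambda>\<omega>. k \<in> K \<omega> \<longleftrightarrow> k \<in> A)" if k: "k \<in> {1..p}" for k
    proof -
      have "(\<lambda>\<omega>. \<Sum>j\<in>{1..<k}. w \<omega> j) \<in> borel_measurable G"
        "(\<lambda>\<omega>. \<Sum>j\<in>{1..k}. w \<omega> j) \<in> borel_measurable G"
        using k by (auto intro!: borel_measurable_sum w)
      note [measurable] = this
      have "Measurable.pred G (\<lambda>\<omega>. ((\<Sum>j\<in>{1..<k}. w \<omega> j) \<le> u \<omega> \<and> u \<omega> < (\<Sum>j\<in>{1..k}. w \<omega> j)) \<longleftrightarrow> k \<in> A)"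
        by measurable
      then show ?thesis using k by (simp add: K_def)
    qed
    then have "{\<omega>\<in>space G. \<forall>k\<in>{1..p}. k \<in> K \<omega> \<longleftrightarrow> k \<in> A} \<in> sets G"
      by (intro sets.sets_Collect_finite_All) (auto simp: pred_def)
    moreover have "{\<omega>\<in>space G. \<forall>k\<in>{1..p}. k \<in> K \<omega> \<longleftrightarrow> k \<in> A} = K -` {A} \<inter> space G"
    proof -
      have "K \<omega> \<subseteq> {1..p}" for \<omega> unfolding K_def by blast
      then have "(\<forall>k\<in>{1..p}. k \<in> K \<omega> \<longleftrightarrow> k \<in> A) \<longleftrightarrow> K \<omega> = A" for \<omega> using A by blast
      then show ?thesis by blast
    qed
    ultimately show "K -` {A} \<inter> space G \<in> sets G" by (simp only:)
  qed
  then have "(\<lambda>\<omega>. f (K \<omega>)) \<in> measurable G (count_space UNIV)"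
    by (rule measurable_compose) simp
  ultimately show ?thesis by simp
qed

text \<open>The kernel \<open>q l\<close> governs the step from index \<open>l - 1\<close> to \<open>l\<close>; \<open>q 0\<close> does not occur.\<close>

definition substochastic :: "nat \<Rightarrow> (nat \<Rightarrow> nat \<Rightarrow> nat \<Rightarrow> real) \<Rightarrow> bool" where
  "substochastic p q \<longleftrightarrow>
     (\<forall>l\<ge>1. \<forall>i\<in>{1..p}. (\<forall>j\<in>{1..p}. 0 \<le> q l i j) \<and> (\<Sum>j\<in>{1..p}. q l i j) \<le> 1)"

lemma substochasticD:
  assumes "substochastic p q" "i \<in> {1..p}"
  shows "j \<in> {1..p} \<Longrightarrow> 0 \<le> q (Suc l) i j" "(\<Sum>j\<in>{1..p}. q (Suc l) i j) \<le> 1"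
  using assms by (auto simp: substochastic_def)

primrec sampled_chain ::
  "nat \<Rightarrow> (nat \<Rightarrow> real) \<Rightarrow> (nat \<Rightarrow> nat \<Rightarrow> nat \<Rightarrow> real) \<Rightarrow> (nat \<Rightarrow> real) \<Rightarrow> nat \<Rightarrow> nat option"
where
  "sampled_chain p \<alpha> q u 0 = sample p \<alpha> (u 0)"
| "sampled_chain p \<alpha> q u (Suc l) =
     (case sampled_chain p \<alpha> q u l of None \<Rightarrow> None | Some i \<Rightarrow> sample p (q (Suc l) i) (u (Suc l)))"

text \<open>The row vector \<open>\<alpha> q\<^sub>1 \<cdots> q\<^sub>l\<close>.\<close>

primrec occupation ::
  "nat \<Rightarrow> (nat \<Rightarrow> real) \<Rightarrow> (nat \<Rightarrow> nat \<Rightarrow> nat \<Rightarrow> real) \<Rightarrow> nat \<Rightarrow> nat \<Rightarrow> real"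
where
  "occupation p \<alpha> q 0 j = \<alpha> j"
| "occupation p \<alpha> q (Suc l) j = (\<Sum>i\<in>{1..p}. occupation p \<alpha> q l i * q (Suc l) i j)"

lemma sampled_chain_range:
  assumes \<alpha>: "probability_vector p \<alpha>" and q: "substochastic p q"
  shows "sampled_chain p \<alpha> q u l \<in> insert None (Some ` {1..p})"
proof (induction l)
  case 0
  then show ?case using sample_range[of p \<alpha>] \<alpha> by (simp add: probability_vector_def)
next
  case (Suc l)
  show ?case
  proof (cases "sampled_chain p \<alpha> q u l")
    case (Some i)
    then have "i \<in> {1..p}" using Suc by auto
    then show ?thesis using sample_range[of p "q (Suc l) i", OF substochasticD(1)[OF q]] Some by simp
  qed simp
qed

lemma sampled_chain_None_mono:
  "l \<le> m \<Longrightarrow> sampled_chain p \<alpha> q u l = None \<Longrightarrow> sampled_chain p \<alpha> q u m = None"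
  by (induction m) (auto simp: le_Suc_eq)

lemma sampled_chain_measurable:
  assumes q: "\<And>l i j. j \<in> {1..p} \<Longrightarrow> (\<lambda>\<omega>. q \<omega> l i j) \<in> borel_measurable G"
    and u: "\<And>k. k \<le> l \<Longrightarrow> (\<lambda>\<omega>. u \<omega> k) \<in> borel_measurable G"
  shows "(\<lambda>\<omega>. sampled_chain p \<alpha> (q \<omega>) (u \<omega>) l) \<in> measurable G (count_space UNIV)"
  using u
proof (induction l)
  case 0
  then show ?case using sample_measurable[of p "\<lambda>_. \<alpha>" G "\<lambda>\<omega>. u \<omega> 0"] by simp
next
  case (Suc l)
  have "(\<lambda>\<omega>. case x of None \<Rightarrow> None | Some i \<Rightarrow> sample p (q \<omega> (Suc l) i) (u \<omega> (Suc l)))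
      \<in> measurable G (count_space UNIV)" for x
    using sample_measurable[of p "\<lambda>\<omega>. q \<omega> (Suc l) (the x)" G "\<lambda>\<omega>. u \<omega> (Suc l)"] q Suc.prems
    by (cases x) auto
  from measurable_compose_countable[OF this Suc.IH] show ?case using Suc.prems by simp
qed

lemma occupation_nonneg:
  assumes \<alpha>: "probability_vector p \<alpha>" and q: "substochastic p q"
  shows "j \<in> {1..p} \<Longrightarrow> 0 \<le> occupation p \<alpha> q l j"
proof (induction l arbitrary: j)
  case 0
  then show ?case using \<alpha> by (simp add: probability_vector_def)
next
  case (Suc l)
  show ?case
    unfolding occupation.simps
    by (intro sum_nonneg mult_nonneg_nonneg Suc.IH substochasticD(1)[OF q] Suc.prems)
qed

lemma occupation_measurable:
  assumes q: "\<And>l i j. i \<in> {1..p} \<Longrightarrow> j \<in> {1..p} \<Longrightarrow> (\<lambda>\<omega>. q \<omega> l i j) \<in> borel_measurable G"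
  shows "j \<in> {1..p} \<Longrightarrow> (\<lambda>\<omega>. occupation p \<alpha> (q \<omega>) l j) \<in> borel_measurable G"
  by (induction l arbitrary: j) (auto intro!: borel_measurable_sum borel_measurable_times q)

context prob_space begin

lemma prob_sample:
  assumes U: "iid_uniform M U" and w: "\<And>j. j \<in> {1..p} \<Longrightarrow> 0 \<le> w j" "(\<Sum>j\<in>{1..p}. w j) \<le> 1"
  shows "prob {\<omega>\<in>space M. sample p w (U l \<omega>) = Some k} = (if k \<in> {1..p} then w k else 0)"
proof (cases "k \<in> {1..p}")
  case True
  let ?a = "\<Sum>j\<in>{1..<k}. w j" and ?b = "\<Sum>j\<in>{1..k}. w j"
  have eq: "?b = ?a + w k"
    using True by (simp add: atLeastLessThanSuc_atLeastAtMost[symmetric])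
  have "0 \<le> ?a" by (rule sum_nonneg) (use True w in auto)
  moreover have "?b \<le> (\<Sum>j\<in>{1..p}. w j)" by (rule sum_mono2) (use True w in auto)
  ultimately have "prob {\<omega>\<in>space M. U l \<omega> \<in> {?a..<?b}} = ?b - ?a"
    using w True eq by (intro iid_uniform_interval[OF U]) auto
  then show ?thesis using True eq sample_eq_Some_iff[of p w, OF w(1)] by simp
next
  case False
  then have "{\<omega>\<in>space M. sample p w (U l \<omega>) = Some k} = {}"
    using sample_eq_Some_iff[of p w, OF w(1)] by blast
  then show ?thesis using False by (simp only: if_False measure_empty)
qed

lemma prob_sample_None:
  assumes U: "iid_uniform M U" and w: "\<And>j. j \<in> {1..p} \<Longrightarrow> 0 \<le> w j" "(\<Sum>j\<in>{1..p}. w j) \<le> 1"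
  shows "prob {\<omega>\<in>space M. sample p w (U l \<omega>) = None} = 1 - (\<Sum>j\<in>{1..p}. w j)"
proof -
  have "(\<lambda>\<omega>. sample p w (U l \<omega>)) \<in> measurable M (count_space UNIV)"
    using iid_uniformD(1)[OF U] by (intro sample_measurable) auto
  then have ev: "{\<omega>\<in>space M. sample p w (U l \<omega>) = x} \<in> events" for x
    using measurable_sets[of "\<lambda>\<omega>. sample p w (U l \<omega>)" M "count_space UNIV" "{x}"]
    by (simp add: vimage_def Int_def conj_commute)
  have "{\<omega>\<in>space M. sample p w (U l \<omega>) = None} =
      space M - (\<Union>k\<in>{1..p}. {\<omega>\<in>space M. sample p w (U l \<omega>) = Some k})"
    using sample_range[of p w, OF w(1)] by fastforce
  moreover have "prob (space M - (\<Union>k\<in>{1..p}. {\<omega>\<in>space M. sample p w (U l \<omega>) = Some k})) =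
      1 - prob (\<Union>k\<in>{1..p}. {\<omega>\<in>space M. sample p w (U l \<omega>) = Some k})"
    using ev by (intro prob_compl) auto
  moreover have "prob (\<Union>k\<in>{1..p}. {\<omega>\<in>space M. sample p w (U l \<omega>) = Some k}) =
      (\<Sum>k\<in>{1..p}. prob {\<omega>\<in>space M. sample p w (U l \<omega>) = Some k})"
    using ev by (intro finite_measure_finite_Union) (auto simp: disjoint_family_on_def)
  ultimately show ?thesis using prob_sample[OF U w] by simp
qed

lemma sampled_chain_event:
  assumes "l \<in> A" "{..l} \<subseteq> A"
  shows "{\<omega>\<in>space M. sampled_chain p \<alpha> q (\<lambda>k. U k \<omega>) l = x} \<in> sets (variable_algebra M U A)"
proof -
  have "(\<lambda>\<omega>. sampled_chain p \<alpha> q (\<lambda>k. U k \<omega>) l) \<in> measurable (variable_algebra M U A) (count_space UNIV)"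
    using assms by (intro sampled_chain_measurable measurable_variable_algebra) auto
  from measurable_sets[OF this, of "{x}"] show ?thesis
    by (simp add: vimage_def Int_def conj_commute)
qed

lemma sampled_chain_law:
  assumes U: "iid_uniform M U" and \<alpha>: "probability_vector p \<alpha>" and q: "substochastic p q"
  shows "j \<in> {1..p} \<Longrightarrow>
    prob {\<omega>\<in>space M. sampled_chain p \<alpha> q (\<lambda>k. U k \<omega>) l = Some j} = occupation p \<alpha> q l j"
proof (induction l arbitrary: j)
  case 0
  then show ?case using prob_sample[OF U, of p \<alpha> 0 j] \<alpha> by (simp add: probability_vector_def)
next
  case (Suc l)
  let ?Y = "\<lambda>l \<omega>. sampled_chain p \<alpha> q (\<lambda>k. U k \<omega>) l"
  let ?A = "\<lambda>i. {\<omega>\<in>space M. ?Y l \<omega> = Some i}"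
  let ?B = "\<lambda>i. {\<omega>\<in>space M. sample p (q (Suc l) i) (U (Suc l) \<omega>) = Some j}"
  have A: "?A i \<in> sets (variable_algebra M U {..l})" for i by (rule sampled_chain_event) auto
  have B: "?B i \<in> sets (variable_algebra M U {Suc l})" for i
  proof -
    have "(\<lambda>\<omega>. sample p (q (Suc l) i) (U (Suc l) \<omega>)) \<in> measurable (variable_algebra M U {Suc l}) (count_space UNIV)"
      by (intro sample_measurable measurable_variable_algebra) auto
    from measurable_sets[OF this, of "{Some j}"] show ?thesis
      by (simp add: vimage_def Int_def conj_commute)
  qed
  have ind: "indep_algebras M (variable_algebra M U {..l}) (variable_algebra M U {Suc l})"
    by (rule iid_uniformD[OF U]) auto
  have ev: "?A i \<inter> ?B i \<in> events" for i
    using A[of i] B[of i] iid_uniformD(3)[OF U] by (auto simp: subalgebra_def)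
  have "{\<omega>\<in>space M. ?Y (Suc l) \<omega> = Some j} = (\<Union>i\<in>{1..p}. ?A i \<inter> ?B i)"
  proof (intro set_eqI iffI)
    fix \<omega> assume \<omega>: "\<omega> \<in> {\<omega>\<in>space M. ?Y (Suc l) \<omega> = Some j}"
    then obtain i where i: "?Y l \<omega> = Some i" by (auto split: option.splits)
    then have "i \<in> {1..p}" using sampled_chain_range[OF \<alpha> q, of "\<lambda>k. U k \<omega>" l] by auto
    then show "\<omega> \<in> (\<Union>i\<in>{1..p}. ?A i \<inter> ?B i)" using \<omega> i by auto
  qed auto
  moreover have "prob (\<Union>i\<in>{1..p}. ?A i \<inter> ?B i) = (\<Sum>i\<in>{1..p}. prob (?A i \<inter> ?B i))"
    using ev by (intro finite_measure_finite_Union) (auto simp: disjoint_family_on_def)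
  moreover have "(\<Sum>i\<in>{1..p}. prob (?A i \<inter> ?B i)) = (\<Sum>i\<in>{1..p}. occupation p \<alpha> q l i * q (Suc l) i j)"
  proof (rule sum.cong[OF refl])
    fix i assume i: "i \<in> {1..p}"
    have "prob (?B i) = q (Suc l) i j"
      using prob_sample[OF U substochasticD[OF q i], where l = "Suc l" and k = j] Suc.prems by simp
    then show "prob (?A i \<inter> ?B i) = occupation p \<alpha> q l i * q (Suc l) i j"
      using indep_algebrasD(3)[OF ind A B, of i i] Suc.IH[OF i] by simp
  qed
  ultimately show ?case by simp
qed

text \<open>Decoupling replaces the uniform variables by a copy, after which the kernels and the index are
  constants for them and \<open>sampled_chain_law\<close> applies.  This is how one conditions on the clocks.\<close>

lemma sampled_chain_freezing:
  assumes U: "iid_uniform M U" and F: "indep_algebras M F (variable_algebra M U UNIV)"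
    and \<alpha>: "probability_vector p \<alpha>" and q: "\<And>\<omega>. \<omega> \<in> space M \<Longrightarrow> substochastic p (q \<omega>)"
    and qm: "\<And>l i j. j \<in> {1..p} \<Longrightarrow> (\<lambda>\<omega>. q \<omega> l i j) \<in> borel_measurable F"
    and k: "k \<in> measurable F (count_space UNIV)" and D: "D \<in> sets F" and j: "j \<in> {1..p}"
  shows "emeasure M {\<omega>\<in>space M. \<omega> \<in> D \<and> sampled_chain p \<alpha> (q \<omega>) (\<lambda>l. U l \<omega>) (k \<omega>) = Some j} =
    (\<integral>\<^sup>+\<omega>. indicator D \<omega> * ennreal (occupation p \<alpha> (q \<omega>) (k \<omega>) j) \<partial>M)"
proof -
  let ?G = "variable_algebra M U UNIV"
  let ?Q = "\<lambda>\<omega> \<omega>'. \<omega> \<in> D \<and> sampled_chain p \<alpha> (q \<omega>) (\<lambda>l. U l \<omega>') (k \<omega>) = Some j"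
  have chain: "(\<lambda>z. sampled_chain p \<alpha> (q (fst z)) (\<lambda>l. U l (snd z)) m)
      \<in> measurable (F \<Otimes>\<^sub>M ?G) (count_space UNIV)" for m
    by (rule sampled_chain_measurable)
       (blast intro: measurable_compose[OF measurable_fst qm]
         measurable_compose[OF measurable_snd measurable_variable_algebra])+
  have kf: "(\<lambda>z. k (fst z)) \<in> measurable (F \<Otimes>\<^sub>M ?G) (count_space UNIV)"
    by (rule measurable_compose[OF measurable_fst k])
  have [measurable]: "(\<lambda>z. sampled_chain p \<alpha> (q (fst z)) (\<lambda>l. U l (snd z)) (k (fst z)))
      \<in> measurable (F \<Otimes>\<^sub>M ?G) (count_space UNIV)"
    by (rule measurable_compose_countable[OF chain kf])
  note [measurable] = D
  have "Measurable.pred (F \<Otimes>\<^sub>M ?G) (\<lambda>z. fst z \<in> D \<and>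
      sampled_chain p \<alpha> (q (fst z)) (\<lambda>l. U l (snd z)) (k (fst z)) = Some j)"
    by measurable
  then have Q: "Measurable.pred (F \<Otimes>\<^sub>M ?G) (\<lambda>(\<omega>, \<omega>'). ?Q \<omega> \<omega>')"
    by (simp add: case_prod_beta')
  have inner: "emeasure M {\<omega>'\<in>space M. ?Q \<omega> \<omega>'} =
      indicator D \<omega> * ennreal (occupation p \<alpha> (q \<omega>) (k \<omega>) j)" if \<omega>: "\<omega> \<in> space M" for \<omega>
    using sampled_chain_law[OF U \<alpha> q[OF \<omega>] j, of "k \<omega>"]
    by (cases "\<omega> \<in> D") (simp_all add: emeasure_eq_measure)
  show ?thesis
    unfolding decoupling_event[OF F Q] by (rule nn_integral_cong) (rule inner)
qed

end

text \<open>The occupation probabilities of a chain that moves only at the marked steps; its \<open>l\<close>-th step,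
  counted from zero, uses the kernel \<open>q (Suc l)\<close> if \<open>l\<close> is marked.\<close>

primrec marked_occupation ::
  "nat \<Rightarrow> (nat \<Rightarrow> real) \<Rightarrow> (nat \<Rightarrow> nat \<Rightarrow> nat \<Rightarrow> real) \<Rightarrow> (nat \<Rightarrow> bool) \<Rightarrow> nat \<Rightarrow> nat \<Rightarrow> real"
where
  "marked_occupation p \<alpha> q b 0 j = \<alpha> j"
| "marked_occupation p \<alpha> q b (Suc l) j =
     (if b l then \<Sum>i\<in>{1..p}. marked_occupation p \<alpha> q b l i * q (Suc l) i j
      else marked_occupation p \<alpha> q b l j)"

lemma marked_occupation_nonneg:
  assumes \<alpha>: "probability_vector p \<alpha>" and q: "substochastic p q"
  shows "j \<in> {1..p} \<Longrightarrow> 0 \<le> marked_occupation p \<alpha> q b l j"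
proof (induction l arbitrary: j)
  case 0
  then show ?case using \<alpha> by (simp add: probability_vector_def)
next
  case (Suc l)
  have "0 \<le> (\<Sum>i\<in>{1..p}. marked_occupation p \<alpha> q b l i * q (Suc l) i j)"
    by (intro sum_nonneg mult_nonneg_nonneg Suc.IH substochasticD(1)[OF q] Suc.prems)
  then show ?case using Suc.IH[OF Suc.prems] by simp
qed

lemma marked_occupation_cong:
  "(\<And>k. k < l \<Longrightarrow> b k = b' k) \<Longrightarrow> marked_occupation p \<alpha> q b l j = marked_occupation p \<alpha> q b' l j"
  by (induction l arbitrary: j) auto

lemma marked_occupation_measurable:
  assumes q: "\<And>l i j. i \<in> {1..p} \<Longrightarrow> j \<in> {1..p} \<Longrightarrow> (\<lambda>\<omega>. q \<omega> l i j) \<in> borel_measurable G"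
    and b: "\<And>k. k < l \<Longrightarrow> Measurable.pred G (\<lambda>\<omega>. b \<omega> k)"
  shows "j \<in> {1..p} \<Longrightarrow> (\<lambda>\<omega>. marked_occupation p \<alpha> (q \<omega>) (b \<omega>) l j) \<in> borel_measurable G"
  using b
proof (induction l arbitrary: j)
  case (Suc l)
  then have [measurable]: "Measurable.pred G (\<lambda>\<omega>. b \<omega> l)"
    "(\<lambda>\<omega>. marked_occupation p \<alpha> (q \<omega>) (b \<omega>) l j) \<in> borel_measurable G"
    "(\<lambda>\<omega>. \<Sum>i\<in>{1..p}. marked_occupation p \<alpha> (q \<omega>) (b \<omega>) l i * q \<omega> (Suc l) i j) \<in> borel_measurable G"
    by (auto intro!: borel_measurable_sum borel_measurable_times q)
  show ?case by simp measurable
qed simp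

lemma ennreal_mixture:
  assumes "0 \<le> a" "0 \<le> b" "0 \<le> r" "r \<le> 1"
  shows "ennreal a * ennreal r + ennreal b * ennreal (1 - r) = ennreal (a * r + b * (1 - r))"
  using assms by (simp add: ennreal_mult ennreal_plus)

text \<open>If every step is marked independently with probability \<open>r\<close>, then averaging over the marks replaces
  each kernel by its mixture with the identity.  The mark of the last step is independent of the
  vector reached before it, and the step is linear in this vector.\<close>

lemma (in prob_space) marked_occupation_average:
  assumes U: "iid_uniform M U" and \<alpha>: "probability_vector p \<alpha>" and q: "substochastic p q"
    and r: "0 \<le> r" "r \<le> 1"
    and q': "\<And>l i j. i \<in> {1..p} \<Longrightarrow> j \<in> {1..p} \<Longrightarrow>
      q' (Suc l) i j = r * q (Suc l) i j + (1 - r) * (if i = j then 1 else 0)"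
  shows "j \<in> {1..p} \<Longrightarrow>
    (\<integral>\<^sup>+\<omega>. ennreal (marked_occupation p \<alpha> q (\<lambda>k. U k \<omega> < r) l j) \<partial>M) = ennreal (occupation p \<alpha> q' l j)"
proof (induction l arbitrary: j)
  case 0
  then show ?case by (simp add: emeasure_space_1)
next
  case (Suc l)
  let ?m = "\<lambda>\<omega> i. marked_occupation p \<alpha> q (\<lambda>k. U k \<omega> < r) l i"
  let ?s = "\<lambda>\<omega>. \<Sum>i\<in>{1..p}. ?m \<omega> i * q (Suc l) i j"
  have m0: "0 \<le> ?m \<omega> i" if "i \<in> {1..p}" for \<omega> i by (rule marked_occupation_nonneg[OF \<alpha> q that])
  have q0: "0 \<le> q (Suc l) i j" if "i \<in> {1..p}" for i
    using substochasticD(1)[OF q that Suc.prems] .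
  have s0: "0 \<le> ?s \<omega>" for \<omega> by (intro sum_nonneg mult_nonneg_nonneg m0 q0)
  let ?F = "variable_algebra M U {..<l}" and ?G = "variable_algebra M U {l}"
  have FG: "indep_algebras M ?F ?G" by (rule iid_uniformD[OF U]) auto
  have Ul [measurable]: "U l \<in> borel_measurable ?G" by (rule measurable_variable_algebra) simp
  have UlM [measurable]: "U l \<in> borel_measurable M" by (rule iid_uniformD(1)[OF U])
  have mF: "(\<lambda>\<omega>. ?m \<omega> i) \<in> borel_measurable ?F" if "i \<in> {1..p}" for i
  proof (rule marked_occupation_measurable[OF _ _ that])
    fix k assume "k < l"
    then have [measurable]: "U k \<in> borel_measurable ?F" by (intro measurable_variable_algebra) auto
    show "Measurable.pred ?F (\<lambda>\<omega>. U k \<omega> < r)" by measurable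
  qed simp
  have mM: "(\<lambda>\<omega>. ?m \<omega> i) \<in> borel_measurable M" if "i \<in> {1..p}" for i
    by (rule measurable_from_subalg[OF iid_uniformD(3)[OF U] mF[OF that]])
  have mj [measurable]: "(\<lambda>\<omega>. ?m \<omega> j) \<in> borel_measurable ?F" by (rule mF[OF Suc.prems])
  have sj [measurable]: "?s \<in> borel_measurable ?F"
    by (intro borel_measurable_sum borel_measurable_times mF) auto
  have "(\<integral>\<^sup>+\<omega>. ennreal (marked_occupation p \<alpha> q (\<lambda>k. U k \<omega> < r) (Suc l) j) \<partial>M) =
      (\<integral>\<^sup>+\<omega>. (if U l \<omega> < r then ennreal (?s \<omega>) else ennreal (?m \<omega> j)) \<partial>M)"
    by (intro nn_integral_cong) simp
  also have "\<dots> = (\<integral>\<^sup>+\<omega>. \<integral>\<^sup>+\<omega>'. (if U l \<omega>' < r then ennreal (?s \<omega>) else ennreal (?m \<omega> j)) \<partial>M \<partial>M)"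
    by (rule decoupling[OF FG]) measurable
  also have "\<dots> = (\<integral>\<^sup>+\<omega>. ennreal (?s \<omega> * r + ?m \<omega> j * (1 - r)) \<partial>M)"
  proof (intro nn_integral_cong)
    fix \<omega>
    have less: "emeasure M {\<omega>\<in>space M. U l \<omega> < r} = ennreal r"
      using iid_uniform_less[OF U r, of l] by (simp add: emeasure_eq_measure)
    have "{\<omega>\<in>space M. \<not> U l \<omega> < r} = space M - {\<omega>\<in>space M. U l \<omega> < r}" by auto
    then have ge: "emeasure M {\<omega>\<in>space M. \<not> U l \<omega> < r} = ennreal (1 - r)"
      using prob_compl[of "{\<omega>\<in>space M. U l \<omega> < r}"] iid_uniform_less[OF U r, of l]
      by (simp add: emeasure_eq_measure)
    have "(\<integral>\<^sup>+\<omega>'. (if U l \<omega>' < r then ennreal (?s \<omega>) else ennreal (?m \<omega> j)) \<partial>M) =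
        (\<integral>\<^sup>+\<omega>'. ennreal (?s \<omega>) * indicator {\<omega>\<in>space M. U l \<omega> < r} \<omega>' +
          ennreal (?m \<omega> j) * indicator {\<omega>\<in>space M. \<not> U l \<omega> < r} \<omega>' \<partial>M)"
      by (intro nn_integral_cong) (auto split: split_indicator)
    also have "\<dots> = ennreal (?s \<omega>) * ennreal r + ennreal (?m \<omega> j) * ennreal (1 - r)"
      by (subst nn_integral_add) (simp_all add: nn_integral_cmult_indicator less ge)
    also have "\<dots> = ennreal (?s \<omega> * r + ?m \<omega> j * (1 - r))"
      by (rule ennreal_mixture[OF s0 m0[OF Suc.prems] r])
    finally show "(\<integral>\<^sup>+\<omega>'. (if U l \<omega>' < r then ennreal (?s \<omega>) else ennreal (?m \<omega> j)) \<partial>M) =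
        ennreal (?s \<omega> * r + ?m \<omega> j * (1 - r))" .
  qed
  also have "\<dots> = (\<integral>\<^sup>+\<omega>. (\<Sum>i\<in>{1..p}. ennreal (q' (Suc l) i j) * ennreal (?m \<omega> i)) \<partial>M)"
  proof (intro nn_integral_cong)
    fix \<omega>
    have "?s \<omega> * r + ?m \<omega> j * (1 - r) = (\<Sum>i\<in>{1..p}. q' (Suc l) i j * ?m \<omega> i)"
    proof -
      have "(\<Sum>i\<in>{1..p}. q' (Suc l) i j * ?m \<omega> i) =
          (\<Sum>i\<in>{1..p}. ?m \<omega> i * q (Suc l) i j * r + (if i = j then ?m \<omega> i * (1 - r) else 0))"
      proof (intro sum.cong refl)
        fix i assume i: "i \<in> {1..p}"
        show "q' (Suc l) i j * ?m \<omega> i =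
            ?m \<omega> i * q (Suc l) i j * r + (if i = j then ?m \<omega> i * (1 - r) else 0)"
          by (simp add: q'[OF i Suc.prems] algebra_simps)
      qed
      also have "\<dots> = ?s \<omega> * r + ?m \<omega> j * (1 - r)"
        using Suc.prems by (simp add: sum.distrib sum_distrib_right)
      finally show ?thesis by simp
    qed
    moreover have q'0: "0 \<le> q' (Suc l) i j" if "i \<in> {1..p}" for i
      using q0[OF that] r Suc.prems that by (simp add: q')
    moreover have "ennreal (\<Sum>i\<in>{1..p}. q' (Suc l) i j * ?m \<omega> i) =
        (\<Sum>i\<in>{1..p}. ennreal (q' (Suc l) i j * ?m \<omega> i))"
      by (intro sum_ennreal[symmetric] mult_nonneg_nonneg m0 q'0)
    moreover have "\<dots> = (\<Sum>i\<in>{1..p}. ennreal (q' (Suc l) i j) * ennreal (?m \<omega> i))"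
      by (intro sum.cong refl ennreal_mult' q'0)
    ultimately show "ennreal (?s \<omega> * r + ?m \<omega> j * (1 - r)) =
        (\<Sum>i\<in>{1..p}. ennreal (q' (Suc l) i j) * ennreal (?m \<omega> i))"
      by (simp only:)
  qed
  also have "\<dots> = (\<Sum>i\<in>{1..p}. ennreal (q' (Suc l) i j) * (\<integral>\<^sup>+\<omega>. ennreal (?m \<omega> i) \<partial>M))"
    using mM by (subst nn_integral_sum) (auto simp: nn_integral_cmult)
  also have "\<dots> = (\<Sum>i\<in>{1..p}. ennreal (occupation p \<alpha> q' l i * q' (Suc l) i j))"
  proof (rule sum.cong[OF refl])
    fix i assume i: "i \<in> {1..p}"
    have "0 \<le> q' (Suc l) i j" using q0[OF i] r Suc.prems i by (simp add: q')
    then show "ennreal (q' (Suc l) i j) * (\<integral>\<^sup>+\<omega>. ennreal (?m \<omega> i) \<partial>M) =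
        ennreal (occupation p \<alpha> q' l i * q' (Suc l) i j)"
      by (simp only: Suc.IH[OF i] mult.commute[of "occupation p \<alpha> q' l i"] ennreal_mult')
  qed
  also have "\<dots> = ennreal (occupation p \<alpha> q' (Suc l) j)"
  proof -
    have "substochastic p q'"
      unfolding substochastic_def
    proof (intro allI impI ballI conjI)
      fix l i assume l: "1 \<le> (l::nat)" and i: "i \<in> {1..p}"
      then obtain l' where l': "l = Suc l'" by (cases l) auto
      show "0 \<le> q' l i j" if "j \<in> {1..p}" for j
        using substochasticD(1)[OF q i that] r i that by (simp add: l' q')
      have "(\<Sum>j\<in>{1..p}. q' l i j) = r * (\<Sum>j\<in>{1..p}. q l i j) + (1 - r)"
        using i by (simp add: l' q' sum.distrib sum_distrib_left[symmetric])
      also have "\<dots> \<le> r * 1 + (1 - r)"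
        using substochasticD(2)[OF q i] r by (intro add_right_mono mult_left_mono) (auto simp: l')
      finally show "(\<Sum>j\<in>{1..p}. q' l i j) \<le> 1" by simp
    qed
    then have nn: "0 \<le> occupation p \<alpha> q' l i * q' (Suc l) i j" if "i \<in> {1..p}" for i
      using occupation_nonneg[OF \<alpha> _ that] substochasticD(1)[OF _ that Suc.prems] by simp
    show ?thesis unfolding occupation.simps by (intro sum_ennreal nn)
  qed
  finally show ?case .
qed

section \<open>Chains subordinated to a Poisson process\<close>

text \<open>The chain started in state \<open>i\<close> of block \<open>l\<close>, that is, with \<open>l - 1\<close> steps already made: its first step
  is the \<open>l\<close>-th one.\<close>

primrec chain_from ::
  "nat \<Rightarrow> (nat \<Rightarrow> nat \<Rightarrow> nat \<Rightarrow> real) \<Rightarrow> (nat \<Rightarrow> real) \<Rightarrow> nat \<Rightarrow> nat \<Rightarrow> nat \<Rightarrow> nat option"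
where
  "chain_from p q u l i 0 = Some i"
| "chain_from p q u l i (Suc d) =
     (case chain_from p q u l i d of None \<Rightarrow> None | Some j \<Rightarrow> sample p (q (l + d) j) (u (l + d)))"

lemma sampled_chain_add:
  "sampled_chain p \<alpha> q u (m + d) =
    (case sampled_chain p \<alpha> q u m of None \<Rightarrow> None | Some i \<Rightarrow> chain_from p q u (Suc m) i d)"
  by (induction d) (auto split: option.split)

lemma chain_from_measurable:
  assumes "{l..<l + d} \<subseteq> A"
  shows "(\<lambda>\<omega>. chain_from p q (\<lambda>k. U k \<omega>) l i d) \<in> measurable (variable_algebra P U A) (count_space UNIV)"
  using assms
proof (induction d)
  case (Suc d)
  have A: "l + d \<in> A" "{l..<l + d} \<subseteq> A" using Suc.prems by (auto simp: subset_iff)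
  then have IH: "(\<lambda>\<omega>. chain_from p q (\<lambda>k. U k \<omega>) l i d) \<in> measurable (variable_algebra P U A) (count_space UNIV)"
    using Suc.IH by blast
  have "(\<lambda>\<omega>. case x of None \<Rightarrow> None | Some j \<Rightarrow> sample p (q (l + d) j) (U (l + d) \<omega>))
      \<in> measurable (variable_algebra P U A) (count_space UNIV)" for x
    using sample_measurable[of p "\<lambda>_. q (l + d) (the x)" "variable_algebra P U A" "U (l + d)",
        OF _ measurable_variable_algebra[OF A(1)]]
    by (cases x) auto
  from measurable_compose_countable[OF this IH] show ?case by simp
qed simp

text \<open>Blocks are numbered from one, so after \<open>m\<close> steps the chain is in block \<open>Suc m\<close>.\<close>

definition block_chain ::
  "nat \<Rightarrow> (nat \<Rightarrow> real) \<Rightarrow> (nat \<Rightarrow> nat \<Rightarrow> nat \<Rightarrow> real) \<Rightarrow> (nat \<Rightarrow> real) \<Rightarrow> nat \<Rightarrow> (nat \<times> nat) option"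
where
  "block_chain p \<alpha> q u m = map_option (Pair (Suc m)) (sampled_chain p \<alpha> q u m)"

text \<open>The block of a state tells which kernels come next.  Hence the \<open>d\<close>-step transition probabilities
  depend on the state only, and not on the number of steps made before.\<close>

fun block_transition ::
  "'a measure \<Rightarrow> (nat \<Rightarrow> 'a \<Rightarrow> real) \<Rightarrow> nat \<Rightarrow> (nat \<Rightarrow> nat \<Rightarrow> nat \<Rightarrow> real) \<Rightarrow> nat \<Rightarrow>
   (nat \<times> nat) option \<Rightarrow> (nat \<times> nat) option \<Rightarrow> real"
where
  "block_transition P U p q d None y = (if y = None then 1 else 0)"
| "block_transition P U p q d (Some (l, i)) y =
     measure P {\<omega>\<in>space P. map_option (Pair (l + d)) (chain_from p q (\<lambda>k. U k \<omega>) l i d) = y}"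

lemma block_chain_measurable:
  assumes "{..m} \<subseteq> A"
  shows "(\<lambda>\<omega>. block_chain p \<alpha> q (\<lambda>k. U k \<omega>) m) \<in> measurable (variable_algebra P U A) (count_space UNIV)"
proof -
  have "(\<lambda>\<omega>. sampled_chain p \<alpha> q (\<lambda>k. U k \<omega>) m) \<in> measurable (variable_algebra P U A) (count_space UNIV)"
    using assms by (intro sampled_chain_measurable measurable_variable_algebra) auto
  then show ?thesis unfolding block_chain_def by (rule measurable_compose) simp
qed

lemma event_of_measurable:
  "f \<in> measurable F (count_space UNIV) \<Longrightarrow> {\<omega>\<in>space F. f \<omega> = x} \<in> sets F"
  using measurable_sets[of f F "count_space UNIV" "{x}"] by (simp add: vimage_def Int_def conj_commute)

context prob_space begin

lemma block_transition_bounds: "0 \<le> block_transition M U p q d x y" "block_transition M U p q d x y \<le> 1"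
  by (cases x; auto simp: prob_le_1 split: prod.split)+

text \<open>The first \<open>m k\<close> steps depend on the uniform variables up to index \<open>m k\<close>, the following \<open>d\<close> steps on
  the state reached and on later variables.\<close>

lemma block_chain_markov:
  assumes U: "iid_uniform M U" and m: "\<And>i::nat. i \<le> k \<Longrightarrow> m i \<le> m k"
  shows "prob {\<omega>\<in>space M. (\<forall>i\<le>k. block_chain p \<alpha> q (\<lambda>k. U k \<omega>) (m i) = x i) \<and>
        block_chain p \<alpha> q (\<lambda>k. U k \<omega>) (m k + d) = y} =
      prob {\<omega>\<in>space M. \<forall>i\<le>k. block_chain p \<alpha> q (\<lambda>k. U k \<omega>) (m i) = x i} *
      block_transition M U p q d (x k) y"
proof -
  let ?Y = "\<lambda>m \<omega>. block_chain p \<alpha> q (\<lambda>k. U k \<omega>) m"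
  let ?A = "{\<omega>\<in>space M. \<forall>i\<le>k. ?Y (m i) \<omega> = x i}"
  let ?AY = "{\<omega>\<in>space M. (\<forall>i\<le>k. ?Y (m i) \<omega> = x i) \<and> ?Y (m k + d) \<omega> = y}"
  have "{\<omega>\<in>space (variable_algebra M U {..m k}). \<forall>i\<in>{..k}. ?Y (m i) \<omega> = x i}
      \<in> sets (variable_algebra M U {..m k})"
  proof (rule sets.sets_Collect_finite_All)
    fix i assume "i \<in> {..k}"
    then have "{..m i} \<subseteq> {..m k}" using m by auto
    from event_of_measurable[OF block_chain_measurable[OF this]]
    show "{\<omega>\<in>space (variable_algebra M U {..m k}). ?Y (m i) \<omega> = x i}
      \<in> sets (variable_algebra M U {..m k})" .
  qed simp
  then have A: "?A \<in> sets (variable_algebra M U {..m k})"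
    by (simp only: Ball_def atMost_iff space_variable_algebra)
  show ?thesis
  proof (cases "x k")
    case None
    have "?Y (m k + d) \<omega> = None" if "\<omega> \<in> ?A" for \<omega>
    proof -
      have "?Y (m k) \<omega> = None" using that None by auto
      then show ?thesis by (simp add: block_chain_def sampled_chain_add)
    qed
    then have "?AY = (if y = None then ?A else {})" by auto
    then show ?thesis using None by simp
  next
    case (Some z)
    obtain l i where z: "z = (l, i)" by force
    show ?thesis
    proof (cases "l = Suc (m k)")
      case False
      have "?A = {}"
      proof -
        have "?Y (m k) \<omega> \<noteq> x k" for \<omega> using False Some z by (auto simp: block_chain_def)
        then show ?thesis by auto
      qed
      then have "?AY = {}" by blast
      then show ?thesis by (simp only: \<open>?A = {}\<close> measure_empty mult_zero_left)
    next
      case True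
      let ?B = "{\<omega>\<in>space M. map_option (Pair (l + d)) (chain_from p q (\<lambda>k. U k \<omega>) l i d) = y}"
      have "(\<lambda>\<omega>. map_option (Pair (l + d)) (chain_from p q (\<lambda>k. U k \<omega>) l i d))
          \<in> measurable (variable_algebra M U {l..<l + d}) (count_space UNIV)"
        by (rule measurable_compose[OF chain_from_measurable]) auto
      from event_of_measurable[OF this, of y]
      have B: "?B \<in> sets (variable_algebra M U {l..<l + d})" by simp
      have "?Y (m k + d) \<omega> = map_option (Pair (l + d)) (chain_from p q (\<lambda>k. U k \<omega>) l i d)"
        if "\<omega> \<in> ?A" for \<omega>
      proof -
        have "?Y (m k) \<omega> = Some (l, i)" using that Some z by auto
        then have "sampled_chain p \<alpha> q (\<lambda>k. U k \<omega>) (m k) = Some i" by (auto simp: block_chain_def)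
        then show ?thesis using True by (simp add: block_chain_def sampled_chain_add)
      qed
      then have "?AY = ?A \<inter> ?B" by auto
      moreover have "indep_algebras M (variable_algebra M U {..m k}) (variable_algebra M U {l..<l + d})"
        by (rule iid_uniformD[OF U]) (use True in auto)
      ultimately show ?thesis using indep_algebrasD(3)[OF _ A B] Some z by simp
    qed
  qed
qed

lemma poisson_markov:
  assumes Z: "counting_process M Z" "poisson_increments M r Z"
    and t: "0 \<le> t 0" "\<And>i. i \<le> k \<Longrightarrow> t i \<le> t (Suc i)"
  shows "prob {\<omega>\<in>space M. (\<forall>i\<le>k. Z (t i) \<omega> = c i) \<and> Z (t (Suc k)) \<omega> = c k + d} =
    prob {\<omega>\<in>space M. \<forall>i\<le>k. Z (t i) \<omega> = c i} * poisson_weight (r * (t (Suc k) - t k)) d"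
proof -
  \<comment> \<open>Time zero and level zero are put in front of the given times and levels.\<close>
  define s where "s i = (case i of 0 \<Rightarrow> 0 | Suc j \<Rightarrow> t j)" for i
  define e where "e i = (case i of 0 \<Rightarrow> 0 | Suc j \<Rightarrow> if j \<le> k then c j else c k + d)" for i
  have s: "s 0 = 0" "\<And>i. i < Suc (Suc k) \<Longrightarrow> s i \<le> s (Suc i)"
    using t by (auto simp: s_def split: nat.split)
  then have s': "0 \<le> s 0" by simp
  have lev: "(\<forall>i\<le>Suc m. Z (s i) \<omega> = e i) \<longleftrightarrow> (\<forall>i\<le>m. Z (t i) \<omega> = e (Suc i))"
    if "\<omega> \<in> space M" for \<omega> m
  proof -
    have "Z (s 0) \<omega> = e 0"
      using counting_process_path[OF Z(1) that] by (simp add: s_def e_def counting_path_def)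
    moreover have "(\<forall>i\<le>Suc m. P i) \<longleftrightarrow> P 0 \<and> (\<forall>i\<le>m. P (Suc i))" for P
      by (metis Suc_le_mono le0 nat.exhaust)
    ultimately show ?thesis by (simp add: s_def)
  qed
  have inc: "{\<omega>\<in>space M. \<forall>i\<le>m. Z (t i) \<omega> = e (Suc i)} =
      (if \<forall>i<Suc m. e i \<le> e (Suc i)
       then {\<omega>\<in>space M. \<forall>i<Suc m. Z (s (Suc i)) \<omega> = Z (s i) \<omega> + (e (Suc i) - e i)} else {})"
    if m: "m \<le> Suc k" for m
  proof -
    have sm: "\<And>i. i < Suc m \<Longrightarrow> s i \<le> s (Suc i)" using s m by auto
    have "(\<forall>i\<le>m. Z (t i) \<omega> = e (Suc i)) \<longleftrightarrow> (\<forall>i<Suc m. e i \<le> e (Suc i)) \<and>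
        (\<forall>i<Suc m. Z (s (Suc i)) \<omega> = Z (s i) \<omega> + (e (Suc i) - e i))" if "\<omega> \<in> space M" for \<omega>
      using lev[OF that, of m]
        levels_iff_increments[where x = "\<lambda>t. Z t \<omega>", OF counting_process_path[OF Z(1) that] s(1) sm, where c = e]
      by (simp add: e_def)
    then show ?thesis by (cases "\<forall>i<Suc m. e i \<le> e (Suc i)") auto
  qed
  have P: "prob {\<omega>\<in>space M. \<forall>i\<le>m. Z (t i) \<omega> = e (Suc i)} =
      (if \<forall>i<Suc m. e i \<le> e (Suc i)
       then \<Prod>i<Suc m. poisson_weight (r * (s (Suc i) - s i)) (e (Suc i) - e i) else 0)"
    if m: "m \<le> Suc k" for m
  proof -
    have sm: "\<And>i. i < Suc m \<Longrightarrow> s i \<le> s (Suc i)" using s m by auto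
    show ?thesis
      unfolding inc[OF m] using poisson_incrementsD[OF Z(2) s' sm, where d = "\<lambda>i. e (Suc i) - e i"]
      by (simp only: if_distrib[of prob] measure_empty)
  qed
  have "{\<omega>\<in>space M. (\<forall>i\<le>k. Z (t i) \<omega> = c i) \<and> Z (t (Suc k)) \<omega> = c k + d} =
      {\<omega>\<in>space M. \<forall>i\<le>Suc k. Z (t i) \<omega> = e (Suc i)}"
    by (auto simp: e_def le_Suc_eq)
  moreover have "{\<omega>\<in>space M. \<forall>i\<le>k. Z (t i) \<omega> = c i} = {\<omega>\<in>space M. \<forall>i\<le>k. Z (t i) \<omega> = e (Suc i)}"
    by (auto simp: e_def)
  moreover have "(\<forall>i<Suc (Suc k). e i \<le> e (Suc i)) \<longleftrightarrow> (\<forall>i<Suc k. e i \<le> e (Suc i))"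
    by (auto simp: less_Suc_eq e_def)
  moreover have "s (Suc (Suc k)) - s (Suc k) = t (Suc k) - t k" "e (Suc (Suc k)) - e (Suc k) = d"
    by (simp_all add: s_def e_def)
  moreover have "(\<Prod>i<Suc (Suc k). poisson_weight (r * (s (Suc i) - s i)) (e (Suc i) - e i)) =
      (\<Prod>i<Suc k. poisson_weight (r * (s (Suc i) - s i)) (e (Suc i) - e i)) *
      poisson_weight (r * (s (Suc (Suc k)) - s (Suc k))) (e (Suc (Suc k)) - e (Suc k))"
    by (rule prod.lessThan_Suc)
  moreover have "(if Q then a * b else 0) = (if Q then a else 0) * b" for Q and a b :: real by simp
  ultimately show ?thesis by (simp only: P[OF order_refl] P[OF le_SucI[OF order_refl]])
qed

text \<open>For variables with countably many values independence can be checked on single values.\<close>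

lemma discrete_indep_algebras:
  fixes V :: "'a \<Rightarrow> 'c :: countable" and D :: "'a \<Rightarrow> 'd :: countable"
  assumes V [measurable]: "V \<in> measurable M (count_space UNIV)"
    and D [measurable]: "D \<in> measurable M (count_space UNIV)"
    and VD: "\<And>v d. prob {\<omega>\<in>space M. V \<omega> = v \<and> D \<omega> = d} =
      prob {\<omega>\<in>space M. V \<omega> = v} * prob {\<omega>\<in>space M. D \<omega> = d}"
  shows "indep_algebras M (vimage_algebra (space M) V (count_space UNIV))
    (vimage_algebra (space M) D (count_space UNIV))"
proof -
  have decomp: "emeasure M (E \<inter> (W -` A \<inter> space M)) =
      (\<integral>\<^sup>+w. emeasure M (E \<inter> {\<omega>\<in>space M. W \<omega> = w}) \<partial>count_space A)"
    if E: "E \<in> events" and W: "W \<in> measurable M (count_space UNIV)"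
    for E and W :: "'a \<Rightarrow> 'e :: countable" and A
  proof -
    have eq: "E \<inter> (W -` A \<inter> space M) = (\<Union>w\<in>A. E \<inter> {\<omega>\<in>space M. W \<omega> = w})" by auto
    show ?thesis
      unfolding eq
    proof (rule emeasure_UN_countable)
      show "E \<inter> {\<omega>\<in>space M. W \<omega> = w} \<in> events" if "w \<in> A" for w
        by (rule sets.Int[OF E event_of_measurable[OF W]])
      show "disjoint_family_on (\<lambda>w. E \<inter> {\<omega>\<in>space M. W \<omega> = w}) A"
        by (auto simp: disjoint_family_on_def)
    qed simp
  qed
  have "emeasure M (V -` A \<inter> space M \<inter> (D -` B \<inter> space M)) =
      emeasure M (V -` A \<inter> space M) * emeasure M (D -` B \<inter> space M)" for A B
  proof -
    have sV: "{\<omega>\<in>space M. V \<omega> = v} \<in> events" for v by (rule event_of_measurable[OF V])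
    have sB: "D -` B \<inter> space M \<in> events" by measurable
    have point: "emeasure M ({\<omega>\<in>space M. V \<omega> = v} \<inter> (D -` B \<inter> space M)) =
        emeasure M {\<omega>\<in>space M. V \<omega> = v} * emeasure M (D -` B \<inter> space M)" for v
    proof -
      have "emeasure M ({\<omega>\<in>space M. V \<omega> = v} \<inter> {\<omega>\<in>space M. D \<omega> = d}) =
          emeasure M {\<omega>\<in>space M. V \<omega> = v} * emeasure M (space M \<inter> {\<omega>\<in>space M. D \<omega> = d})" for d
      proof -
        have "{\<omega>\<in>space M. V \<omega> = v} \<inter> {\<omega>\<in>space M. D \<omega> = d} = {\<omega>\<in>space M. V \<omega> = v \<and> D \<omega> = d}"
          "space M \<inter> {\<omega>\<in>space M. D \<omega> = d} = {\<omega>\<in>space M. D \<omega> = d}" by auto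
        then show ?thesis by (simp add: emeasure_eq_measure VD ennreal_mult)
      qed
      then have "emeasure M ({\<omega>\<in>space M. V \<omega> = v} \<inter> (D -` B \<inter> space M)) =
          emeasure M {\<omega>\<in>space M. V \<omega> = v} * emeasure M (space M \<inter> (D -` B \<inter> space M))"
        unfolding decomp[OF sV D] decomp[OF sets.top D] by (simp add: nn_integral_cmult)
      then show ?thesis by (simp add: Int_absorb1)
    qed
    have "emeasure M ((D -` B \<inter> space M) \<inter> (V -` A \<inter> space M)) =
        emeasure M (D -` B \<inter> space M) * emeasure M (space M \<inter> (V -` A \<inter> space M))"
      unfolding decomp[OF sB V] decomp[OF sets.top V]
    proof (subst nn_integral_cmult[symmetric])
      show "(\<integral>\<^sup>+w. emeasure M (D -` B \<inter> space M \<inter> {\<omega>\<in>space M. V \<omega> = w}) \<partial>count_space A) =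
          (\<integral>\<^sup>+w. emeasure M (D -` B \<inter> space M) * emeasure M (space M \<inter> {\<omega>\<in>space M. V \<omega> = w}) \<partial>count_space A)"
      proof (rule nn_integral_cong)
        fix w
        have "space M \<inter> {\<omega>\<in>space M. V \<omega> = w} = {\<omega>\<in>space M. V \<omega> = w}" by auto
        then show "emeasure M (D -` B \<inter> space M \<inter> {\<omega>\<in>space M. V \<omega> = w}) =
            emeasure M (D -` B \<inter> space M) * emeasure M (space M \<inter> {\<omega>\<in>space M. V \<omega> = w})"
          using point[of w] by (simp only: Int_commute[of "D -` B \<inter> space M"] mult.commute)
      qed
    qed simp
    then show ?thesis by (simp add: Int_absorb1 Int_commute mult.commute)
  qed
  then have prod: "prob (V -` A \<inter> space M \<inter> (D -` B \<inter> space M)) =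
      prob (V -` A \<inter> space M) * prob (D -` B \<inter> space M)" for A B
    by (simp add: measure_def enn2real_mult)
  have sub: "subalgebra M (vimage_algebra (space M) W (count_space UNIV))"
    if "W \<in> measurable M (count_space UNIV)" for W :: "'a \<Rightarrow> 'e :: countable"
    using that by (auto simp: subalgebra_def sets_vimage_algebra2)
  show ?thesis
    unfolding indep_algebras_def using sub[OF V] sub[OF D] prod
    by (auto simp: sets_vimage_algebra2)
qed

lemma nn_integral_discrete:
  fixes D :: "'a \<Rightarrow> nat"
  assumes D: "D \<in> measurable M (count_space UNIV)"
  shows "(\<integral>\<^sup>+\<omega>. f (D \<omega>) \<partial>M) = (\<Sum>d. f d * emeasure M {\<omega>\<in>space M. D \<omega> = d})"
proof -
  have "(\<integral>\<^sup>+\<omega>. f (D \<omega>) \<partial>M) = (\<integral>\<^sup>+\<omega>. (\<Sum>d. f d * indicator {\<omega>\<in>space M. D \<omega> = d} \<omega>) \<partial>M)"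
  proof (rule nn_integral_cong)
    fix \<omega> assume \<omega>: "\<omega> \<in> space M"
    have "(\<Sum>d. f d * indicator {\<omega>\<in>space M. D \<omega> = d} \<omega>) = (\<Sum>d\<in>{D \<omega>}. f d * indicator {\<omega>\<in>space M. D \<omega> = d} \<omega>)"
      by (rule suminf_finite) auto
    then show "f (D \<omega>) = (\<Sum>d. f d * indicator {\<omega>\<in>space M. D \<omega> = d} \<omega>)" using \<omega> by simp
  qed
  also have "\<dots> = (\<Sum>d. \<integral>\<^sup>+\<omega>. f d * indicator {\<omega>\<in>space M. D \<omega> = d} \<omega> \<partial>M)"
    using event_of_measurable[OF D] by (intro nn_integral_suminf) auto
  also have "\<dots> = (\<Sum>d. f d * emeasure M {\<omega>\<in>space M. D \<omega> = d})"
    using event_of_measurable[OF D] by (simp add: nn_integral_cmult_indicator)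
  finally show ?thesis .
qed

end

definition poisson_mixture :: "real \<Rightarrow> (nat \<Rightarrow> real) \<Rightarrow> real" where
  "poisson_mixture m r = (\<Sum>d. poisson_weight m d * r d)"

lemma poisson_mixture_summable:
  assumes "\<And>d. 0 \<le> r d" "\<And>d. r d \<le> 1" "0 \<le> m"
  shows "summable (\<lambda>d. poisson_weight m d * r d)"
proof (rule summable_comparison_test')
  show "summable (poisson_weight m)" using poisson_weight_sums sums_summable by blast
  show "norm (poisson_weight m d * r d) \<le> poisson_weight m d" for d
    using assms poisson_weight_nonneg[OF assms(3), of d]
    by (simp add: abs_mult mult_left_le)
qed

text \<open>Near time zero at most one jump matters: the mixture is a power series in \<open>m\<close> with coefficients
  \<open>r d / fact d\<close>, times \<open>exp (- m)\<close>, and only its constant and its linear term enter the derivative.\<close>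

lemma poisson_mixture_derivative:
  assumes r: "\<And>d. 0 \<le> r d" "\<And>d. r d \<le> 1"
  shows "((\<lambda>h. (poisson_mixture (n * h) r - r 0) / h) \<longlongrightarrow> n * (r 1 - r 0)) (at_right 0)"
proof -
  define c where "c d = r d / fact d" for d
  have summable: "summable (\<lambda>d. c d * y ^ d)" for y :: real
  proof (rule summable_comparison_test')
    show "summable (\<lambda>d. \<bar>y\<bar> ^ d /\<^sub>R fact d)" using exp_converges sums_summable by blast
    show "norm (c d * y ^ d) \<le> \<bar>y\<bar> ^ d /\<^sub>R fact d" for d
      using r[of d] by (simp add: c_def abs_mult power_abs divide_inverse mult_left_le mult_right_mono mult.commute[of "r d"] mult.assoc mult_left_le_one_le)
  qed
  have mix: "poisson_mixture y r = (\<Sum>d. c d * y ^ d) * exp (- y)" for y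
  proof -
    have "(\<Sum>d. c d * y ^ d) * exp (- y) = (\<Sum>d. c d * y ^ d * exp (- y))"
      by (rule suminf_mult2[OF summable])
    then show ?thesis unfolding poisson_mixture_def
      by (simp add: poisson_weight_def c_def mult_ac)
  qed
  have series: "((\<lambda>y. \<Sum>d. c d * y ^ d) has_field_derivative (\<Sum>d. diffs c d * 0 ^ d)) (at 0)"
    by (rule termdiffs_strong_converges_everywhere[OF summable])
  have c1: "(\<Sum>d. diffs c d * 0 ^ d) = r 1" by (simp only: powser_zero) (simp add: diffs_def c_def)
  have c0: "(\<Sum>d. c d * 0 ^ d) = r 0" by (simp only: powser_zero) (simp add: c_def)
  have inner: "((\<lambda>h. n * h) has_field_derivative n) (at 0)"
    by (auto intro!: derivative_eq_intros)
  have "((\<lambda>h. \<Sum>d. c d * (n * h) ^ d) has_field_derivative r 1 * n) (at 0)"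
    using DERIV_chain2[OF _ inner, of "\<lambda>y. \<Sum>d. c d * y ^ d" "r 1"] series c1 by simp
  moreover have "((\<lambda>h. exp (- (n * h))) has_field_derivative - n) (at 0)"
    by (auto intro!: derivative_eq_intros)
  ultimately have "((\<lambda>h. (\<Sum>d. c d * (n * h) ^ d) * exp (- (n * h))) has_field_derivative
      r 1 * n * exp (- (n * 0)) + - n * (\<Sum>d. c d * (n * 0) ^ d)) (at 0)"
    by (rule DERIV_mult)
  then have "((\<lambda>h. poisson_mixture (n * h) r) has_field_derivative n * (r 1 - r 0)) (at 0)"
    using c0 by (simp add: mix algebra_simps)
  then have "((\<lambda>h. (poisson_mixture (n * (0 + h)) r - poisson_mixture (n * 0) r) / h) \<longlongrightarrow>
      n * (r 1 - r 0)) (at 0)"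
    unfolding DERIV_def .
  moreover have "poisson_mixture (n * 0) r = r 0" using c0 by (simp add: mix)
  ultimately have "((\<lambda>h. (poisson_mixture (n * h) r - r 0) / h) \<longlongrightarrow> n * (r 1 - r 0)) (at 0)" by simp
  then show ?thesis by (rule filterlim_mono[OF _ order_refl at_le]) simp
qed

definition subordinated_chain ::
  "nat \<Rightarrow> (nat \<Rightarrow> real) \<Rightarrow> (nat \<Rightarrow> nat \<Rightarrow> nat \<Rightarrow> real) \<Rightarrow> (real \<Rightarrow> 'a \<Rightarrow> nat) \<Rightarrow> (nat \<Rightarrow> 'a \<Rightarrow> real) \<Rightarrow>
   real \<Rightarrow> 'a \<Rightarrow> (nat \<times> nat) option"
where
  "subordinated_chain p \<alpha> q Z U t \<omega> = block_chain p \<alpha> q (\<lambda>k. U k \<omega>) (Z t \<omega>)"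

context prob_space begin

lemma subordinated_chain_measurable:
  assumes U: "iid_uniform M U" and Z: "counting_process M Z" and t: "0 \<le> t"
  shows "subordinated_chain p \<alpha> q Z U t \<in> measurable M (count_space UNIV)"
proof -
  have "(\<lambda>\<omega>. block_chain p \<alpha> q (\<lambda>k. U k \<omega>) m) \<in> measurable M (count_space UNIV)" for m
    by (rule measurable_from_subalg[OF iid_uniformD(3)[OF U] block_chain_measurable[OF order_refl]])
  from measurable_compose_countable[OF this counting_process_measurable[OF Z t]]
  show ?thesis by (simp add: subordinated_chain_def[abs_def])
qed

text \<open>First the clock is decoupled from the uniform variables, which reduces the claim to the Markov
  property of the block chain at fixed numbers of steps; then the next increment of the clock is
  decoupled from its past, which averages the transition probabilities over a Poisson number of
  steps.\<close>

lemma subordinated_chain_markov: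
  assumes U: "iid_uniform M U" and HU: "indep_algebras M H (variable_algebra M U UNIV)"
    and Z: "counting_process H Z" "poisson_increments M r Z" and r: "0 \<le> r"
    and t: "0 \<le> t 0" "\<And>i. i \<le> k \<Longrightarrow> t i \<le> t (Suc i)"
  shows "prob {\<omega>\<in>space M. \<forall>i\<le>Suc k. subordinated_chain p \<alpha> q Z U (t i) \<omega> = x i} =
    prob {\<omega>\<in>space M. \<forall>i\<le>k. subordinated_chain p \<alpha> q Z U (t i) \<omega> = x i} *
    poisson_mixture (r * (t (Suc k) - t k)) (\<lambda>d. block_transition M U p q d (x k) (x (Suc k)))"
proof -
  let ?Y = "\<lambda>m \<omega>. block_chain p \<alpha> q (\<lambda>k. U k \<omega>) m"
  let ?G = "variable_algebra M U UNIV"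
  let ?R = "\<lambda>d. block_transition M U p q d (x k) (x (Suc k))"
  note sub = indep_algebrasD(1)[OF HU]
  have ZM: "counting_process M Z" by (rule counting_process_subalgebra[OF Z(1) sub])
  have spaceH: "space H = space M" using sub by (simp add: subalgebra_def)
  have t0: "0 \<le> t i" if "i \<le> Suc k" for i
    using nondecreasing_times_nonneg[of t "Suc k" i] t that by auto
  have Q: "Measurable.pred (H \<Otimes>\<^sub>M ?G) (\<lambda>(\<omega>, \<omega>'). \<forall>i\<le>j. ?Y (Z (t i) \<omega>) \<omega>' = x i)"
    if j: "j \<le> Suc k" for j
  proof -
    have "{z\<in>space (H \<Otimes>\<^sub>M ?G). \<forall>i\<in>{..j}. ?Y (Z (t i) (fst z)) (snd z) = x i} \<in> sets (H \<Otimes>\<^sub>M ?G)"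
    proof (rule sets.sets_Collect_finite_All)
      fix i assume "i \<in> {..j}"
      then have Zt: "Z (t i) \<in> measurable H (count_space UNIV)"
        using j by (intro counting_process_measurable[OF Z(1)] t0) auto
      have "(\<lambda>z. ?Y m (snd z)) \<in> measurable (H \<Otimes>\<^sub>M ?G) (count_space UNIV)" for m
        by (rule measurable_compose[OF measurable_snd block_chain_measurable]) simp
      from measurable_compose_countable[OF this measurable_compose[OF measurable_fst Zt]]
      show "{z\<in>space (H \<Otimes>\<^sub>M ?G). ?Y (Z (t i) (fst z)) (snd z) = x i} \<in> sets (H \<Otimes>\<^sub>M ?G)"
        by (rule event_of_measurable)
    qed simp
    then show ?thesis unfolding pred_def case_prod_beta' Ball_def atMost_iff .
  qed
  \<comment> \<open>\<open>V\<close> is the past of the clock, \<open>D\<close> its next increment, and \<open>g v\<close> the probability that the block chain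
    visits the prescribed states after the numbers of steps in \<open>v\<close>.\<close>
  define V where "V \<omega> = map (\<lambda>i. Z (t i) \<omega>) [0..<Suc k]" for \<omega>
  define D where "D \<omega> = Z (t (Suc k)) \<omega> - Z (t k) \<omega>" for \<omega>
  define g where "g v = emeasure M {\<omega>'\<in>space M. \<forall>i\<le>k. ?Y (v ! i) \<omega>' = x i}" for v :: "nat list"
  have Vi: "V \<omega> ! i = Z (t i) \<omega>" if "i \<le> k" for i \<omega> using that by (simp add: V_def del: upt_Suc)
  have mono: "Z (t i) \<omega> \<le> Z (t j) \<omega>" if "\<omega> \<in> space M" "i \<le> j" "j \<le> Suc k" for i j \<omega>
  proof -
    have "t i \<le> t j" using that(2,3)
    proof (induction j)
      case (Suc j)
      then show ?case using t(2)[of j] by (cases "i = Suc j") auto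
    qed simp
    then show ?thesis using t0[of i] that by (intro counting_path_mono[OF counting_process_path[OF ZM]]) auto
  qed
  have Zt: "Z (t i) \<in> measurable M (count_space UNIV)" if "i \<le> Suc k" for i
    by (rule counting_process_measurable[OF ZM t0[OF that]])
  have Veq: "V \<omega> = v \<longleftrightarrow> length v = Suc k \<and> (\<forall>i\<le>k. Z (t i) \<omega> = v ! i)" for v \<omega>
    unfolding list_eq_iff_nth_eq using Vi by (auto simp: V_def less_Suc_eq_le)
  have Vev: "{\<omega>\<in>space M. V \<omega> = v} \<in> events" for v
  proof -
    have "{\<omega>\<in>space M. \<forall>i\<in>{..k}. Z (t i) \<omega> = v ! i} \<in> events"
      by (rule sets.sets_Collect_finite_All) (auto intro!: event_of_measurable Zt)
    moreover have "{\<omega>\<in>space M. V \<omega> = v} =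
        (if length v = Suc k then {\<omega>\<in>space M. \<forall>i\<in>{..k}. Z (t i) \<omega> = v ! i} else {})"
      by (auto simp: Veq)
    ultimately show ?thesis
      by (cases "length v = Suc k") (simp_all only: if_True if_False sets.empty_sets simp_thms)
  qed
  have V [measurable]: "V \<in> measurable M (count_space UNIV)"
    using Vev unfolding measurable_count_space_eq2_countable
    by (simp add: vimage_def Int_def conj_commute)
  have Dm [measurable]: "D \<in> measurable M (count_space UNIV)"
    unfolding D_def
    by (rule measurable_compose_countable[OF measurable_compose[OF Zt[of "Suc k"]] Zt[of k]]) auto
  have Deq: "D \<omega> = d \<longleftrightarrow> Z (t (Suc k)) \<omega> = Z (t k) \<omega> + d" if "\<omega> \<in> space M" for d \<omega>
    using mono[OF that, of k "Suc k"] by (auto simp: D_def)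
  have tk: "0 \<le> t k" "t k \<le> t (Suc k)" using t0[of k] t(2)[of k] by auto
  have PD: "prob {\<omega>\<in>space M. D \<omega> = d} = poisson_weight (r * (t (Suc k) - t k)) d" for d
  proof -
    have "{\<omega>\<in>space M. D \<omega> = d} = {\<omega>\<in>space M. Z (t (Suc k)) \<omega> = Z (t k) \<omega> + d}" using Deq by auto
    then show ?thesis using poisson_increments_single[OF Z(2) tk] by simp
  qed
  have ind: "indep_algebras M (vimage_algebra (space M) V (count_space UNIV))
      (vimage_algebra (space M) D (count_space UNIV))"
  proof (rule discrete_indep_algebras[OF V Dm])
    fix v d
    show "prob {\<omega>\<in>space M. V \<omega> = v \<and> D \<omega> = d} =
        prob {\<omega>\<in>space M. V \<omega> = v} * prob {\<omega>\<in>space M. D \<omega> = d}"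
    proof (cases "length v = Suc k")
      case True
      have "{\<omega>\<in>space M. V \<omega> = v \<and> D \<omega> = d} =
          {\<omega>\<in>space M. (\<forall>i\<le>k. Z (t i) \<omega> = v ! i) \<and> Z (t (Suc k)) \<omega> = v ! k + d}"
      proof -
        have "V \<omega> = v \<and> D \<omega> = d \<longleftrightarrow>
            (\<forall>i\<le>k. Z (t i) \<omega> = v ! i) \<and> Z (t (Suc k)) \<omega> = v ! k + d" if "\<omega> \<in> space M" for \<omega>
          unfolding Veq Deq[OF that] using True by auto
        then show ?thesis by blast
      qed
      moreover have "{\<omega>\<in>space M. V \<omega> = v} = {\<omega>\<in>space M. \<forall>i\<le>k. Z (t i) \<omega> = v ! i}"
        using True by (auto simp: Veq)
      ultimately show ?thesis
        using poisson_markov[OF ZM Z(2) t, where c = "\<lambda>i. v ! i" and d = d] PD by simp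
    qed (simp add: Veq)
  qed
  have eqk: "{\<omega>\<in>space M. \<forall>i\<le>j. subordinated_chain p \<alpha> q Z U (t i) \<omega> = x i} =
      {\<omega>\<in>space M. \<forall>i\<le>j. ?Y (Z (t i) \<omega>) \<omega> = x i}" for j
    by (simp add: subordinated_chain_def)
  have gV: "g (V \<omega>) = emeasure M {\<omega>'\<in>space M. \<forall>i\<le>k. ?Y (Z (t i) \<omega>) \<omega>' = x i}" for \<omega>
  proof -
    have "(\<forall>i\<le>k. ?Y (V \<omega> ! i) \<omega>' = x i) \<longleftrightarrow> (\<forall>i\<le>k. ?Y (Z (t i) \<omega>) \<omega>' = x i)" for \<omega>'
      using Vi by metis
    then show ?thesis by (simp only: g_def)
  qed
  have past: "emeasure M {\<omega>\<in>space M. \<forall>i\<le>k. ?Y (Z (t i) \<omega>) \<omega> = x i} = (\<integral>\<^sup>+\<omega>. g (V \<omega>) \<partial>M)"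
    by (simp only: gV decoupling_event[OF HU Q[OF le_SucI[OF order_refl]]])
  have "emeasure M {\<omega>\<in>space M. \<forall>i\<le>Suc k. ?Y (Z (t i) \<omega>) \<omega> = x i} =
      (\<integral>\<^sup>+\<omega>. emeasure M {\<omega>'\<in>space M. \<forall>i\<le>Suc k. ?Y (Z (t i) \<omega>) \<omega>' = x i} \<partial>M)"
    by (rule decoupling_event[OF HU Q[OF order_refl]])
  also have "\<dots> = (\<integral>\<^sup>+\<omega>. g (V \<omega>) * ennreal (?R (D \<omega>)) \<partial>M)"
  proof (rule nn_integral_cong)
    fix \<omega> assume \<omega>: "\<omega> \<in> space M"
    have "{\<omega>'\<in>space M. \<forall>i\<le>Suc k. ?Y (Z (t i) \<omega>) \<omega>' = x i} =
        {\<omega>'\<in>space M. (\<forall>i\<le>k. ?Y (Z (t i) \<omega>) \<omega>' = x i) \<and> ?Y (Z (t k) \<omega> + D \<omega>) \<omega>' = x (Suc k)}"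
      using mono[OF \<omega>, of k "Suc k"] by (auto simp: le_Suc_eq D_def)
    then have "prob {\<omega>'\<in>space M. \<forall>i\<le>Suc k. ?Y (Z (t i) \<omega>) \<omega>' = x i} =
        prob {\<omega>'\<in>space M. \<forall>i\<le>k. ?Y (Z (t i) \<omega>) \<omega>' = x i} * ?R (D \<omega>)"
      using block_chain_markov[OF U, where m = "\<lambda>i. Z (t i) \<omega>" and k = k and x = x and y = "x (Suc k)" and d = "D \<omega>"]
        mono[OF \<omega>, of _ k] by simp
    then show "emeasure M {\<omega>'\<in>space M. \<forall>i\<le>Suc k. ?Y (Z (t i) \<omega>) \<omega>' = x i} =
        g (V \<omega>) * ennreal (?R (D \<omega>))"
      by (simp add: emeasure_eq_measure gV ennreal_mult block_transition_bounds)
  qed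
  also have "\<dots> = (\<integral>\<^sup>+\<omega>. \<integral>\<^sup>+\<omega>'. g (V \<omega>) * ennreal (?R (D \<omega>')) \<partial>M \<partial>M)"
  proof (rule decoupling[OF ind])
    have V': "V \<in> measurable (vimage_algebra (space M) V (count_space UNIV)) (count_space UNIV)"
      and D': "D \<in> measurable (vimage_algebra (space M) D (count_space UNIV)) (count_space UNIV)"
      by (rule measurable_vimage_algebra1; simp)+
    have "(\<lambda>z. g (V (fst z)) * ennreal (?R (D (snd z)))) \<in> borel_measurable
        (vimage_algebra (space M) V (count_space UNIV) \<Otimes>\<^sub>M vimage_algebra (space M) D (count_space UNIV))"
    proof (rule borel_measurable_times_ennreal)
      show "(\<lambda>z. g (V (fst z))) \<in> borel_measurable
          (vimage_algebra (space M) V (count_space UNIV) \<Otimes>\<^sub>M vimage_algebra (space M) D (count_space UNIV))"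
        by (rule measurable_compose[OF measurable_compose[OF measurable_fst V']]) simp
      show "(\<lambda>z. ennreal (?R (D (snd z)))) \<in> borel_measurable
          (vimage_algebra (space M) V (count_space UNIV) \<Otimes>\<^sub>M vimage_algebra (space M) D (count_space UNIV))"
        by (rule measurable_compose[OF measurable_compose[OF measurable_snd D']]) simp
    qed
    then show "(\<lambda>(\<omega>, \<omega>'). g (V \<omega>) * ennreal (?R (D \<omega>'))) \<in> borel_measurable
        (vimage_algebra (space M) V (count_space UNIV) \<Otimes>\<^sub>M vimage_algebra (space M) D (count_space UNIV))"
      by (simp add: case_prod_beta')
  qed
  also have "\<dots> = (\<integral>\<^sup>+\<omega>. g (V \<omega>) * (\<integral>\<^sup>+\<omega>'. ennreal (?R (D \<omega>')) \<partial>M) \<partial>M)"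
    by (intro nn_integral_cong nn_integral_cmult measurable_compose[OF Dm]) simp
  also have "\<dots> = (\<integral>\<^sup>+\<omega>. g (V \<omega>) \<partial>M) * (\<integral>\<^sup>+\<omega>'. ennreal (?R (D \<omega>')) \<partial>M)"
    by (intro nn_integral_multc measurable_compose[OF V]) simp
  also have "(\<integral>\<^sup>+\<omega>'. ennreal (?R (D \<omega>')) \<partial>M) = ennreal (poisson_mixture (r * (t (Suc k) - t k)) ?R)"
  proof -
    have rt: "0 \<le> r * (t (Suc k) - t k)" using r tk by simp
    have "(\<integral>\<^sup>+\<omega>'. ennreal (?R (D \<omega>')) \<partial>M) = (\<Sum>d. ennreal (?R d) * emeasure M {\<omega>\<in>space M. D \<omega> = d})"
      by (rule nn_integral_discrete[OF Dm])
    also have "\<dots> = (\<Sum>d. ennreal (poisson_weight (r * (t (Suc k) - t k)) d * ?R d))"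
      by (simp add: emeasure_eq_measure PD ennreal_mult poisson_weight_nonneg[OF rt] block_transition_bounds mult.commute)
    also have "\<dots> = ennreal (poisson_mixture (r * (t (Suc k) - t k)) ?R)"
      unfolding poisson_mixture_def
      by (intro suminf_ennreal2 mult_nonneg_nonneg poisson_weight_nonneg[OF rt] block_transition_bounds
          poisson_mixture_summable rt)
    finally show ?thesis .
  qed
  finally have "emeasure M {\<omega>\<in>space M. \<forall>i\<le>Suc k. ?Y (Z (t i) \<omega>) \<omega> = x i} =
      emeasure M {\<omega>\<in>space M. \<forall>i\<le>k. ?Y (Z (t i) \<omega>) \<omega> = x i} *
      ennreal (poisson_mixture (r * (t (Suc k) - t k)) ?R)"
    using past by simp
  moreover have "0 \<le> poisson_mixture (r * (t (Suc k) - t k)) ?R"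
    unfolding poisson_mixture_def
    using r tk by (intro suminf_nonneg poisson_mixture_summable mult_nonneg_nonneg poisson_weight_nonneg block_transition_bounds) auto
  ultimately have "prob {\<omega>\<in>space M. \<forall>i\<le>Suc k. ?Y (Z (t i) \<omega>) \<omega> = x i} =
      prob {\<omega>\<in>space M. \<forall>i\<le>k. ?Y (Z (t i) \<omega>) \<omega> = x i} * poisson_mixture (r * (t (Suc k) - t k)) ?R"
    by (simp add: measure_def enn2real_mult)
  then show ?thesis by (simp only: eqk)
qed

end

section \<open>Transfer of a process to its path space\<close>

text \<open>The image is given the largest \<open>\<sigma>\<close>-algebra that makes \<open>\<phi>\<close> measurable, so that whatever is measurable
  after composition with \<open>\<phi>\<close> is measurable on the image.  Applied to the map from sample points to
  paths, it moves a process to a measure on its space of paths, over which the definition of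
  phase-type laws quantifies.\<close>

definition image_measure :: "'a measure \<Rightarrow> ('a \<Rightarrow> 'b) \<Rightarrow> 'b measure" where
  "image_measure P \<phi> = distr P
     (measure_of (\<phi> ` space P) {A. A \<subseteq> \<phi> ` space P \<and> \<phi> -` A \<inter> space P \<in> sets P} (\<lambda>_. 0)) \<phi>"

lemma sigma_algebra_image:
  "sigma_algebra (\<phi> ` space P) {A. A \<subseteq> \<phi> ` space P \<and> \<phi> -` A \<inter> space P \<in> sets P}"
proof (rule sigma_algebra_iff2[THEN iffD2], intro conjI ballI allI impI)
  show "{A. A \<subseteq> \<phi> ` space P \<and> \<phi> -` A \<inter> space P \<in> sets P} \<subseteq> Pow (\<phi> ` space P)" by blast
  show "{} \<in> {A. A \<subseteq> \<phi> ` space P \<and> \<phi> -` A \<inter> space P \<in> sets P}" by simp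
next
  fix A assume A: "A \<in> {A. A \<subseteq> \<phi> ` space P \<and> \<phi> -` A \<inter> space P \<in> sets P}"
  have "\<phi> -` (\<phi> ` space P - A) \<inter> space P = space P - (\<phi> -` A \<inter> space P)" by auto
  then show "\<phi> ` space P - A \<in> {A. A \<subseteq> \<phi> ` space P \<and> \<phi> -` A \<inter> space P \<in> sets P}"
    using A sets.compl_sets[of "\<phi> -` A \<inter> space P" P] by auto
next
  fix A :: "nat \<Rightarrow> _ set"
  assume A: "range A \<subseteq> {A. A \<subseteq> \<phi> ` space P \<and> \<phi> -` A \<inter> space P \<in> sets P}"
  have "\<phi> -` (\<Union>i. A i) \<inter> space P = (\<Union>i. \<phi> -` A i \<inter> space P)" by auto
  moreover have "(\<Union>i. \<phi> -` A i \<inter> space P) \<in> sets P" using A by (intro sets.countable_UN) auto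
  ultimately show "(\<Union>i. A i) \<in> {A. A \<subseteq> \<phi> ` space P \<and> \<phi> -` A \<inter> space P \<in> sets P}"
    using A by auto
qed

lemma space_image_measure [simp]: "space (image_measure P \<phi>) = \<phi> ` space P"
  by (simp add: image_measure_def space_measure_of_conv)

lemma sets_image_measure:
  "sets (image_measure P \<phi>) = {A. A \<subseteq> \<phi> ` space P \<and> \<phi> -` A \<inter> space P \<in> sets P}"
  unfolding image_measure_def sets_distr
  by (rule sigma_algebra.sets_measure_of_eq[OF sigma_algebra_image])

lemma measurable_to_image_measure: "\<phi> \<in> measurable P (image_measure P \<phi>)"
  by (rule measurableI) (auto simp: sets_image_measure)

lemma image_measure_eq_distr: "image_measure P \<phi> = distr P (image_measure P \<phi>) \<phi>"
  by (subst (1) image_measure_def, rule distr_cong)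
     (simp_all add: sets_image_measure sigma_algebra.sets_measure_of_eq[OF sigma_algebra_image])

lemma measurable_from_image_measure:
  assumes "(\<lambda>\<omega>. f (\<phi> \<omega>)) \<in> measurable P N"
  shows "f \<in> measurable (image_measure P \<phi>) N"
proof (rule measurableI)
  show "f w \<in> space N" if "w \<in> space (image_measure P \<phi>)" for w
    using that measurable_space[OF assms] by auto
  fix A assume "A \<in> sets N"
  then have "(\<lambda>\<omega>. f (\<phi> \<omega>)) -` A \<inter> space P \<in> sets P" by (rule measurable_sets[OF assms])
  moreover have "\<phi> -` (f -` A \<inter> \<phi> ` space P) \<inter> space P = (\<lambda>\<omega>. f (\<phi> \<omega>)) -` A \<inter> space P" by auto
  ultimately show "f -` A \<inter> space (image_measure P \<phi>) \<in> sets (image_measure P \<phi>)"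
    by (simp add: sets_image_measure)
qed

lemma measure_image_measure:
  assumes "{\<omega>\<in>space P. Q (\<phi> \<omega>)} \<in> sets P"
  shows "measure (image_measure P \<phi>) {w\<in>space (image_measure P \<phi>). Q w} = measure P {\<omega>\<in>space P. Q (\<phi> \<omega>)}"
proof -
  have pre: "\<phi> -` {w\<in>space (image_measure P \<phi>). Q w} \<inter> space P = {\<omega>\<in>space P. Q (\<phi> \<omega>)}" by auto
  then have "{w\<in>space (image_measure P \<phi>). Q w} \<in> sets (image_measure P \<phi>)"
    using assms by (auto simp: sets_image_measure)
  then have "measure (distr P (image_measure P \<phi>) \<phi>) {w\<in>space (image_measure P \<phi>). Q w} =
      measure P {\<omega>\<in>space P. Q (\<phi> \<omega>)}"
    by (simp only: measure_distr[OF measurable_to_image_measure] pre)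
  then show ?thesis using image_measure_eq_distr[of P \<phi>] by simp
qed

section \<open>Phase-type laws of subordinated chains\<close>

lemma counting_path_left_limit:
  assumes x: "counting_path x" and t: "0 < t"
  shows "\<exists>v. \<forall>\<^sub>F s in at_left t. x s = v"
proof -
  have fin: "finite (x ` {0..<t})"
    by (rule finite_subset[of _ "{..x t}"]) (use counting_path_mono[OF x] in auto)
  have ne: "x ` {0..<t} \<noteq> {}" using t by auto
  obtain s where s: "0 \<le> s" "s < t" "x s = Max (x ` {0..<t})"
    using Max_in[OF fin ne] by auto
  have "x u = x s" if "s < u" "u < t" for u
  proof (rule antisym)
    show "x u \<le> x s" unfolding s(3) using s that by (intro Max_ge[OF fin]) auto
    show "x s \<le> x u" using s that by (intro counting_path_mono[OF x]) auto
  qed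
  then have "\<forall>\<^sub>F u in at_left t. x u = x s"
    unfolding eventually_at_left[OF s(2)] using s by (intro exI[of _ s]) auto
  then show ?thesis by blast
qed

text \<open>Only the two blocks \<open>l\<close> and \<open>Suc l\<close> contribute to row \<open>(l, i)\<close>, so the infinite sum is finite.\<close>

lemma sum_block_matrix:
  assumes n: "0 < n" and l: "l \<ge> 1" and i: "i \<in> {1..p}"
  shows "block_matrix S n c (l, i) summable_on block_states p"
    and "(\<Sum>\<^sub>\<infinity>y\<in>block_states p. block_matrix S n c (l, i) y) =
      real n * ((\<Sum>j\<in>{1..p}. Q_matrix S n c l i j) - 1)"
proof -
  let ?F = "{l, Suc l} \<times> {1..p}"
  have zero: "block_matrix S n c (l, i) y = 0" if "y \<in> block_states p - ?F" for y
    using that by (cases y) (auto simp: block_states_def)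
  have sub: "?F \<subseteq> block_states p" using l by (auto simp: block_states_def)
  have fin: "finite ?F" by simp
  show "block_matrix S n c (l, i) summable_on block_states p"
    using summable_on_finite[OF fin] zero sub
    by (subst summable_on_cong_neutral[of ?F "block_states p"]) auto
  have "(\<Sum>\<^sub>\<infinity>y\<in>block_states p. block_matrix S n c (l, i) y) = (\<Sum>\<^sub>\<infinity>y\<in>?F. block_matrix S n c (l, i) y)"
    by (rule infsum_cong_neutral) (use zero sub in auto)
  also have "\<dots> = (\<Sum>y\<in>?F. block_matrix S n c (l, i) y)" by simp
  also have "\<dots> = (\<Sum>m\<in>{l, Suc l}. \<Sum>j\<in>{1..p}. block_matrix S n c (l, i) (m, j))"
    by (simp only: sum.cartesian_product')
  also have "\<dots> = (\<Sum>j\<in>{1..p}. if i = j then - real n else 0) + (\<Sum>j\<in>{1..p}. real n * Q_matrix S n c l i j)"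
    by simp
  also have "(\<Sum>j\<in>{1..p}. if i = j then - real n else 0) = - real n"
    using i by (simp only: sum.delta' finite_atLeastAtMost if_True)
  also have "(\<Sum>j\<in>{1..p}. real n * Q_matrix S n c l i j) = real n * (\<Sum>j\<in>{1..p}. Q_matrix S n c l i j)"
    by (rule sum_distrib_left[symmetric])
  finally show "(\<Sum>\<^sub>\<infinity>y\<in>block_states p. block_matrix S n c (l, i) y) =
      real n * ((\<Sum>j\<in>{1..p}. Q_matrix S n c l i j) - 1)"
    by (simp add: algebra_simps)
qed

lemma block_subintensity_matrix:
  assumes n: "0 < n" and q: "substochastic p (Q_matrix S n c)"
  shows "subintensity_matrix (block_states p) (block_matrix S n c)"
  unfolding subintensity_matrix_def
proof (intro ballI conjI impI)
  fix x assume "x \<in> block_states p"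
  then obtain l i where x: "x = (l, i)" "l \<ge> 1" "i \<in> {1..p}" by (auto simp: block_states_def)
  then obtain l' where l': "l = Suc l'" by (cases l) auto
  show "block_matrix S n c x x \<le> 0" using x by simp
  show "block_matrix S n c x summable_on block_states p"
    using sum_block_matrix(1)[OF n x(2,3)] x by simp
  have "(\<Sum>j\<in>{1..p}. Q_matrix S n c l i j) \<le> 1" using substochasticD(2)[OF q x(3)] l' by simp
  then show "(\<Sum>\<^sub>\<infinity>y\<in>block_states p. block_matrix S n c x y) \<le> 0"
    unfolding x(1) sum_block_matrix(2)[OF n x(2,3)] by (simp add: mult_nonneg_nonpos)
  fix y assume y: "y \<in> block_states p" "x \<noteq> y"
  then obtain m j where y': "y = (m, j)" "j \<in> {1..p}" by (auto simp: block_states_def)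
  then have "0 \<le> Q_matrix S n c l i j" using substochasticD(1)[OF q x(3)] l' by simp
  then show "0 \<le> block_matrix S n c x y" using x y y' by auto
qed

context prob_space begin

lemma block_transition_0:
  "block_transition M U p q 0 x y = (if x = y then 1 else 0)"
proof (cases x)
  case (Some z)
  obtain l i where z: "z = (l, i)" by force
  have "{\<omega>\<in>space M. Some (l, i) = y} = (if Some (l, i) = y then space M else {})" by auto
  then show ?thesis using Some z by (simp add: prob_space)
qed auto

text \<open>The intensities are \<open>n\<close> times the difference between the one-step kernel and the identity.\<close>

lemma block_transition_generator:
  assumes U: "iid_uniform M U" and n: "0 < n" and q: "substochastic p (Q_matrix S n c)"
    and x: "x \<in> insert None (Some ` block_states p)" and y: "y \<in> insert None (Some ` block_states p)"
  shows "real n * (block_transition M U p (Q_matrix S n c) 1 x y - block_transition M U p (Q_matrix S n c) 0 x y) =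
    full_intensity (block_states p) (block_matrix S n c) x y"
proof (cases x)
  case None
  then show ?thesis by (cases y) simp_all
next
  case (Some z)
  then obtain l i where z: "z = (l, i)" "l \<ge> 1" "i \<in> {1..p}" using x by (auto simp: block_states_def)
  then obtain l' where l': "l = Suc l'" by (cases l) auto
  let ?q = "Q_matrix S n c"
  have q0: "0 \<le> ?q l i j" if "j \<in> {1..p}" for j using substochasticD(1)[OF q z(3) that] l' by simp
  have q1: "(\<Sum>j\<in>{1..p}. ?q l i j) \<le> 1" using substochasticD(2)[OF q z(3)] l' by simp
  have R1: "block_transition M U p ?q 1 (Some (l, i)) y =
      prob {\<omega>\<in>space M. map_option (Pair (Suc l)) (sample p (?q l i) (U l \<omega>)) = y}" by simp
  show ?thesis
  proof (cases y)
    case y: None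
    have "block_transition M U p ?q 1 (Some (l, i)) None = 1 - (\<Sum>j\<in>{1..p}. ?q l i j)"
      using prob_sample_None[OF U, where w = "?q l i" and l = l, OF q0 q1] R1 y by simp
    then show ?thesis
      unfolding block_transition_0 Some z(1) y full_intensity.simps sum_block_matrix(2)[OF n z(2,3)]
      by (simp only: option.distinct if_False) (simp add: algebra_simps)
  next
    case y': (Some w)
    then obtain m j where w: "w = (m, j)" "j \<in> {1..p}" using y by (auto simp: block_states_def)
    have "block_transition M U p ?q 1 x y = (if m = Suc l then ?q l i j else 0)"
    proof (cases "m = Suc l")
      case True
      have *: "map_option (Pair (Suc l)) s = Some (Suc l, j) \<longleftrightarrow> s = Some j" for s by auto
      have "prob {\<omega>\<in>space M. sample p (?q l i) (U l \<omega>) = Some j} = ?q l i j"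
        using prob_sample[OF U, where w = "?q l i" and l = l and k = j, OF q0 q1] w(2)
        by (simp only: if_True)
      then show ?thesis unfolding Some z(1) R1 y' w(1) True * by simp
    next
      case False
      have "map_option (Pair (Suc l)) s \<noteq> Some (m, j)" for s using False by auto
      then show ?thesis using False by (simp only: Some z(1) R1 y' w if_False) simp
    qed
    then show ?thesis
      unfolding block_transition_0 Some z(1) y' w(1) full_intensity.simps block_matrix.simps by auto
  qed
qed

lemma sampled_chain_start:
  assumes U: "iid_uniform M U" and \<alpha>: "probability_vector p \<alpha>" and x: "x \<in> block_states p"
  shows "prob {\<omega>\<in>space M. block_chain p \<alpha> q (\<lambda>k. U k \<omega>) 0 = Some x} = block_initial \<alpha> x"
proof -
  obtain l i where li: "x = (l, i)" "i \<in> {1..p}" using x by (auto simp: block_states_def)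
  show ?thesis
  proof (cases "l = 1")
    case True
    have "map_option (Pair (Suc 0)) s = Some (Suc 0, i) \<longleftrightarrow> s = Some i" for s by auto
    then show ?thesis
      using prob_sample[OF U, where w = \<alpha> and l = 0 and k = i and p = p] \<alpha> li True
      by (simp add: block_chain_def probability_vector_def)
  next
    case False
    then have "map_option (Pair (Suc 0)) s \<noteq> Some (l, i)" for s by auto
    then show ?thesis using False li by (simp add: block_chain_def)
  qed
qed

text \<open>Run at the arrivals of an independent Poisson process of intensity \<open>n\<close>, the chain with one-step
  kernels \<open>Q\<^sub>1, Q\<^sub>2, \<dots>\<close> is, once its position is paired with the number of steps made, a
  time-homogeneous Markov jump process with the block bidiagonal intensity matrix.\<close>

lemma subordinated_chain_phase_type:
  assumes U: "iid_uniform M U" and HU: "indep_algebras M H (variable_algebra M U UNIV)"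
    and Z: "counting_process H Z" "poisson_increments M (real n) Z" and n: "0 < n"
    and \<alpha>: "probability_vector p \<alpha>" and q: "substochastic p (Q_matrix S n c)"
    and absorbed: "AE \<omega> in M. \<exists>t\<ge>0. subordinated_chain p \<alpha> (Q_matrix S n c) Z U t \<omega> = None"
    and meas: "(\<lambda>\<omega>. Inf {t. 0 \<le> t \<and> subordinated_chain p \<alpha> (Q_matrix S n c) Z U t \<omega> = None}) \<in> borel_measurable M"
  shows "phase_type (block_states p) (block_initial \<alpha>) (block_matrix S n c)
    (distr M borel (\<lambda>\<omega>. Inf {t. 0 \<le> t \<and> subordinated_chain p \<alpha> (Q_matrix S n c) Z U t \<omega> = None}))"
proof -
  let ?q = "Q_matrix S n c"
  define \<phi> where "\<phi> \<omega> t = subordinated_chain p \<alpha> ?q Z U t \<omega>" for \<omega> t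
  define W where "W = image_measure M \<phi>"
  define X where "X t w = w t" for t :: real and w :: "real \<Rightarrow> (nat \<times> nat) option"
  note ZM = counting_process_subalgebra[OF Z(1) indep_algebrasD(1)[OF HU]]
  have Wd: "distr M W \<phi> = W" unfolding W_def by (rule image_measure_eq_distr[symmetric])
  have spaceW: "space W = \<phi> ` space M" by (simp add: W_def)
  have \<phi>m: "(\<lambda>\<omega>. \<phi> \<omega> t) \<in> measurable M (count_space UNIV)" if "0 \<le> t" for t
    using subordinated_chain_measurable[OF U ZM that, of p \<alpha> ?q] by (simp add: \<phi>_def)
  have range: "\<phi> \<omega> t \<in> insert None (Some ` block_states p)" for \<omega> t
  proof -
    have "sampled_chain p \<alpha> ?q (\<lambda>k. U k \<omega>) (Z t \<omega>) \<in> insert None (Some ` {1..p})"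
      by (rule sampled_chain_range[OF \<alpha> q])
    then show ?thesis by (auto simp: \<phi>_def subordinated_chain_def block_chain_def block_states_def)
  qed
  have Wmeas: "measure W {w\<in>space W. Q w} = prob {\<omega>\<in>space M. Q (\<phi> \<omega>)}"
    if "{\<omega>\<in>space M. Q (\<phi> \<omega>)} \<in> events" for Q
    unfolding W_def by (rule measure_image_measure[where Q = Q and \<phi> = \<phi>, OF that])
  have fin: "{\<omega>\<in>space M. \<forall>i\<le>k. \<phi> \<omega> (t i) = x i} \<in> events" if "\<And>i. i \<le> k \<Longrightarrow> 0 \<le> t i" for k :: nat and t x
  proof -
    have "{\<omega>\<in>space M. \<forall>i\<in>{..k}. \<phi> \<omega> (t i) = x i} \<in> events"
      by (rule sets.sets_Collect_finite_All) (use that in \<open>auto intro!: event_of_measurable \<phi>m\<close>)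
    then show ?thesis by (simp only: Ball_def atMost_iff)
  qed
  define T where "T h x y = poisson_mixture (real n * h) (\<lambda>d. block_transition M U p ?q d x y)" for h x y
  have "markov_jump_process W X (block_states p) (block_initial \<alpha>) (block_matrix S n c)"
    unfolding markov_jump_process_def
  proof (intro conjI)
    show "prob_space W"
      using prob_space_distr[OF measurable_to_image_measure[of \<phi> M]] Wd unfolding W_def by (simp only:)
    show "countable (block_states p)" by simp
    show "subintensity_matrix (block_states p) (block_matrix S n c)"
      by (rule block_subintensity_matrix[OF n q])
    show "\<forall>t\<ge>0. X t \<in> measurable W (count_space UNIV)"
      unfolding W_def X_def using \<phi>m by (auto intro!: measurable_from_image_measure)
    show "\<forall>w\<in>space W. (\<forall>t\<ge>0. X t w \<in> insert None (Some ` block_states p)) \<and>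
        (\<forall>t\<ge>0. \<forall>\<^sub>F s in at_right t. X s w = X t w) \<and> (\<forall>t>0. \<exists>x. \<forall>\<^sub>F s in at_left t. X s w = x)"
      unfolding spaceW
    proof (rule ballI)
      fix w assume "w \<in> \<phi> ` space M"
      then obtain \<omega> where \<omega>: "\<omega> \<in> space M" "w = \<phi> \<omega>" by blast
      have x: "counting_path (\<lambda>t. Z t \<omega>)" by (rule counting_process_path[OF ZM \<omega>(1)])
      have Xeq: "X t w = block_chain p \<alpha> ?q (\<lambda>k. U k \<omega>) (Z t \<omega>)" for t
        by (simp add: X_def \<omega> \<phi>_def subordinated_chain_def)
      show "(\<forall>t\<ge>0. X t w \<in> insert None (Some ` block_states p)) \<and>
        (\<forall>t\<ge>0. \<forall>\<^sub>F s in at_right t. X s w = X t w) \<and> (\<forall>t>0. \<exists>x. \<forall>\<^sub>F s in at_left t. X s w = x)"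
      proof (intro conjI allI impI)
        show "X t w \<in> insert None (Some ` block_states p)" for t
          using range[of \<omega> t] by (simp add: X_def \<omega>)
        fix t :: real
        {
          assume "0 \<le> t"
          then have "\<forall>\<^sub>F s in at_right t. Z s \<omega> = Z t \<omega>"
            using x by (auto simp: counting_path_def continuous_nat_iff_eventually_const)
          then show "\<forall>\<^sub>F s in at_right t. X s w = X t w" by eventually_elim (simp add: Xeq)
        next
          assume "0 < t"
          from counting_path_left_limit[OF x this] obtain v where "\<forall>\<^sub>F s in at_left t. Z s \<omega> = v" by blast
          then have "\<forall>\<^sub>F s in at_left t. X s w = block_chain p \<alpha> ?q (\<lambda>k. U k \<omega>) v"
            by eventually_elim (simp add: Xeq)
          then show "\<exists>x. \<forall>\<^sub>F s in at_left t. X s w = x" by blast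
        }
      qed
    qed
    show "\<forall>i\<in>block_states p. measure W {w\<in>space W. X 0 w = Some i} = block_initial \<alpha> i"
    proof (rule ballI)
      fix i assume i: "i \<in> block_states p"
      have "measure W {w\<in>space W. X 0 w = Some i} = prob {\<omega>\<in>space M. \<phi> \<omega> 0 = Some i}"
        unfolding X_def by (rule Wmeas[OF event_of_measurable[OF \<phi>m]]) simp
      also have "{\<omega>\<in>space M. \<phi> \<omega> 0 = Some i} =
          {\<omega>\<in>space M. block_chain p \<alpha> ?q (\<lambda>k. U k \<omega>) 0 = Some i}"
        using counting_process_path[OF ZM]
        by (auto simp: \<phi>_def subordinated_chain_def counting_path_def)
      finally show "measure W {w\<in>space W. X 0 w = Some i} = block_initial \<alpha> i"
        using sampled_chain_start[OF U \<alpha> i, of ?q] by simp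
    qed
    show "\<exists>T. (\<forall>k (t :: nat \<Rightarrow> real) x. 0 \<le> t 0 \<and> (\<forall>i\<le>k. t i < t (Suc i)) \<longrightarrow>
           measure W {w\<in>space W. \<forall>i\<le>Suc k. X (t i) w = x i} =
           measure W {w\<in>space W. \<forall>i\<le>k. X (t i) w = x i} * T (t (Suc k) - t k) (x k) (x (Suc k))) \<and>
        (\<forall>x\<in>insert None (Some ` block_states p). \<forall>y\<in>insert None (Some ` block_states p).
           ((\<lambda>h. (T h x y - (if x = y then 1 else 0)) / h) \<longlongrightarrow>
             full_intensity (block_states p) (block_matrix S n c) x y) (at_right 0))"
    proof (intro exI[of _ T] conjI allI impI ballI; (elim conjE)?)
      fix k :: nat and t :: "nat \<Rightarrow> real" and x
      assume t: "0 \<le> t 0" "\<forall>i\<le>k. t i < t (Suc i)"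
      then have t': "\<And>i. i \<le> k \<Longrightarrow> t i \<le> t (Suc i)" by (simp add: less_imp_le)
      have t0: "0 \<le> t i" if "i \<le> Suc k" for i
        using nondecreasing_times_nonneg[of t "Suc k" i] t(1) t' that by auto
      have "measure W {w\<in>space W. \<forall>i\<le>Suc k. X (t i) w = x i} =
          prob {\<omega>\<in>space M. \<forall>i\<le>Suc k. \<phi> \<omega> (t i) = x i}"
        unfolding X_def by (rule Wmeas[OF fin[OF t0]])
      moreover have "measure W {w\<in>space W. \<forall>i\<le>k. X (t i) w = x i} =
          prob {\<omega>\<in>space M. \<forall>i\<le>k. \<phi> \<omega> (t i) = x i}"
        unfolding X_def by (rule Wmeas[OF fin[OF t0]]) simp
      ultimately show "measure W {w\<in>space W. \<forall>i\<le>Suc k. X (t i) w = x i} =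
           measure W {w\<in>space W. \<forall>i\<le>k. X (t i) w = x i} * T (t (Suc k) - t k) (x k) (x (Suc k))"
        using subordinated_chain_markov[OF U HU Z _ t(1) t', where x = x and \<alpha> = \<alpha> and p = p and q = ?q]
        by (simp only: \<phi>_def T_def of_nat_0_le_iff)
    next
      fix x y assume xy: "x \<in> insert None (Some ` block_states p)" "y \<in> insert None (Some ` block_states p)"
      have "((\<lambda>h. (T h x y - block_transition M U p ?q 0 x y) / h) \<longlongrightarrow>
          real n * (block_transition M U p ?q 1 x y - block_transition M U p ?q 0 x y)) (at_right 0)"
        unfolding T_def by (rule poisson_mixture_derivative[OF block_transition_bounds])
      then show "((\<lambda>h. (T h x y - (if x = y then 1 else 0)) / h) \<longlongrightarrow>
             full_intensity (block_states p) (block_matrix S n c) x y) (at_right 0)"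
        by (simp only: block_transition_generator[OF U n q xy]) (simp only: block_transition_0)
    qed
  qed
  moreover have "AE w in W. \<exists>t\<ge>0. X t w = None"
  proof -
    obtain N where N: "{\<omega>\<in>space M. \<not> (\<exists>t\<ge>0. \<phi> \<omega> t = None)} \<subseteq> N" "N \<in> null_sets M"
      using absorbed unfolding eventually_ae_filter \<phi>_def by auto
    \<comment> \<open>Absorption is permanent, so it can be tested at integer times, which makes the event measurable.\<close>
    define N' where "N' = {\<omega>\<in>space M. \<forall>k::nat. \<phi> \<omega> (real k) \<noteq> None}"
    have N'ev: "N' \<in> events"
    proof -
      have "{\<omega>\<in>space M. \<phi> \<omega> (real k) \<noteq> None} \<in> events" for k
      proof -
        have "{\<omega>\<in>space M. \<phi> \<omega> (real k) \<noteq> None} = space M - {\<omega>\<in>space M. \<phi> \<omega> (real k) = None}" by auto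
        then show ?thesis using event_of_measurable[OF \<phi>m[of "real k"], of None] by auto
      qed
      then show ?thesis unfolding N'_def by (rule sets.sets_Collect_countable_All)
    qed
    have "N' \<subseteq> N"
    proof
      fix \<omega> assume \<omega>: "\<omega> \<in> N'"
      have "\<phi> \<omega> t \<noteq> None" if t: "0 \<le> t" for t
      proof
        assume *: "\<phi> \<omega> t = None"
        have "Z t \<omega> \<le> Z (real (nat \<lceil>t\<rceil>)) \<omega>"
          using \<omega> t by (intro counting_path_mono[OF counting_process_path[OF ZM]]) (auto simp: N'_def)
        then have "\<phi> \<omega> (real (nat \<lceil>t\<rceil>)) = None"
          using * sampled_chain_None_mono[of "Z t \<omega>" "Z (real (nat \<lceil>t\<rceil>)) \<omega>" p \<alpha> ?q "\<lambda>k. U k \<omega>"]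
          by (simp add: \<phi>_def subordinated_chain_def block_chain_def)
        then show False using \<omega> unfolding N'_def by blast
      qed
      then show "\<omega> \<in> N" using N \<omega> by (auto simp: N'_def)
    qed
    then have "emeasure M N' = 0"
      using null_sets_subset[OF N(2) N'ev] by (simp add: null_setsD1)
    then have "AE \<omega> in M. \<exists>k::nat. \<phi> \<omega> (real k) = None"
      by (intro AE_I[OF _ _ N'ev]) (auto simp: N'_def)
    moreover have "{w\<in>space W. \<exists>k::nat. w (real k) = None} \<in> sets W"
    proof (intro sets.sets_Collect_countable_Ex)
      fix k :: nat
      show "{w\<in>space W. w (real k) = None} \<in> sets W"
        unfolding W_def
        by (rule event_of_measurable[OF measurable_from_image_measure[where f = "\<lambda>w. w (real k)", OF \<phi>m]]) simp
    qed
    ultimately have "AE w in distr M W \<phi>. \<exists>k::nat. w (real k) = None"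
      by (subst AE_distr_iff) (auto simp: W_def measurable_to_image_measure)
    then have "AE w in W. \<exists>k::nat. w (real k) = None" by (simp only: Wd)
    then show ?thesis unfolding X_def by eventually_elim (use of_nat_0_le_iff in blast)
  qed
  moreover have "distr M borel (\<lambda>\<omega>. Inf {t. 0 \<le> t \<and> subordinated_chain p \<alpha> ?q Z U t \<omega> = None}) =
      distr W borel (\<lambda>w. Inf {t. 0 \<le> t \<and> X t w = None})"
  proof -
    have "(\<lambda>w. Inf {t. 0 \<le> t \<and> X t w = None}) \<in> borel_measurable W"
      unfolding W_def X_def by (rule measurable_from_image_measure) (use meas in \<open>simp add: \<phi>_def\<close>)
    then have "distr (distr M W \<phi>) borel (\<lambda>w. Inf {t. 0 \<le> t \<and> X t w = None}) =
        distr M borel ((\<lambda>w. Inf {t. 0 \<le> t \<and> X t w = None}) \<circ> \<phi>)"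
      by (rule distr_distr) (simp add: W_def measurable_to_image_measure)
    then show ?thesis by (simp only: Wd comp_def X_def \<phi>_def)
  qed
  ultimately show ?thesis unfolding phase_type_def by blast
qed

end

section \<open>Uniformization kernels\<close>

lemma diagonal_le_lambda0:
  assumes S: "uniformly_bounded p S" and t: "0 \<le> t" and i: "i \<in> {1..p}"
  shows "\<bar>S t i i\<bar> \<le> real (lambda0 p S)"
proof -
  let ?f = "\<lambda>(i, t). \<bar>S t i i\<bar>"
  obtain C where C: "\<And>t i j. 0 \<le> t \<Longrightarrow> i \<in> {1..p} \<Longrightarrow> j \<in> {1..p} \<Longrightarrow> \<bar>S t i j\<bar> \<le> C"
    using S unfolding uniformly_bounded_def by blast
  have bdd: "bdd_above (?f ` ({1..p} \<times> {0..}))"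
    by (rule bdd_aboveI2[of _ _ C]) (use C in auto)
  have "\<bar>S t i i\<bar> \<le> (SUP (i, t)\<in>{1..p} \<times> {0..}. \<bar>S t i i\<bar>)"
    using cSUP_upper[OF _ bdd, of "(i, t)"] t i by simp
  also have "\<dots> \<le> real (lambda0 p S)"
    unfolding lambda0_def by (rule real_nat_ceiling_ge)
  finally show ?thesis .
qed

text \<open>The kernels \<open>I + S / n\<close> of the uniformized chain with jump times \<open>c\<close>.  Negative times, which arise only
  on null sets, and rows outside the state space are replaced so as to make the kernels
  substochastic and measurable without exception.\<close>

definition clock_kernel ::
  "nat \<Rightarrow> (real \<Rightarrow> nat \<Rightarrow> nat \<Rightarrow> real) \<Rightarrow> nat \<Rightarrow> (nat \<Rightarrow> real) \<Rightarrow> nat \<Rightarrow> nat \<Rightarrow> nat \<Rightarrow> real"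
where
  "clock_kernel p S n c l i j = (if i \<in> {1..p} then Q_matrix S n (\<lambda>l. max 0 (c l)) l i j else 0)"

lemma substochastic_Q_matrix:
  assumes S: "subintensity_function p S" and n: "0 < n"
    and bound: "\<And>t i. 0 \<le> t \<Longrightarrow> i \<in> {1..p} \<Longrightarrow> \<bar>S t i i\<bar> \<le> real n"
    and c: "\<And>l. 0 \<le> c l"
  shows "substochastic p (Q_matrix S n c)"
  unfolding substochastic_def
proof (intro allI impI ballI conjI)
  fix l i assume i: "i \<in> {1..p}"
  have off: "\<forall>j\<in>{1..p}. i \<noteq> j \<longrightarrow> 0 \<le> S (c l) i j" and row: "(\<Sum>j\<in>{1..p}. S (c l) i j) \<le> 0"
    using S c[of l] i unfolding subintensity_function_def by blast+
  show "0 \<le> Q_matrix S n c l i j" if j: "j \<in> {1..p}" for j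
  proof (cases "i = j")
    case True
    have "- real n \<le> S (c l) i i" using bound[OF c[of l] i] by linarith
    then show ?thesis using True n by (simp add: Q_matrix_def field_simps)
  next
    case False
    then show ?thesis using off j by (simp add: Q_matrix_def)
  qed
  have "(\<Sum>j\<in>{1..p}. Q_matrix S n c l i j) = (\<Sum>j\<in>{1..p}. if i = j then 1 else 0) + 1 / real n * (\<Sum>j\<in>{1..p}. S (c l) i j)"
    unfolding Q_matrix_def sum.distrib sum_distrib_left ..
  also have "(\<Sum>j\<in>{1..p}. if i = j then 1 else 0 :: real) = 1"
    using i by (simp only: sum.delta' finite_atLeastAtMost if_True)
  also have "1 + 1 / real n * (\<Sum>j\<in>{1..p}. S (c l) i j) \<le> 1"
    using row n by (simp add: divide_nonpos_pos)
  finally show "(\<Sum>j\<in>{1..p}. Q_matrix S n c l i j) \<le> 1" .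
qed

lemma substochastic_clock_kernel:
  assumes S: "subintensity_function p S" and n: "0 < n"
    and bound: "\<And>t i. 0 \<le> t \<Longrightarrow> i \<in> {1..p} \<Longrightarrow> \<bar>S t i i\<bar> \<le> real n"
  shows "substochastic p (clock_kernel p S n c)"
  using substochastic_Q_matrix[OF S n bound, of "\<lambda>l. max 0 (c l)"]
  by (auto simp: substochastic_def clock_kernel_def)

lemma subintensity_measurable:
  assumes S: "subintensity_function p S" and ij: "i \<in> {1..p}" "j \<in> {1..p}"
  shows "(\<lambda>t. S (max 0 t) i j) \<in> borel_measurable borel"
proof -
  have S': "(\<lambda>t. S t i j) \<in> borel_measurable (restrict_space borel {0..})"
    using S ij unfolding subintensity_function_def by blast
  have "(\<lambda>t::real. max 0 t) \<in> measurable borel (restrict_space borel {0..})"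
    by (intro measurable_restrict_space2) auto
  from measurable_compose[OF this S'] show ?thesis .
qed

lemma clock_kernel_measurable:
  assumes S: "subintensity_function p S" and c: "\<And>l. (\<lambda>\<omega>. c \<omega> l) \<in> borel_measurable G" and j: "j \<in> {1..p}"
  shows "(\<lambda>\<omega>. clock_kernel p S n (c \<omega>) l i j) \<in> borel_measurable G"
proof (cases "i \<in> {1..p}")
  case True
  have "(\<lambda>\<omega>. S (max 0 (c \<omega> l)) i j) \<in> borel_measurable G"
    by (rule measurable_compose[OF c subintensity_measurable[OF S True j]])
  then show ?thesis using True by (simp add: clock_kernel_def Q_matrix_def)
next
  case False
  then show ?thesis by (simp add: clock_kernel_def del: atLeastAtMost_iff)
qed

text \<open>The identity \<open>I + S / n = (l0 / n) (I + S / l0) + (1 - l0 / n) I\<close>: a step of the fast chain is a step of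
  the slow chain made with probability \<open>l0 / n\<close>.\<close>

lemma clock_kernel_rates:
  assumes "i \<in> {1..p}" "0 < l0" "0 < n"
  shows "clock_kernel p S n c l i j =
    real l0 / real n * clock_kernel p S l0 c l i j + (1 - real l0 / real n) * (if i = j then 1 else 0)"
  using assms by (simp add: clock_kernel_def Q_matrix_def field_simps)

lemma sampled_chain_cong:
  assumes \<alpha>: "probability_vector p \<alpha>" and q: "substochastic p q"
    and eq: "\<And>l i. 1 \<le> l \<Longrightarrow> i \<in> {1..p} \<Longrightarrow> q' l i = q l i"
  shows "sampled_chain p \<alpha> q' u l = sampled_chain p \<alpha> q u l"
proof (induction l)
  case (Suc l)
  show ?case
  proof (cases "sampled_chain p \<alpha> q u l")
    case (Some i)
    then have "i \<in> {1..p}" using sampled_chain_range[OF \<alpha> q, of u l] by auto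
    then show ?thesis using eq[of "Suc l" i] Suc Some by simp
  qed (use Suc in simp)
qed simp

text \<open>The kernels are functions \<open>g\<close> of the jump times.  A chain that jumps at the arrivals of \<open>x\<close>, observed at
  the arrivals of \<open>z = x + y\<close>, is a chain on the arrivals of \<open>z\<close> that moves only where \<open>x\<close> jumps, and
  there \<open>component_step\<close> identifies the two jump times.\<close>

lemma occupation_subordinate_path:
  assumes x: "counting_path x" and y: "counting_path y"
    and z: "simple_path z" and sum: "\<And>t. 0 \<le> t \<Longrightarrow> z t = x t + y t"
  shows "occupation p \<alpha> (\<lambda>l. g (arrival_time x l)) (x (arrival_time z l)) j =
    marked_occupation p \<alpha> (\<lambda>l. g (arrival_time z l))
      (\<lambda>k. x (arrival_time z (Suc k)) \<noteq> x (arrival_time z k)) l j"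
proof (induction l arbitrary: j)
  case 0
  have "x 0 = 0" using x by (simp add: counting_path_def)
  then show ?case by simp
next
  case (Suc l)
  show ?case using component_step[OF x y z sum, of l] Suc by auto
qed

section \<open>Natural filtrations\<close>

lemma natural_sigma_generator: "{X t -` A \<inter> space M |t A. 0 \<le> t} \<subseteq> Pow (space M)"
  by auto

lemma space_natural_sigma [simp]: "space (natural_sigma M X) = space M"
  by (simp add: natural_sigma_def space_measure_of_conv)

lemma sets_natural_sigma:
  "sets (natural_sigma M X) = sigma_sets (space M) {X t -` A \<inter> space M |t A. 0 \<le> t}"
  unfolding natural_sigma_def by (rule sets_measure_of[OF natural_sigma_generator])

lemma counting_process_natural_sigma:
  assumes "counting_process M X" shows "counting_process (natural_sigma M X) X"
  unfolding counting_process_def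
proof (intro conjI allI impI ballI)
  fix t :: real assume t: "0 \<le> t"
  show "X t \<in> measurable (natural_sigma M X) (count_space UNIV)"
  proof (rule measurableI)
    fix A
    have "X t -` A \<inter> space M \<in> {X t -` A \<inter> space M |t A. 0 \<le> t}" using t by blast
    then show "X t -` A \<inter> space (natural_sigma M X) \<in> sets (natural_sigma M X)"
      by (simp add: sets_natural_sigma sigma_sets.Basic)
  qed simp
qed (use counting_process_path[OF assms] in simp)

lemma natural_sigma_subset:
  assumes X: "counting_process F X" and space: "space F = space M"
  shows "sets (natural_sigma M X) \<subseteq> sets F"
  unfolding sets_natural_sigma space[symmetric]
proof (rule sets.sigma_sets_subset, rule subsetI)
  fix C assume "C \<in> {X t -` A \<inter> space F |t A. 0 \<le> t}"
  then obtain t A where "C = X t -` A \<inter> space F" "0 \<le> t" by blast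
  then show "C \<in> sets F" using measurable_sets[OF counting_process_measurable[OF X]] by simp
qed

text \<open>An event of the natural filtration is an event on the path.  The second component zero makes the
  path an element of the space of pairs of paths.\<close>

lemma natural_sigma_path_event:
  assumes X: "counting_process M X" and C: "C \<in> sets (natural_sigma M X)"
  obtains E where "E \<in> sets path_algebra" "C = {\<omega>\<in>space M. (\<lambda>t. (X t \<omega>, 0)) \<in> E}"
proof -
  define \<phi> where "\<phi> \<omega> = (\<lambda>t. (X t \<omega>, 0 :: nat))" for \<omega>
  have zero: "counting_process M (\<lambda>t \<omega>. 0)" by (simp add: counting_process_def counting_path_zero)
  have \<phi>: "\<phi> \<in> measurable M path_algebra"
    unfolding \<phi>_def by (rule path_map_measurable[OF X zero])
  have \<phi>s: "\<phi> \<in> space M \<rightarrow> space path_algebra" using measurable_space[OF \<phi>] by blast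
  have "sets (natural_sigma M X) \<subseteq> sets (vimage_algebra (space M) \<phi> path_algebra)"
    unfolding sets_natural_sigma
  proof (subst (1) space_vimage_algebra[of "space M" \<phi> path_algebra, symmetric],
      rule sets.sigma_sets_subset, rule subsetI)
    fix D assume "D \<in> {X t -` A \<inter> space M |t A. 0 \<le> t}"
    then obtain t A where D: "D = X t -` A \<inter> space M" "0 \<le> t" by blast
    have "(\<lambda>x. x t) -` (A \<times> UNIV) \<inter> space path_algebra \<in> sets path_algebra"
      by (rule measurable_sets[OF path_coordinate_measurable[OF D(2)]]) simp
    then have "\<phi> -` ((\<lambda>x. x t) -` (A \<times> UNIV) \<inter> space path_algebra) \<inter> space M
        \<in> sets (vimage_algebra (space M) \<phi> path_algebra)" by (rule in_vimage_algebra)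
    moreover have "\<phi> -` ((\<lambda>x. x t) -` (A \<times> UNIV) \<inter> space path_algebra) \<inter> space M = D"
      using \<phi>s by (auto simp: D \<phi>_def)
    ultimately show "D \<in> sets (vimage_algebra (space M) \<phi> path_algebra)" by simp
  qed
  then obtain E where "E \<in> sets path_algebra" "C = \<phi> -` E \<inter> space M"
    using C \<phi>s by (auto simp: sets_vimage_algebra2)
  then show thesis by (intro that[of E]) (auto simp: \<phi>_def)
qed

section \<open>The coupled chains\<close>

text \<open>\<open>X\<close> is the slow clock, \<open>B\<close> the superposition of the clocks added to it, \<open>X + B\<close> the fast clock and \<open>Z\<close>
  the other fast clock.  The \<open>\<sigma>\<close>-algebras \<open>FX\<close>, \<open>FB\<close>, \<open>FZ\<close> contain the information in \<open>X\<close>, \<open>B\<close>, \<open>Z\<close>,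
  while \<open>FY\<close> contains that in \<open>X\<close> and \<open>B\<close>, and \<open>FYU\<close> that in \<open>X\<close>, \<open>B\<close> and \<open>U\<close>.\<close>

locale coupled_clocks = prob_space M
  for M :: "'a measure" +
  fixes p :: nat and \<alpha> :: "nat \<Rightarrow> real" and S :: "real \<Rightarrow> nat \<Rightarrow> nat \<Rightarrow> real" and l0 n :: nat
    and X B Z :: "real \<Rightarrow> 'a \<Rightarrow> nat" and U :: "nat \<Rightarrow> 'a \<Rightarrow> real"
    and FX FB FY FYU FZ :: "'a measure"
  assumes \<alpha>: "probability_vector p \<alpha>" and S: "subintensity_function p S"
    and bound: "\<And>t i. 0 \<le> t \<Longrightarrow> i \<in> {1..p} \<Longrightarrow> \<bar>S t i i\<bar> \<le> real l0"
    and rates: "0 < l0" "l0 \<le> n"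
    and U: "iid_uniform M U"
    and X: "counting_process FX X" "poisson_increments M (real l0) X"
    and B: "counting_process FB B" "poisson_increments M (real n - real l0) B"
    and Z: "counting_process FZ Z" "poisson_increments M (real n) Z"
    and indep_XB: "indep_algebras M FX FB"
    and indep_YU: "indep_algebras M FY (variable_algebra M U UNIV)"
    and indep_ZU: "indep_algebras M FZ (variable_algebra M U UNIV)"
    and indep_YUZ: "indep_algebras M FYU FZ"
    and subalgebras: "subalgebra FY FX" "subalgebra FY FB" "subalgebra FYU FY"
      "subalgebra FYU (variable_algebra M U UNIV)"
begin

definition Y :: "real \<Rightarrow> 'a \<Rightarrow> nat" where "Y t \<omega> = X t \<omega> + B t \<omega>"

abbreviation kernel :: "nat \<Rightarrow> (nat \<Rightarrow> real) \<Rightarrow> nat \<Rightarrow> nat \<Rightarrow> nat \<Rightarrow> real" where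
  "kernel m c \<equiv> clock_kernel p S m c"

lemma n_pos: "0 < n" using rates by simp

lemma substochastic_kernel: "l0 \<le> m \<Longrightarrow> substochastic p (kernel m c)"
  using rates by (intro substochastic_clock_kernel[OF S]) (auto intro: order_trans[OF bound])

lemma counting_X: "counting_process M X" "counting_process FY X"
  using counting_process_subalgebra[OF X(1) indep_algebrasD(1)[OF indep_XB]]
    counting_process_subalgebra[OF X(1) subalgebras(1)] .

lemma counting_B: "counting_process M B" "counting_process FY B"
  using counting_process_subalgebra[OF B(1) indep_algebrasD(2)[OF indep_XB]]
    counting_process_subalgebra[OF B(1) subalgebras(2)] .

lemma counting_Y: "counting_process M Y" "counting_process FY Y"
  using counting_process_add[OF counting_X(1) counting_B(1)]
    counting_process_add[OF counting_X(2) counting_B(2)] by (simp_all add: Y_def[abs_def])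

lemma counting_Z: "counting_process M Z"
  by (rule counting_process_subalgebra[OF Z(1) indep_algebrasD(1)[OF indep_ZU]])

lemma space_FY: "space FY = space M"
  using indep_algebrasD(1)[OF indep_YU] by (simp add: subalgebra_def)

lemma poisson_Y: "poisson_increments M (real n) Y"
  using poisson_increments_add[OF indep_XB X B] by (simp add: Y_def[abs_def])

lemma simple_Y: "AE \<omega> in M. simple_path (\<lambda>t. Y t \<omega>)"
  using n_pos by (intro poisson_simple_path[OF _ poisson_Y counting_Y(1)]) simp

lemma simple_Z: "AE \<omega> in M. simple_path (\<lambda>t. Z t \<omega>)"
  using n_pos by (intro poisson_simple_path[OF _ Z(2) counting_Z]) simp

lemma simple_X: "AE \<omega> in M. simple_path (\<lambda>t. X t \<omega>)"
  using rates by (intro poisson_simple_path[OF _ X(2) counting_X(1)]) simp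

text \<open>The states of \<open>J\<close> after its successive jumps.\<close>

definition chain :: "'a \<Rightarrow> nat \<Rightarrow> nat option" where
  "chain \<omega> = sampled_chain p \<alpha> (kernel l0 (\<lambda>l. arrival X l \<omega>)) (\<lambda>k. U k \<omega>)"

text \<open>The number of slow arrivals up to the \<open>l\<close>-th fast one.  The maximum matters on a null set only.\<close>

definition X_count :: "nat \<Rightarrow> 'a \<Rightarrow> nat" where
  "X_count l \<omega> = X (max 0 (arrival Y l \<omega>)) \<omega>"

lemma X_count_measurable: "X_count l \<in> measurable FY (count_space UNIV)"
  unfolding X_count_def[abs_def]
  using measurable_arrival[OF counting_Y(2), of l]
  by (intro measurable_at_random_time[OF counting_X(2)]) auto

definition sum_path :: "(real \<Rightarrow> nat \<times> nat) \<Rightarrow> real \<Rightarrow> nat \<times> nat" where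
  "sum_path x = (\<lambda>t. (fst (x t) + snd (x t), 0))"

lemma sum_path_measurable: "sum_path \<in> measurable path_algebra path_algebra"
proof -
  have zero: "counting_process path_algebra (\<lambda>t \<omega>. 0)" by (simp add: counting_process_def counting_path_zero)
  show ?thesis
    unfolding sum_path_def[abs_def]
    by (rule path_map_measurable[OF counting_process_add[OF counting_process_fst counting_process_snd] zero])
qed

text \<open>Both integrands are functionals of the pair \<open>(X, B)\<close>, so this pair may be replaced by the marked and
  the unmarked arrivals of \<open>Z\<close>.  There \<open>U\<close> provides the marks, which are independent of \<open>Z\<close>, and
  averaging over them turns the slow kernels into the fast ones.  The event \<open>C\<close> concerns the sum
  only, which is not affected by the marks.\<close>

lemma occupation_transport:
  assumes C: "C \<in> sets (natural_sigma M Y)" and j: "j \<in> {1..p}"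
  shows "(\<integral>\<^sup>+\<omega>. indicator C \<omega> *
      ennreal (occupation p \<alpha> (kernel l0 (\<lambda>l. arrival X l \<omega>)) (X_count l \<omega>) j) \<partial>M) =
    (\<integral>\<^sup>+\<omega>. indicator C \<omega> * ennreal (occupation p \<alpha> (kernel n (\<lambda>l. arrival Y l \<omega>)) l j) \<partial>M)"
proof -
  obtain E where E: "E \<in> sets path_algebra" "C = {\<omega>\<in>space M. (\<lambda>t. (Y t \<omega>, 0)) \<in> E}"
    using natural_sigma_path_event[OF counting_Y(1) C] by blast
  \<comment> \<open>The probability that a fast arrival is a slow one.\<close>
  define r where "r = real l0 / real n"
  have r: "0 \<le> r" "r \<le> 1" "r = real l0 / (real l0 + (real n - real l0))"
    using rates by (auto simp: r_def)
  let ?X = "\<lambda>t x. fst (x t) :: nat" and ?Y = "\<lambda>t x. fst (x t) + snd (x t) :: nat"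
  let ?Z1 = "\<lambda>t \<omega>. hits r U {..<Z t \<omega>} \<omega>" and ?Z2 = "\<lambda>t \<omega>. Z t \<omega> - hits r U {..<Z t \<omega>} \<omega>"
  note cX = counting_process_fst
  note cY = counting_process_add[OF counting_process_fst counting_process_snd]
  define f where "f x = indicator E (sum_path x) * ennreal (occupation p \<alpha>
      (kernel l0 (\<lambda>l. arrival ?X l x)) (?X (max 0 (arrival ?Y l x)) x) j)" for x
  define f' where "f' x = indicator E (sum_path x) * ennreal (occupation p \<alpha>
      (kernel n (\<lambda>l. arrival ?Y l x)) l j)" for x
  have ind: "(\<lambda>x. indicator E (sum_path x) :: ennreal) \<in> borel_measurable path_algebra"
    by (rule measurable_compose[OF sum_path_measurable borel_measurable_indicator[OF E(1)]])
  have occ: "(\<lambda>x. occupation p \<alpha> (kernel m (\<lambda>l. arrival W l x)) k j) \<in> borel_measurable path_algebra"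
    if "counting_process path_algebra W" for W m k
    by (intro occupation_measurable clock_kernel_measurable[OF S] measurable_arrival[OF that] j)
  have idx: "(\<lambda>x. ?X (max 0 (arrival ?Y l x)) x) \<in> measurable path_algebra (count_space UNIV)"
    using measurable_arrival[OF cY, of l] by (intro measurable_at_random_time[OF cX]) auto
  have f: "f \<in> borel_measurable path_algebra"
    unfolding f_def[abs_def]
    by (intro borel_measurable_times_ennreal ind
        measurable_compose[OF measurable_compose_countable[OF occ[OF cX] idx]] measurable_ennreal)
  have f': "f' \<in> borel_measurable path_algebra"
    unfolding f'_def[abs_def]
    by (intro borel_measurable_times_ennreal ind measurable_compose[OF occ[OF cY]] measurable_ennreal)
  have mXB: "(\<lambda>\<omega> t. (X t \<omega>, B t \<omega>)) \<in> measurable M path_algebra"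
    by (rule path_map_measurable[OF counting_X(1) counting_B(1)])
  have mZ: "(\<lambda>\<omega> t. (?Z1 t \<omega>, ?Z2 t \<omega>)) \<in> measurable M path_algebra"
    by (rule path_map_measurable[OF counting_process_mark_counts[OF counting_Z U]])
  have law: "distr M path_algebra (\<lambda>\<omega> t. (X t \<omega>, B t \<omega>)) = distr M path_algebra (\<lambda>\<omega> t. (?Z1 t \<omega>, ?Z2 t \<omega>))"
    by (rule thinning_path_law[OF indep_XB X B indep_ZU U Z(1)])
       (use Z(2) r rates in \<open>simp_all\<close>)
  have transport: "(\<integral>\<^sup>+\<omega>. h (\<lambda>t. (X t \<omega>, B t \<omega>)) \<partial>M) = (\<integral>\<^sup>+\<omega>. h (\<lambda>t. (?Z1 t \<omega>, ?Z2 t \<omega>)) \<partial>M)"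
    if h: "h \<in> borel_measurable path_algebra" for h :: "(real \<Rightarrow> nat \<times> nat) \<Rightarrow> ennreal"
    using nn_integral_distr[OF mXB, of h] nn_integral_distr[OF mZ, of h] h law by simp
  have sumZ: "?Z1 t \<omega> + ?Z2 t \<omega> = Z t \<omega>" for t \<omega> using hits_le[of "{..<Z t \<omega>}" r U \<omega>] by simp
  have arrXB: "arrival ?X l (\<lambda>t. (X t \<omega>, B t \<omega>)) = arrival X l \<omega>"
    "arrival ?Y l (\<lambda>t. (X t \<omega>, B t \<omega>)) = arrival Y l \<omega>" for l \<omega>
    by (simp_all add: arrival_def Y_def)
  have arrZ: "arrival ?X l (\<lambda>t. (?Z1 t \<omega>, ?Z2 t \<omega>)) = arrival ?Z1 l \<omega>"
    "arrival ?Y l (\<lambda>t. (?Z1 t \<omega>, ?Z2 t \<omega>)) = arrival Z l \<omega>" for l \<omega>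
    unfolding arrival_def fst_conv snd_conv sumZ by (rule refl)+
  have "(\<integral>\<^sup>+\<omega>. indicator C \<omega> *
      ennreal (occupation p \<alpha> (kernel l0 (\<lambda>l. arrival X l \<omega>)) (X_count l \<omega>) j) \<partial>M) =
      (\<integral>\<^sup>+\<omega>. f (\<lambda>t. (X t \<omega>, B t \<omega>)) \<partial>M)"
    by (rule nn_integral_cong)
       (simp add: f_def arrXB sum_path_def E(2) X_count_def Y_def[abs_def] indicator_def)
  also have "\<dots> = (\<integral>\<^sup>+\<omega>. f (\<lambda>t. (?Z1 t \<omega>, ?Z2 t \<omega>)) \<partial>M)" by (rule transport[OF f])
  also have "\<dots> = (\<integral>\<^sup>+\<omega>. indicator E (\<lambda>t. (Z t \<omega>, 0)) * ennreal (marked_occupation p \<alpha>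
      (kernel l0 (\<lambda>l. arrival Z l \<omega>)) (\<lambda>k. U k \<omega> < r) l j) \<partial>M)"
  proof (rule nn_integral_cong_AE)
    show "AE \<omega> in M. f (\<lambda>t. (?Z1 t \<omega>, ?Z2 t \<omega>)) = indicator E (\<lambda>t. (Z t \<omega>, 0)) *
      ennreal (marked_occupation p \<alpha> (kernel l0 (\<lambda>l. arrival Z l \<omega>)) (\<lambda>k. U k \<omega> < r) l j)"
      using simple_Z AE_space
    proof eventually_elim
      case (elim \<omega>)
      let ?z = "\<lambda>t. Z t \<omega>" and ?x = "\<lambda>t. ?Z1 t \<omega>" and ?y = "\<lambda>t. ?Z2 t \<omega>"
      note xy = counting_process_path[OF counting_process_mark_counts(1)[OF counting_Z U, of r] elim(2)]
        counting_process_path[OF counting_process_mark_counts(2)[OF counting_Z U, of r] elim(2)]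
      have marks: "?x (arrival_time ?z k) = hits r U {..<k} \<omega>" for k
        using simple_pathD(3)[OF elim(1), of k] by simp
      \<comment> \<open>The kernel depends on the index only through the arrival time.\<close>
      have K: "kernel l0 (\<lambda>l. arrival V l \<omega>) =
          (\<lambda>l. (\<lambda>t i j. clock_kernel p S l0 (\<lambda>_. t) 0 i j) (arrival_time (\<lambda>t. V t \<omega>) l))"
        for V :: "real \<Rightarrow> 'a \<Rightarrow> nat"
        by (intro ext) (simp add: clock_kernel_def Q_matrix_def arrival_eq_arrival_time)
      have "occupation p \<alpha> (kernel l0 (\<lambda>l. arrival ?Z1 l \<omega>)) (?x (arrival_time ?z l)) j =
          marked_occupation p \<alpha> (kernel l0 (\<lambda>l. arrival Z l \<omega>))
            (\<lambda>k. ?x (arrival_time ?z (Suc k)) \<noteq> ?x (arrival_time ?z k)) l j"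
        unfolding K
        by (rule occupation_subordinate_path[OF xy(1) xy(2) elim(1),
              where g = "\<lambda>t i j. clock_kernel p S l0 (\<lambda>_. t) 0 i j"]) (simp only: sumZ)
      also have "\<dots> = marked_occupation p \<alpha> (kernel l0 (\<lambda>l. arrival Z l \<omega>)) (\<lambda>k. U k \<omega> < r) l j"
        unfolding marks hits_Suc by (rule marked_occupation_cong) simp
      finally have occ_eq: "occupation p \<alpha> (kernel l0 (\<lambda>l. arrival ?Z1 l \<omega>)) (?x (arrival_time ?z l)) j =
          marked_occupation p \<alpha> (kernel l0 (\<lambda>l. arrival Z l \<omega>)) (\<lambda>k. U k \<omega> < r) l j" .
      have time: "max 0 (arrival ?Y l (\<lambda>t. (?x t, ?y t))) = arrival_time ?z l"
        using simple_pathD(4)[OF elim(1), of l] unfolding arrZ(2)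
        by (simp add: arrival_eq_arrival_time)
      have sp: "sum_path (\<lambda>t. (?x t, ?y t)) = (\<lambda>t. (Z t \<omega>, 0))"
        unfolding sum_path_def fst_conv snd_conv sumZ ..
      show ?case
        unfolding f_def sp time arrZ(1) fst_conv occ_eq ..
    qed
  qed
  also have "\<dots> = (\<integral>\<^sup>+\<omega>. \<integral>\<^sup>+\<omega>'. indicator E (\<lambda>t. (Z t \<omega>, 0)) * ennreal (marked_occupation p \<alpha>
      (kernel l0 (\<lambda>l. arrival Z l \<omega>)) (\<lambda>k. U k \<omega>' < r) l j) \<partial>M \<partial>M)"
  proof (rule decoupling[OF indep_ZU])
    let ?G = "FZ \<Otimes>\<^sub>M variable_algebra M U UNIV"
    have zero: "counting_process FZ (\<lambda>t \<omega>. 0)" by (simp add: counting_process_def counting_path_zero)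
    have 1: "(\<lambda>z. indicator E (\<lambda>t. (Z t (fst z), 0)) :: ennreal) \<in> borel_measurable ?G"
      by (rule measurable_compose[OF measurable_compose[OF measurable_fst path_map_measurable[OF Z(1) zero]]
            borel_measurable_indicator[OF E(1)]])
    have [measurable]: "(\<lambda>z. U k (snd z)) \<in> borel_measurable ?G" for k
      by (rule measurable_compose[OF measurable_snd measurable_variable_algebra]) simp
    have 2: "(\<lambda>z. marked_occupation p \<alpha> (kernel l0 (\<lambda>l. arrival Z l (fst z))) (\<lambda>k. U k (snd z) < r) l j)
        \<in> borel_measurable ?G"
    proof (rule marked_occupation_measurable[OF _ _ j])
      show "(\<lambda>z. kernel l0 (\<lambda>l. arrival Z l (fst z)) l i j) \<in> borel_measurable ?G" if "j \<in> {1..p}" for l i j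
        by (intro clock_kernel_measurable[OF S _ that] measurable_compose[OF measurable_fst measurable_arrival[OF Z(1)]])
      show "Measurable.pred ?G (\<lambda>z. U k (snd z) < r)" for k by measurable
    qed
    show "(\<lambda>(\<omega>, \<omega>'). indicator E (\<lambda>t. (Z t \<omega>, 0)) * ennreal (marked_occupation p \<alpha>
      (kernel l0 (\<lambda>l. arrival Z l \<omega>)) (\<lambda>k. U k \<omega>' < r) l j)) \<in> borel_measurable ?G"
      unfolding case_prod_beta'
      by (intro borel_measurable_times_ennreal 1 measurable_compose[OF 2] measurable_ennreal)
  qed
  also have "\<dots> = (\<integral>\<^sup>+\<omega>. f' (\<lambda>t. (?Z1 t \<omega>, ?Z2 t \<omega>)) \<partial>M)"
  proof (rule nn_integral_cong)
    fix \<omega>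
    have mm: "(\<lambda>\<omega>'. marked_occupation p \<alpha> (kernel l0 (\<lambda>l. arrival Z l \<omega>)) (\<lambda>k. U k \<omega>' < r) l j) \<in> borel_measurable M"
    proof (rule marked_occupation_measurable[OF _ _ j])
      fix k
      have [measurable]: "U k \<in> borel_measurable M" by (rule iid_uniformD(1)[OF U])
      show "Measurable.pred M (\<lambda>\<omega>. U k \<omega> < r)" by measurable
    qed simp
    have avg: "(\<integral>\<^sup>+\<omega>'. ennreal (marked_occupation p \<alpha> (kernel l0 (\<lambda>l. arrival Z l \<omega>)) (\<lambda>k. U k \<omega>' < r) l j) \<partial>M) =
        ennreal (occupation p \<alpha> (kernel n (\<lambda>l. arrival Z l \<omega>)) l j)"
      by (rule marked_occupation_average[OF U \<alpha> substochastic_kernel[OF order_refl] r(1,2) _ j])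
         (simp only: clock_kernel_rates[OF _ rates(1) n_pos] r_def)
    have "f' (\<lambda>t. (?Z1 t \<omega>, ?Z2 t \<omega>)) = indicator E (\<lambda>t. (Z t \<omega>, 0)) *
        ennreal (occupation p \<alpha> (kernel n (\<lambda>l. arrival Z l \<omega>)) l j)"
      unfolding f'_def arrZ sumZ sum_path_def fst_conv snd_conv ..
    moreover have "(\<integral>\<^sup>+\<omega>'. indicator E (\<lambda>t. (Z t \<omega>, 0)) * ennreal (marked_occupation p \<alpha>
      (kernel l0 (\<lambda>l. arrival Z l \<omega>)) (\<lambda>k. U k \<omega>' < r) l j) \<partial>M) = indicator E (\<lambda>t. (Z t \<omega>, 0)) *
        ennreal (occupation p \<alpha> (kernel n (\<lambda>l. arrival Z l \<omega>)) l j)"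
      unfolding avg[symmetric] by (rule nn_integral_cmult) (rule measurable_compose[OF mm measurable_ennreal])
    ultimately show "(\<integral>\<^sup>+\<omega>'. indicator E (\<lambda>t. (Z t \<omega>, 0)) * ennreal (marked_occupation p \<alpha>
      (kernel l0 (\<lambda>l. arrival Z l \<omega>)) (\<lambda>k. U k \<omega>' < r) l j) \<partial>M) = f' (\<lambda>t. (?Z1 t \<omega>, ?Z2 t \<omega>))"
      by (simp only:)
  qed
  also have "\<dots> = (\<integral>\<^sup>+\<omega>. f' (\<lambda>t. (X t \<omega>, B t \<omega>)) \<partial>M)" by (rule transport[OF f', symmetric])
  also have "\<dots> = (\<integral>\<^sup>+\<omega>. indicator C \<omega> * ennreal (occupation p \<alpha> (kernel n (\<lambda>l. arrival Y l \<omega>)) l j) \<partial>M)"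
    by (rule nn_integral_cong)
       (simp add: f'_def arrXB sum_path_def E(2) Y_def[abs_def] indicator_def)
  finally show ?thesis .
qed

text \<open>The number of slow arrivals and the slow kernels are functions of the clocks alone, so freezing yields a
  slow occupation vector, which \<open>occupation_transport\<close> turns into a fast one: given the fast clock, the
  observed chain makes each step with the kernel \<open>I + S / n\<close>.\<close>

lemma conditional_occupation:
  assumes C: "C \<in> sets (natural_sigma M Y)" and j: "j \<in> {1..p}"
  shows "emeasure M {\<omega>\<in>space M. \<omega> \<in> C \<and> chain \<omega> (X_count l \<omega>) = Some j} =
    (\<integral>\<^sup>+\<omega>. indicator C \<omega> * ennreal (occupation p \<alpha> (kernel n (\<lambda>l. arrival Y l \<omega>)) l j) \<partial>M)"
proof -
  have CF: "C \<in> sets FY" using natural_sigma_subset[OF counting_Y(2) space_FY] C by blast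
  have "emeasure M {\<omega>\<in>space M. \<omega> \<in> C \<and> chain \<omega> (X_count l \<omega>) = Some j} =
      (\<integral>\<^sup>+\<omega>. indicator C \<omega> *
      ennreal (occupation p \<alpha> (kernel l0 (\<lambda>l. arrival X l \<omega>)) (X_count l \<omega>) j) \<partial>M)"
    unfolding chain_def
    by (rule sampled_chain_freezing[OF U indep_YU \<alpha> substochastic_kernel[OF order_refl]
          clock_kernel_measurable[OF S measurable_arrival[OF counting_X(2)]] X_count_measurable CF j])
  then show ?thesis using occupation_transport[OF C j] by simp
qed

end

section \<open>The conditional law of the approximation\<close>

definition first_None :: "(nat \<Rightarrow> 'b option) \<Rightarrow> nat \<Rightarrow> bool" where
  "first_None f l \<longleftrightarrow> f l = None \<and> (\<forall>k<l. f k \<noteq> None)"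

text \<open>For a chain that stays at \<open>None\<close> this means that it has not been absorbed before index \<open>l\<close>.  Referring
  to the preceding index only, it has a probability given by the occupation vector of that index.\<close>

definition alive :: "(nat \<Rightarrow> 'b option) \<Rightarrow> nat \<Rightarrow> bool" where
  "alive f l \<longleftrightarrow> (case l of 0 \<Rightarrow> True | Suc k \<Rightarrow> f k \<noteq> None)"

definition persistent :: "(nat \<Rightarrow> 'b option) \<Rightarrow> bool" where
  "persistent f \<longleftrightarrow> (\<forall>k l. k \<le> l \<longrightarrow> f k = None \<longrightarrow> f l = None)"

lemma persistent_sampled_chain: "persistent (sampled_chain p \<alpha> q u)"
  using sampled_chain_None_mono unfolding persistent_def by blast

lemma alive_0: "alive f 0" and alive_Suc: "alive f (Suc k) \<longleftrightarrow> f k \<noteq> None"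
  by (simp_all add: alive_def)

lemma alive_step:
  assumes "persistent f" shows "alive f (Suc l) \<longleftrightarrow> alive f l \<and> f l \<noteq> None"
proof (cases l)
  case (Suc m)
  have "f m = None \<longrightarrow> f (Suc m) = None" using assms le_SucI[OF order_refl] unfolding persistent_def by blast
  then show ?thesis unfolding Suc alive_Suc by metis
qed (simp only: alive_0 alive_Suc simp_thms)

lemma alive_iff: "persistent f \<Longrightarrow> alive f l \<longleftrightarrow> (\<forall>k<l. f k \<noteq> None)"
  by (induction l) (simp_all only: alive_0 alive_step less_Suc_eq, blast+)

lemma first_None_persistent: "persistent f \<Longrightarrow> first_None f l \<longleftrightarrow> alive f l \<and> f l = None"
  unfolding first_None_def by (simp only: alive_iff) blast

lemma first_None_unique: "first_None f k \<Longrightarrow> first_None f l \<Longrightarrow> k = l"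
  unfolding first_None_def by (metis linorder_neqE_nat)

lemma first_None_Least:
  "first_None f l \<Longrightarrow> (LEAST k. f k = None) = l"
  unfolding first_None_def by (intro Least_equality) (auto simp: not_less[symmetric])

lemma first_None_exists: "\<exists>k. f k = None \<Longrightarrow> first_None f (LEAST k. f k = None)"
  unfolding first_None_def using LeastI_ex[of "\<lambda>k. f k = None"] not_less_Least by blast

text \<open>Run at the arrivals of a counting path \<open>z\<close>, a chain is absorbed at the arrival whose index is its
  absorption index.\<close>

lemma first_passage_time:
  assumes "persistent f"
  shows "Inf {t. 0 \<le> t \<and> f (z t) = None} =
    (if \<exists>l. f l = None then arrival_time z (LEAST l. f l = None) else Inf {})"
proof (cases "\<exists>l. f l = None")
  case True
  define k where "k = (LEAST l. f l = None)"
  have "f m = None \<longleftrightarrow> k \<le> m" for m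
    using first_None_exists[OF True] assms unfolding persistent_def first_None_def k_def
    by (metis not_le)
  then have "{t. 0 \<le> t \<and> f (z t) = None} = {t. 0 \<le> t \<and> k \<le> z t}" by (simp only:)
  then show ?thesis unfolding if_P[OF True] arrival_time_def k_def[symmetric] by (rule arg_cong)
next
  case False
  then have "{t. 0 \<le> t \<and> f (z t) = None} = {}" by auto
  then show ?thesis using False by (simp only: if_False)
qed

text \<open>The absorption index is determined by \<open>F\<close> and the times by \<open>G\<close>, so the law of the time at that
  random index is a mixture over the index.\<close>

lemma (in prob_space) first_None_law:
  assumes FG: "indep_algebras M F G" and f: "\<And>l. (\<lambda>\<omega>. f \<omega> l) \<in> measurable F (count_space UNIV)"
    and \<theta>: "\<And>l. \<theta> l \<in> borel_measurable G" and C: "C \<in> sets F"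
    and absorbed: "AE \<omega> in M. \<exists>l. f \<omega> l = None" and A: "A \<in> sets borel"
    and T: "\<And>\<omega> l. \<omega> \<in> space M \<Longrightarrow> first_None (f \<omega>) l \<Longrightarrow> T \<omega> = (\<theta> l \<omega> :: real)" and Tm: "T \<in> borel_measurable M"
  shows "emeasure M {\<omega>\<in>space M. \<omega> \<in> C \<and> T \<omega> \<in> A} =
    (\<Sum>l. emeasure M {\<omega>\<in>space M. \<omega> \<in> C \<and> first_None (f \<omega>) l} * emeasure M {\<omega>\<in>space M. \<theta> l \<omega> \<in> A})"
proof -
  note sub = indep_algebrasD(1,2)[OF FG]
  have spaces: "space F = space M" "space G = space M" using sub by (simp_all add: subalgebra_def)
  have fN: "{\<omega>\<in>space M. first_None (f \<omega>) l} \<in> sets F" for l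
  proof -
    have none: "{\<omega>\<in>space F. f \<omega> k = None} \<in> sets F" for k by (rule event_of_measurable[OF f])
    have "{\<omega>\<in>space F. \<forall>k\<in>{..<l}. f \<omega> k \<noteq> None} \<in> sets F"
    proof (rule sets.sets_Collect_finite_All)
      show "{\<omega>\<in>space F. f \<omega> k \<noteq> None} \<in> sets F" for k
        by (rule sets.sets_Collect_neg[OF none])
    qed simp
    from sets.Int[OF none this, of l] show ?thesis
      by (rule back_subst[of "\<lambda>A. A \<in> sets F"]) (auto simp: first_None_def spaces)
  qed
  let ?D = "\<lambda>l. {\<omega>\<in>space M. \<omega> \<in> C \<and> first_None (f \<omega>) l}"
  let ?E = "\<lambda>l. {\<omega>\<in>space M. \<theta> l \<omega> \<in> A}"
  have D: "?D l \<in> sets F" for l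
  proof -
    have "?D l = C \<inter> {\<omega>\<in>space M. first_None (f \<omega>) l}" by auto
    then show ?thesis using sets.Int[OF C fN] by simp
  qed
  have E: "?E l \<in> sets G" for l
    using measurable_sets[OF \<theta> A, of l] by (simp add: vimage_def Int_def conj_commute spaces)
  have DM: "?D l \<in> events" and EM: "?E l \<in> events" for l
    using D E sub unfolding subalgebra_def by blast+
  have CM: "C \<in> events" using C sub unfolding subalgebra_def by blast
  have TM: "{\<omega>\<in>space M. T \<omega> \<in> A} \<in> events"
    using measurable_sets[OF Tm A] by (simp add: vimage_def Int_def conj_commute)
  have "emeasure M {\<omega>\<in>space M. \<omega> \<in> C \<and> T \<omega> \<in> A} = emeasure M (\<Union>l. ?D l \<inter> ?E l)"
  proof (rule emeasure_eq_AE)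
    show "AE \<omega> in M. (\<omega> \<in> {\<omega>\<in>space M. \<omega> \<in> C \<and> T \<omega> \<in> A}) = (\<omega> \<in> (\<Union>l. ?D l \<inter> ?E l))"
      using absorbed AE_space
    proof eventually_elim
      case (elim \<omega>)
      obtain k where first: "first_None (f \<omega>) k" using first_None_exists[OF elim(1)] by blast
      have "(\<omega> \<in> C \<and> T \<omega> \<in> A) \<longleftrightarrow> (\<exists>l. (\<omega> \<in> C \<and> first_None (f \<omega>) l) \<and> \<theta> l \<omega> \<in> A)"
        using first first_None_unique[OF first] T[OF elim(2) first] by metis
      then show ?case using elim(2) by blast
    qed
    show "{\<omega>\<in>space M. \<omega> \<in> C \<and> T \<omega> \<in> A} \<in> events"
      using sets.Int[OF CM TM] by (rule back_subst[of "\<lambda>A. A \<in> events"]) auto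
    show "(\<Union>l. ?D l \<inter> ?E l) \<in> events" using DM EM by blast
  qed
  also have "\<dots> = (\<Sum>l. emeasure M (?D l \<inter> ?E l))"
  proof (rule suminf_emeasure[symmetric])
    show "range (\<lambda>l. ?D l \<inter> ?E l) \<subseteq> events" using DM EM by blast
    show "disjoint_family (\<lambda>l. ?D l \<inter> ?E l)"
      unfolding disjoint_family_on_def using first_None_unique by blast
  qed
  also have "\<dots> = (\<Sum>l. emeasure M (?D l) * emeasure M (?E l))"
    using indep_algebrasD(3)[OF FG D E] by (simp add: emeasure_eq_measure ennreal_mult)
  finally show ?thesis .
qed

text \<open>Transience of \<open>J\<close>, expressed by its chain of states.\<close>

locale absorbed_clocks = coupled_clocks +
  assumes absorbed: "AE \<omega> in M. \<exists>k. chain \<omega> k = None"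
begin

lemma space_FYU: "space FYU = space M"
  using indep_algebrasD(1)[OF indep_YUZ] by (simp add: subalgebra_def)

text \<open>The slow chain observed at the arrivals of the fast clock.\<close>

definition state :: "'a \<Rightarrow> nat \<Rightarrow> nat option" where
  "state \<omega> l = chain \<omega> (X_count l \<omega>)"

definition fast_index :: "'a \<Rightarrow> nat" where
  "fast_index \<omega> = (LEAST l. state \<omega> l = None)"

text \<open>The random variable \<open>\<tau>\<^sup>n\<close> of the theorem.\<close>

definition approximation :: "'a \<Rightarrow> real" where
  "approximation \<omega> = arrival Z (fast_index \<omega>) \<omega>"

text \<open>The clock \<open>Y\<close>, and with it the kernels, are taken from \<open>\<omega>\<close>, whereas the randomness of the chain comes
  from an independent copy \<open>\<omega>'\<close>.\<close>

definition fast_chain :: "'a \<Rightarrow> 'a \<Rightarrow> nat \<Rightarrow> nat option" where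
  "fast_chain \<omega> \<omega>' = sampled_chain p \<alpha> (kernel n (\<lambda>l. arrival Y l \<omega>)) (\<lambda>k. U k \<omega>')"

text \<open>The default value agrees with that of an infimum over the empty set of absorption times.\<close>

definition hitting :: "'a \<Rightarrow> 'a \<Rightarrow> real" where
  "hitting \<omega> \<omega>' = (if \<exists>l. fast_chain \<omega> \<omega>' l = None
     then arrival Z (LEAST l. fast_chain \<omega> \<omega>' l = None) \<omega>' else Inf {})"

definition conditional_law :: "'a \<Rightarrow> real measure" where
  "conditional_law \<omega> = distr M borel (hitting \<omega>)"

lemma chain_measurable: "(\<lambda>\<omega>. chain \<omega> k) \<in> measurable FYU (count_space UNIV)"
  unfolding chain_def
proof (rule sampled_chain_measurable)
  have X': "counting_process FYU X"
    by (rule counting_process_subalgebra[OF counting_X(2) subalgebras(3)])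
  show "(\<lambda>\<omega>. kernel l0 (\<lambda>l. arrival X l \<omega>) l i j) \<in> borel_measurable FYU" if "j \<in> {1..p}" for l i j
    by (rule clock_kernel_measurable[OF S measurable_arrival[OF X'] that])
  show "U k \<in> borel_measurable FYU" for k
    by (rule measurable_from_subalg[OF subalgebras(4) measurable_variable_algebra]) simp
qed

lemma state_measurable: "(\<lambda>\<omega>. state \<omega> l) \<in> measurable FYU (count_space UNIV)"
  unfolding state_def
  by (rule measurable_compose_countable[OF chain_measurable
        measurable_from_subalg[OF subalgebras(3) X_count_measurable]])

lemma state_measurable_M: "(\<lambda>\<omega>. state \<omega> l) \<in> measurable M (count_space UNIV)"
  by (rule measurable_from_subalg[OF indep_algebrasD(1)[OF indep_YUZ] state_measurable])

lemma fast_index_measurable: "fast_index \<in> measurable M (count_space UNIV)"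
proof -
  have [measurable]: "(\<lambda>\<omega>. state \<omega> l) \<in> measurable M (count_space UNIV)" for l by (rule state_measurable_M)
  show ?thesis unfolding fast_index_def[abs_def] by measurable
qed

lemma approximation_measurable: "approximation \<in> borel_measurable M"
  unfolding approximation_def[abs_def]
  by (rule measurable_compose_countable[OF measurable_arrival[OF counting_Z] fast_index_measurable])

text \<open>The absorption time \<open>arrival X (LEAST k. chain \<omega> k = None) \<omega>\<close> of \<open>J\<close> is the time of the fast arrival with
  the index at which the observed chain is first found absorbed.\<close>

lemma fast_index_properties:
  "AE \<omega> in M. persistent (state \<omega>) \<and> (\<exists>l. state \<omega> l = None) \<and>
    fast_index \<omega> = Y (arrival X (LEAST k. chain \<omega> k = None) \<omega>) \<omega> \<and>
    arrival Y (fast_index \<omega>) \<omega> = arrival X (LEAST k. chain \<omega> k = None) \<omega>"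
  using simple_Y simple_X absorbed AE_space
proof eventually_elim
  case (elim \<omega>)
  let ?x = "\<lambda>t. X t \<omega>" and ?y = "\<lambda>t. B t \<omega>" and ?z = "\<lambda>t. Y t \<omega>"
  define k where "k = (LEAST k. chain \<omega> k = None)"
  have count: "X_count l \<omega> = ?x (arrival_time ?z l)" for l
    using simple_pathD(4)[OF elim(1), of l] by (simp add: X_count_def arrival_eq_arrival_time)
  note x = counting_process_path[OF counting_X(1) elim(4)] and y = counting_process_path[OF counting_B(1) elim(4)]
  have sum: "?z t = ?x t + ?y t" for t by (simp add: Y_def)
  have reach: "\<exists>s\<ge>0. k \<le> ?x s" using simple_pathD(2)[OF elim(2)] .
  note fp = first_passage_of_component[OF x y elim(1) sum reach]
  have chain: "chain \<omega> m = None \<longleftrightarrow> k \<le> m" for m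
  proof -
    have "persistent (chain \<omega>)" unfolding chain_def by (rule persistent_sampled_chain)
    then show ?thesis
      using first_None_exists[OF elim(3)] unfolding persistent_def first_None_def k_def by (metis not_le)
  qed
  have mono: "X_count i \<omega> \<le> X_count l \<omega>" if "i \<le> l" for i l
    unfolding count using that simple_path_arrival_time_mono[OF elim(1), of i l] simple_pathD(4)[OF elim(1)]
    by (intro counting_path_mono[OF x]) auto
  have pers: "persistent (state \<omega>)"
    unfolding persistent_def state_def chain using mono order_trans by blast
  have idx: "fast_index \<omega> = ?z (arrival_time ?x k)"
    unfolding fast_index_def state_def chain count
    using fp(1,3) by (intro Least_equality) (auto simp: not_less[symmetric])
  moreover have "state \<omega> (?z (arrival_time ?x k)) = None"
    unfolding state_def chain count using fp(1) .
  ultimately show ?case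
    using pers fp(2) unfolding arrival_eq_arrival_time k_def by auto
qed

lemma fast_chain_survival:
  "emeasure M {\<omega>'\<in>space M. fast_chain \<omega> \<omega>' l \<noteq> None} =
    (\<Sum>j\<in>{1..p}. ennreal (occupation p \<alpha> (kernel n (\<lambda>l. arrival Y l \<omega>)) l j))"
proof -
  have meas: "(\<lambda>\<omega>'. fast_chain \<omega> \<omega>' l) \<in> measurable M (count_space UNIV)"
    unfolding fast_chain_def
    by (intro sampled_chain_measurable iid_uniformD(1)[OF U]) simp
  have range: "fast_chain \<omega> \<omega>' l \<in> insert None (Some ` {1..p})" for \<omega>'
    unfolding fast_chain_def by (rule sampled_chain_range[OF \<alpha> substochastic_kernel[OF rates(2)]])
  have "{\<omega>'\<in>space M. fast_chain \<omega> \<omega>' l \<noteq> None} = (\<Union>j\<in>{1..p}. {\<omega>'\<in>space M. fast_chain \<omega> \<omega>' l = Some j})"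
  proof -
    have "fast_chain \<omega> \<omega>' l \<noteq> None \<longleftrightarrow> (\<exists>j\<in>{1..p}. fast_chain \<omega> \<omega>' l = Some j)" for \<omega>'
      using range[of \<omega>'] by (cases "fast_chain \<omega> \<omega>' l") auto
    then show ?thesis by blast
  qed
  moreover have "emeasure M (\<Union>j\<in>{1..p}. {\<omega>'\<in>space M. fast_chain \<omega> \<omega>' l = Some j}) =
      (\<Sum>j\<in>{1..p}. emeasure M {\<omega>'\<in>space M. fast_chain \<omega> \<omega>' l = Some j})"
    by (rule sum_emeasure[symmetric])
       (auto simp: disjoint_family_on_def intro: event_of_measurable[OF meas])
  moreover have "emeasure M {\<omega>'\<in>space M. fast_chain \<omega> \<omega>' l = Some j} =
      ennreal (occupation p \<alpha> (kernel n (\<lambda>l. arrival Y l \<omega>)) l j)" if "j \<in> {1..p}" for j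
    unfolding fast_chain_def emeasure_eq_measure
    by (simp only: sampled_chain_law[OF U \<alpha> substochastic_kernel[OF rates(2)] that])
  then have "(\<Sum>j\<in>{1..p}. emeasure M {\<omega>'\<in>space M. fast_chain \<omega> \<omega>' l = Some j}) =
      (\<Sum>j\<in>{1..p}. ennreal (occupation p \<alpha> (kernel n (\<lambda>l. arrival Y l \<omega>)) l j))"
    by (rule sum.cong[OF refl])
  ultimately show ?thesis by (simp only:)
qed

text \<open>Survival is the sum of the occupation probabilities, to which \<open>conditional_occupation\<close> applies.\<close>

lemma conditional_survival:
  assumes C: "C \<in> sets (natural_sigma M Y)"
  shows "emeasure M {\<omega>\<in>space M. \<omega> \<in> C \<and> alive (state \<omega>) l} =
    (\<integral>\<^sup>+\<omega>. indicator C \<omega> * emeasure M {\<omega>'\<in>space M. alive (fast_chain \<omega> \<omega>') l} \<partial>M)"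
proof (cases l)
  case 0
  have CM: "C \<in> events" using natural_sigma_subset[OF counting_Y(1) refl] C by blast
  then have "{\<omega>\<in>space M. \<omega> \<in> C} = C" using sets.sets_into_space by blast
  then show ?thesis using 0 CM by (simp add: alive_def emeasure_space_1)
next
  case (Suc m)
  have CM: "C \<in> events" using natural_sigma_subset[OF counting_Y(1) refl] C by blast
  have range: "state \<omega> m \<in> insert None (Some ` {1..p})" for \<omega>
    unfolding state_def chain_def by (rule sampled_chain_range[OF \<alpha> substochastic_kernel[OF order_refl]])
  have ev: "{\<omega>\<in>space M. \<omega> \<in> C \<and> state \<omega> m = Some j} \<in> events" for j
    using sets.Int[OF CM event_of_measurable[OF state_measurable_M, of m "Some j"]]
    by (rule back_subst[of "\<lambda>A. A \<in> events"]) auto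
  have occm: "(\<lambda>\<omega>. indicator C \<omega> * ennreal (occupation p \<alpha> (kernel n (\<lambda>l. arrival Y l \<omega>)) m j)) \<in> borel_measurable M"
    if "j \<in> {1..p}" for j
    by (intro borel_measurable_times_ennreal borel_measurable_indicator CM measurable_compose[OF _ measurable_ennreal]
        occupation_measurable clock_kernel_measurable[OF S measurable_arrival[OF counting_Y(1)]] that)
  have "{\<omega>\<in>space M. \<omega> \<in> C \<and> alive (state \<omega>) l} = (\<Union>j\<in>{1..p}. {\<omega>\<in>space M. \<omega> \<in> C \<and> state \<omega> m = Some j})"
  proof -
    have "alive (state \<omega>) l \<longleftrightarrow> (\<exists>j\<in>{1..p}. state \<omega> m = Some j)" for \<omega>
      using range[of \<omega>] by (cases "state \<omega> m") (auto simp: alive_def Suc)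
    then show ?thesis by blast
  qed
  moreover have "emeasure M (\<Union>j\<in>{1..p}. {\<omega>\<in>space M. \<omega> \<in> C \<and> state \<omega> m = Some j}) =
      (\<Sum>j\<in>{1..p}. emeasure M {\<omega>\<in>space M. \<omega> \<in> C \<and> state \<omega> m = Some j})"
    by (rule sum_emeasure[symmetric]) (use ev in \<open>auto simp: disjoint_family_on_def\<close>)
  moreover have "\<dots> = (\<Sum>j\<in>{1..p}. \<integral>\<^sup>+\<omega>. indicator C \<omega> *
      ennreal (occupation p \<alpha> (kernel n (\<lambda>l. arrival Y l \<omega>)) m j) \<partial>M)"
    unfolding state_def by (intro sum.cong refl conditional_occupation[OF C])
  moreover have "\<dots> = (\<integral>\<^sup>+\<omega>. (\<Sum>j\<in>{1..p}. indicator C \<omega> *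
      ennreal (occupation p \<alpha> (kernel n (\<lambda>l. arrival Y l \<omega>)) m j)) \<partial>M)"
    by (rule nn_integral_sum[symmetric]) (rule occm)
  moreover have "\<dots> = (\<integral>\<^sup>+\<omega>. indicator C \<omega> * emeasure M {\<omega>'\<in>space M. alive (fast_chain \<omega> \<omega>') l} \<partial>M)"
    unfolding Suc alive_Suc fast_chain_survival sum_distrib_left ..
  ultimately show ?thesis by (simp only:)
qed

lemma fast_chain_event:
  "{\<omega>'\<in>space M. fast_chain \<omega> \<omega>' l = None} \<in> sets (variable_algebra M U UNIV)"
  "{\<omega>'\<in>space M. fast_chain \<omega> \<omega>' l = None} \<in> events"
proof -
  have "(\<lambda>\<omega>'. fast_chain \<omega> \<omega>' l) \<in> measurable (variable_algebra M U UNIV) (count_space UNIV)"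
    unfolding fast_chain_def by (intro sampled_chain_measurable measurable_variable_algebra) auto
  from event_of_measurable[OF this, of None]
  show 1: "{\<omega>'\<in>space M. fast_chain \<omega> \<omega>' l = None} \<in> sets (variable_algebra M U UNIV)" by simp
  then show "{\<omega>'\<in>space M. fast_chain \<omega> \<omega>' l = None} \<in> events"
    using iid_uniformD(3)[OF U, of UNIV] unfolding subalgebra_def by blast
qed

lemma alive_event:
  assumes "\<And>l. {\<omega>\<in>space M. f \<omega> l = None} \<in> events"
  shows "{\<omega>\<in>space M. alive (f \<omega>) l} \<in> events"
proof (cases l)
  case (Suc m)
  then show ?thesis using sets.sets_Collect_neg[OF assms, of m] by (simp add: alive_def)
qed (simp add: alive_def)

lemma fast_chain_jointly_measurable:
  "(\<lambda>z. fast_chain (fst z) (snd z) l) \<in> measurable (natural_sigma M Y \<Otimes>\<^sub>M M) (count_space UNIV)"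
  unfolding fast_chain_def
proof (rule sampled_chain_measurable)
  note Y' = counting_process_natural_sigma[OF counting_Y(1)]
  show "(\<lambda>z. kernel n (\<lambda>l. arrival Y l (fst z)) l i j) \<in> borel_measurable (natural_sigma M Y \<Otimes>\<^sub>M M)"
    if "j \<in> {1..p}" for l i j
    by (intro clock_kernel_measurable[OF S _ that] measurable_compose[OF measurable_fst measurable_arrival[OF Y']])
  show "(\<lambda>z. U k (snd z)) \<in> borel_measurable (natural_sigma M Y \<Otimes>\<^sub>M M)" for k
    by (rule measurable_compose[OF measurable_snd iid_uniformD(1)[OF U]])
qed

lemma natural_sigma_measurable: "f \<in> measurable (natural_sigma M Y) N \<Longrightarrow> f \<in> measurable M N"
  using natural_sigma_subset[OF counting_Y(1) refl] by (auto simp: measurable_def)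

lemma section_measurable:
  assumes Q: "Measurable.pred (natural_sigma M Y \<Otimes>\<^sub>M M) (\<lambda>z. Q (fst z) (snd z))"
  shows "(\<lambda>\<omega>. emeasure M {\<omega>'\<in>space M. Q \<omega> \<omega>'}) \<in> borel_measurable M"
proof (rule natural_sigma_measurable)
  have "(\<lambda>\<omega>. emeasure M (Pair \<omega> -` {z\<in>space (natural_sigma M Y \<Otimes>\<^sub>M M). Q (fst z) (snd z)}))
      \<in> borel_measurable (natural_sigma M Y)"
    by (rule measurable_emeasure_Pair) (use Q in \<open>simp add: pred_def\<close>)
  moreover have "Pair \<omega> -` {z\<in>space (natural_sigma M Y \<Otimes>\<^sub>M M). Q (fst z) (snd z)} = {\<omega>'\<in>space M. Q \<omega> \<omega>'}"
    if "\<omega> \<in> space (natural_sigma M Y)" for \<omega>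
    using that by (auto simp: space_pair_measure)
  ultimately show "(\<lambda>\<omega>. emeasure M {\<omega>'\<in>space M. Q \<omega> \<omega>'}) \<in> borel_measurable (natural_sigma M Y)"
    by (simp only: cong: measurable_cong)
qed

lemma fast_chain_pred [measurable]:
  "Measurable.pred (natural_sigma M Y \<Otimes>\<^sub>M M) (\<lambda>z. fast_chain (fst z) (snd z) l = None)"
proof -
  note [measurable] = fast_chain_jointly_measurable
  show ?thesis by measurable
qed

lemma alive_pred: "Measurable.pred (natural_sigma M Y \<Otimes>\<^sub>M M) (\<lambda>z. alive (fast_chain (fst z) (snd z)) l)"
proof (cases l)
  case (Suc k)
  show ?thesis unfolding Suc alive_Suc by measurable
qed (simp add: alive_0)

lemma first_None_pred:
  "Measurable.pred (natural_sigma M Y \<Otimes>\<^sub>M M) (\<lambda>z. first_None (fast_chain (fst z) (snd z)) l)"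
  unfolding first_None_def
  by (intro pred_intros_logic pred_intros_countable fast_chain_pred) simp

text \<open>Absorption at index \<open>l\<close> is the difference between being alive at \<open>l\<close> and at \<open>Suc l\<close>, for the observed
  chain as well as for the fast one.\<close>

lemma conditional_first_None:
  assumes C: "C \<in> sets (natural_sigma M Y)"
  shows "emeasure M {\<omega>\<in>space M. \<omega> \<in> C \<and> first_None (state \<omega>) l} =
    (\<integral>\<^sup>+\<omega>. indicator C \<omega> * emeasure M {\<omega>'\<in>space M. first_None (fast_chain \<omega> \<omega>') l} \<partial>M)"
proof -
  have CM: "C \<in> events" using natural_sigma_subset[OF counting_Y(1) refl] C by blast
  have st: "{\<omega>\<in>space M. state \<omega> k = None} \<in> events" for k by (rule event_of_measurable[OF state_measurable_M])
  let ?a = "\<lambda>l. {\<omega>\<in>space M. \<omega> \<in> C \<and> alive (state \<omega>) l}"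
  let ?d = "{\<omega>\<in>space M. \<omega> \<in> C \<and> first_None (state \<omega>) l}"
  have a: "?a k \<in> events" for k
    using sets.Int[OF CM alive_event[of state, OF st, of k]] by (rule back_subst[of "\<lambda>A. A \<in> events"]) auto
  have aN: "?a l \<inter> {\<omega>\<in>space M. state \<omega> l = None} \<in> events" by (rule sets.Int[OF a st])
  have d: "?d \<in> events"
  proof -
    have "{\<omega>\<in>space M. \<forall>k\<in>{..<l}. state \<omega> k \<noteq> None} \<in> events"
      by (rule sets.sets_Collect_finite_All[OF sets.sets_Collect_neg[OF st]]) simp
    from sets.Int[OF CM sets.Int[OF st this]] show ?thesis
      by (rule back_subst[of "\<lambda>A. A \<in> events"]) (auto simp: first_None_def)
  qed
  have split_state: "emeasure M ?d + emeasure M (?a (Suc l)) = emeasure M (?a l)"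
  proof -
    have "emeasure M ?d = emeasure M (?a l \<inter> {\<omega>\<in>space M. state \<omega> l = None})"
    proof (rule emeasure_eq_AE[OF _ d aN])
      show "AE \<omega> in M. (\<omega> \<in> ?d) = (\<omega> \<in> ?a l \<inter> {\<omega>\<in>space M. state \<omega> l = None})"
        using fast_index_properties by eventually_elim (auto simp: first_None_persistent)
    qed
    moreover have "emeasure M (?a (Suc l)) = emeasure M (?a l - {\<omega>\<in>space M. state \<omega> l = None})"
    proof (rule emeasure_eq_AE[OF _ a sets.Diff[OF a st]])
      show "AE \<omega> in M. (\<omega> \<in> ?a (Suc l)) = (\<omega> \<in> ?a l - {\<omega>\<in>space M. state \<omega> l = None})"
        using fast_index_properties
      proof eventually_elim
        case (elim \<omega>)
        then have "alive (state \<omega>) (Suc l) \<longleftrightarrow> alive (state \<omega>) l \<and> state \<omega> l \<noteq> None"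
          using alive_step by blast
        then show ?case by blast
      qed
    qed
    ultimately show ?thesis
      using plus_emeasure[OF aN sets.Diff[OF a st]] by (simp add: Int_Diff_Un Int_Diff_disjoint)
  qed
  let ?A = "\<lambda>\<omega> l. {\<omega>'\<in>space M. alive (fast_chain \<omega> \<omega>') l}"
  let ?D = "\<lambda>\<omega>. {\<omega>'\<in>space M. first_None (fast_chain \<omega> \<omega>') l}"
  have split_fast: "emeasure M (?D \<omega>) + emeasure M (?A \<omega> (Suc l)) = emeasure M (?A \<omega> l)" for \<omega>
  proof -
    have pers: "persistent (fast_chain \<omega> \<omega>')" for \<omega>' unfolding fast_chain_def by (rule persistent_sampled_chain)
    have 1: "?D \<omega> = ?A \<omega> l \<inter> {\<omega>'\<in>space M. fast_chain \<omega> \<omega>' l = None}"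
      using first_None_persistent[OF pers] by auto
    have 2: "?A \<omega> (Suc l) = ?A \<omega> l - {\<omega>'\<in>space M. fast_chain \<omega> \<omega>' l = None}"
    proof -
      have "alive (fast_chain \<omega> \<omega>') (Suc l) \<longleftrightarrow> alive (fast_chain \<omega> \<omega>') l \<and> fast_chain \<omega> \<omega>' l \<noteq> None" for \<omega>'
        by (rule alive_step[OF pers])
      then show ?thesis by blast
    qed
    have ev: "?A \<omega> l \<in> events" by (rule alive_event[OF fast_chain_event(2)])
    show ?thesis
      unfolding 1 2
      using plus_emeasure[OF sets.Int[OF ev fast_chain_event(2)] sets.Diff[OF ev fast_chain_event(2)], of \<omega> l \<omega> l]
      by (simp add: Int_Diff_Un Int_Diff_disjoint)
  qed
  have mA: "(\<lambda>\<omega>. emeasure M (?A \<omega> k)) \<in> borel_measurable M" for k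
    by (rule section_measurable[OF alive_pred])
  have mD: "(\<lambda>\<omega>. emeasure M (?D \<omega>)) \<in> borel_measurable M"
    by (rule section_measurable[OF first_None_pred])
  have "(\<integral>\<^sup>+\<omega>. indicator C \<omega> * emeasure M (?D \<omega>) \<partial>M) + emeasure M (?a (Suc l)) =
      (\<integral>\<^sup>+\<omega>. indicator C \<omega> * emeasure M (?D \<omega>) + indicator C \<omega> * emeasure M (?A \<omega> (Suc l)) \<partial>M)"
    unfolding conditional_survival[OF C]
    by (rule nn_integral_add[symmetric]) (intro borel_measurable_times_ennreal borel_measurable_indicator CM mA mD)+
  also have "\<dots> = (\<integral>\<^sup>+\<omega>. indicator C \<omega> * emeasure M (?A \<omega> l) \<partial>M)"
    unfolding split_fast[symmetric] by (simp only: distrib_left)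
  also have "\<dots> = emeasure M ?d + emeasure M (?a (Suc l))"
    unfolding conditional_survival[OF C, symmetric] split_state ..
  finally show ?thesis
    using ennreal_add_left_cancel[of "emeasure M (?a (Suc l))"] by (simp add: add.commute)
qed

text \<open>By \<open>conditional_survival\<close> the survival probabilities of the fast chain average to those of the
  observed one, and these tend to zero.\<close>

lemma fast_chain_absorbed: "AE \<omega> in M. AE \<omega>' in M. \<exists>l. fast_chain \<omega> \<omega>' l = None"
proof -
  have st: "{\<omega>\<in>space M. state \<omega> k = None} \<in> events" for k by (rule event_of_measurable[OF state_measurable_M])
  let ?N = "\<lambda>\<omega>. {\<omega>'\<in>space M. \<forall>l. fast_chain \<omega> \<omega>' l \<noteq> None}"
  have Nm: "(\<lambda>\<omega>. emeasure M (?N \<omega>)) \<in> borel_measurable M"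
    by (rule section_measurable) (intro pred_intros_logic pred_intros_countable fast_chain_pred)
  have Nev: "?N \<omega> \<in> events" for \<omega>
    by (rule sets.sets_Collect_countable_All[OF sets.sets_Collect_neg[OF fast_chain_event(2)]])
  let ?A = "\<lambda>l. {\<omega>\<in>space M. \<forall>k\<in>{..<l}. state \<omega> k \<noteq> None}"
  have Aev: "?A l \<in> events" for l
    by (rule sets.sets_Collect_finite_All[OF sets.sets_Collect_neg[OF st]]) simp
  have le: "(\<integral>\<^sup>+\<omega>. emeasure M (?N \<omega>) \<partial>M) \<le> emeasure M (?A l)" for l
  proof -
    have space: "space M \<in> sets (natural_sigma M Y)" using sets.top[of "natural_sigma M Y"] by simp
    have "(\<integral>\<^sup>+\<omega>. emeasure M (?N \<omega>) \<partial>M) \<le>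
        (\<integral>\<^sup>+\<omega>. indicator (space M) \<omega> * emeasure M {\<omega>'\<in>space M. alive (fast_chain \<omega> \<omega>') l} \<partial>M)"
    proof (rule nn_integral_mono)
      fix \<omega> assume "\<omega> \<in> space M"
      moreover have "?N \<omega> \<subseteq> {\<omega>'\<in>space M. alive (fast_chain \<omega> \<omega>') l}" by (cases l) (auto simp: alive_def)
      ultimately show "emeasure M (?N \<omega>) \<le> indicator (space M) \<omega> * emeasure M {\<omega>'\<in>space M. alive (fast_chain \<omega> \<omega>') l}"
        using emeasure_mono[OF _ alive_event[OF fast_chain_event(2)]] by simp
    qed
    also have "\<dots> = emeasure M {\<omega>\<in>space M. \<omega> \<in> space M \<and> alive (state \<omega>) l}"
      by (rule conditional_survival[OF space, symmetric])
    also have "\<dots> = emeasure M (?A l)"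
    proof (rule emeasure_eq_AE[OF _ _ Aev])
      show "AE \<omega> in M. (\<omega> \<in> {\<omega>\<in>space M. \<omega> \<in> space M \<and> alive (state \<omega>) l}) = (\<omega> \<in> ?A l)"
        using fast_index_properties
      proof eventually_elim
        case (elim \<omega>)
        then have "alive (state \<omega>) l \<longleftrightarrow> (\<forall>k\<in>{..<l}. state \<omega> k \<noteq> None)"
          unfolding lessThan_iff Ball_def by (simp only: alive_iff)
        then show ?case by blast
      qed
      show "{\<omega>\<in>space M. \<omega> \<in> space M \<and> alive (state \<omega>) l} \<in> events"
        using alive_event[of state, OF st, of l] by simp
    qed
    finally show ?thesis .
  qed
  have "(\<lambda>l. emeasure M (?A l)) \<longlonglongrightarrow> emeasure M (\<Inter>l. ?A l)"
    by (rule Lim_emeasure_decseq) (use Aev in \<open>auto simp: decseq_def\<close>)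
  moreover have "emeasure M (\<Inter>l. ?A l) = 0"
  proof -
    have "AE \<omega> in M. \<omega> \<notin> (\<Inter>l. ?A l)"
      using fast_index_properties
    proof eventually_elim
      case (elim \<omega>)
      then obtain l where "state \<omega> l = None" by blast
      then have "\<omega> \<notin> ?A (Suc l)" by auto
      then show ?case by blast
    qed
    moreover have "(\<Inter>l. ?A l) \<in> events" using Aev by blast
    ultimately show ?thesis
      by (intro AE_iff_measurable[THEN iffD1, of _ M "\<lambda>\<omega>. \<omega> \<notin> (\<Inter>l. ?A l)"]) blast+
  qed
  ultimately have "(\<integral>\<^sup>+\<omega>. emeasure M (?N \<omega>) \<partial>M) \<le> 0"
    by (intro LIMSEQ_le_const[of "\<lambda>l. emeasure M (?A l)"]) (use le in auto)
  then have "AE \<omega> in M. emeasure M (?N \<omega>) = 0"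
    using nn_integral_0_iff_AE[OF Nm] by simp
  then show ?thesis
  proof eventually_elim
    case (elim \<omega>)
    then show ?case by (intro AE_I[OF _ elim Nev]) auto
  qed
qed

lemma hitting_jointly_measurable:
  "(\<lambda>z. hitting (fst z) (snd z)) \<in> borel_measurable (natural_sigma M Y \<Otimes>\<^sub>M M)"
proof -
  have idx: "(\<lambda>z. LEAST l. fast_chain (fst z) (snd z) l = None) \<in>
      measurable (natural_sigma M Y \<Otimes>\<^sub>M M) (count_space UNIV)"
    by measurable
  have [measurable]: "(\<lambda>z. arrival Z (LEAST l. fast_chain (fst z) (snd z) l = None) (snd z)) \<in>
      borel_measurable (natural_sigma M Y \<Otimes>\<^sub>M M)"
    by (rule measurable_compose_countable[OF measurable_compose[OF measurable_snd measurable_arrival[OF counting_Z]] idx])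
  show ?thesis unfolding hitting_def by measurable
qed

lemma hitting_measurable: "hitting \<omega> \<in> borel_measurable M"
proof -
  have idx: "(\<lambda>\<omega>'. LEAST l. fast_chain \<omega> \<omega>' l = None) \<in> measurable M (count_space UNIV)"
    and ex [measurable]: "Measurable.pred M (\<lambda>\<omega>'. \<exists>l. fast_chain \<omega> \<omega>' l = None)"
  proof -
    have [measurable]: "Measurable.pred M (\<lambda>\<omega>'. fast_chain \<omega> \<omega>' l = None)" for l
      using fast_chain_event(2) by (simp add: pred_def)
    show "(\<lambda>\<omega>'. LEAST l. fast_chain \<omega> \<omega>' l = None) \<in> measurable M (count_space UNIV)"
      "Measurable.pred M (\<lambda>\<omega>'. \<exists>l. fast_chain \<omega> \<omega>' l = None)" by measurable
  qed
  have [measurable]: "(\<lambda>\<omega>'. arrival Z (LEAST l. fast_chain \<omega> \<omega>' l = None) \<omega>') \<in> borel_measurable M"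
    by (rule measurable_compose_countable[OF measurable_arrival[OF counting_Z] idx])
  show ?thesis unfolding hitting_def[abs_def] by measurable
qed

lemma conditional_law_measurable:
  "conditional_law \<in> measurable (natural_sigma M Y) (prob_algebra borel)"
  unfolding conditional_law_def[abs_def]
proof (rule measurable_distr_prob_space2)
  show "(\<lambda>_. M) \<in> measurable (natural_sigma M Y) (prob_algebra M)"
    by (rule measurable_const) (simp add: space_prob_algebra prob_space_axioms)
  show "(\<lambda>(\<omega>, \<omega>'). hitting \<omega> \<omega>') \<in> borel_measurable (natural_sigma M Y \<Otimes>\<^sub>M M)"
    using hitting_jointly_measurable by (simp add: case_prod_beta')
qed

text \<open>Given \<open>Y\<close>, the index of \<open>approximation\<close> has the law of the absorption index of \<open>fast_chain\<close>, and in
  both cases the times \<open>arrival Z l\<close> are independent of the index.\<close>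

lemma regular_conditional_law_approximation:
  "regular_conditional_law M (natural_sigma M Y) approximation conditional_law"
  unfolding regular_conditional_law_def
proof (intro conjI ballI conditional_law_measurable)
  fix C A assume C: "C \<in> sets (natural_sigma M Y)" and A: "A \<in> sets (borel :: real measure)"
  have CM: "C \<in> events" using natural_sigma_subset[OF counting_Y(1) refl] C by blast
  have CF: "C \<in> sets FYU"
    using natural_sigma_subset[OF counting_process_subalgebra[OF counting_Y(2) subalgebras(3)] space_FYU] C by blast
  let ?t = "\<lambda>l. emeasure M {\<omega>\<in>space M. arrival Z l \<omega> \<in> A}"
  let ?e = "\<lambda>l \<omega>. emeasure M {\<omega>'\<in>space M. first_None (fast_chain \<omega> \<omega>') l}"
  have em: "?e l \<in> borel_measurable M" for l
    by (rule section_measurable[OF first_None_pred])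
  have "C \<inter> (approximation -` A \<inter> space M) = {\<omega>\<in>space M. \<omega> \<in> C \<and> approximation \<omega> \<in> A}" by auto
  then have "emeasure M (C \<inter> (approximation -` A \<inter> space M)) =
      emeasure M {\<omega>\<in>space M. \<omega> \<in> C \<and> approximation \<omega> \<in> A}" by simp
  also have "\<dots> = (\<Sum>l. emeasure M {\<omega>\<in>space M. \<omega> \<in> C \<and> first_None (state \<omega>) l} * ?t l)"
  proof (rule first_None_law[OF indep_YUZ state_measurable measurable_arrival[OF Z(1)] CF _ A _ approximation_measurable])
    show "AE \<omega> in M. \<exists>l. state \<omega> l = None" using fast_index_properties by eventually_elim auto
    show "approximation \<omega> = arrival Z l \<omega>" if "first_None (state \<omega>) l" for \<omega> l
      using first_None_Least[OF that] by (simp add: approximation_def fast_index_def)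
  qed
  also have "\<dots> = (\<Sum>l. \<integral>\<^sup>+\<omega>. indicator C \<omega> * ?e l \<omega> * ?t l \<partial>M)"
    unfolding conditional_first_None[OF C]
    by (intro suminf_cong nn_integral_multc[symmetric] borel_measurable_times_ennreal borel_measurable_indicator CM em)
  also have "\<dots> = (\<integral>\<^sup>+\<omega>. (\<Sum>l. indicator C \<omega> * ?e l \<omega> * ?t l) \<partial>M)"
    by (rule nn_integral_suminf[symmetric])
       (intro borel_measurable_times_ennreal borel_measurable_indicator borel_measurable_const CM em)
  also have "\<dots> = (\<integral>\<^sup>+\<omega>. emeasure (conditional_law \<omega>) A * indicator C \<omega> \<partial>M)"
  proof (rule nn_integral_cong_AE)
    show "AE \<omega> in M. (\<Sum>l. indicator C \<omega> * ?e l \<omega> * ?t l) = emeasure (conditional_law \<omega>) A * indicator C \<omega>"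
      using fast_chain_absorbed
    proof eventually_elim
      case (elim \<omega>)
      have ZU: "indep_algebras M (variable_algebra M U UNIV) FZ"
        by (rule indep_algebras_sym[OF indep_ZU])
      have fm: "(\<lambda>\<omega>'. fast_chain \<omega> \<omega>' l) \<in> measurable (variable_algebra M U UNIV) (count_space UNIV)" for l
        unfolding fast_chain_def by (intro sampled_chain_measurable measurable_variable_algebra) auto
      have top: "space M \<in> sets (variable_algebra M U UNIV)"
        using sets.top[of "variable_algebra M U UNIV"] by simp
      have "emeasure (conditional_law \<omega>) A = emeasure M {\<omega>'\<in>space M. \<omega>' \<in> space M \<and> hitting \<omega> \<omega>' \<in> A}"
        unfolding conditional_law_def emeasure_distr[OF hitting_measurable A]
        by (rule arg_cong[of _ _ "emeasure M"]) auto
      also have "\<dots> = (\<Sum>l. emeasure M {\<omega>'\<in>space M. \<omega>' \<in> space M \<and> first_None (fast_chain \<omega> \<omega>') l} * ?t l)"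
      proof (rule first_None_law[OF ZU fm measurable_arrival[OF Z(1)] top elim A _ hitting_measurable])
        show "hitting \<omega> \<omega>' = arrival Z l \<omega>'" if "first_None (fast_chain \<omega> \<omega>') l" for \<omega>' l
        proof -
          have "\<exists>l. fast_chain \<omega> \<omega>' l = None" using that unfolding first_None_def by blast
          then show ?thesis unfolding hitting_def first_None_Least[OF that] by (rule if_P)
        qed
      qed
      finally have K: "emeasure (conditional_law \<omega>) A = (\<Sum>l. ?e l \<omega> * ?t l)" by simp
      show ?case unfolding K by (cases "\<omega> \<in> C") simp_all
    qed
  qed
  finally show "emeasure M (C \<inter> (approximation -` A \<inter> space M)) =
      (\<integral>\<^sup>+\<omega>\<in>C. emeasure (conditional_law \<omega>) A \<partial>M)" .
qed

lemma phase_type_conditional_law: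
  "AE \<omega> in M. phase_type (block_states p) (block_initial \<alpha>)
    (block_matrix S n (\<lambda>l. arrival Y l \<omega>)) (conditional_law \<omega>)"
  using fast_chain_absorbed simple_Y
proof eventually_elim
  case (elim \<omega>)
  let ?c = "\<lambda>l. arrival Y l \<omega>"
  have c: "0 \<le> ?c l" for l using simple_pathD(4)[OF elim(2), of l] by (simp add: arrival_eq_arrival_time)
  have q: "substochastic p (Q_matrix S n ?c)"
    using rates by (intro substochastic_Q_matrix[OF S n_pos _ c]) (auto intro: order_trans[OF bound])
  have chain: "sampled_chain p \<alpha> (Q_matrix S n ?c) (\<lambda>k. U k \<omega>') = fast_chain \<omega> \<omega>'" for \<omega>'
  proof (rule ext)
    fix l
    show "sampled_chain p \<alpha> (Q_matrix S n ?c) (\<lambda>k. U k \<omega>') l = fast_chain \<omega> \<omega>' l"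
      unfolding fast_chain_def
    proof (rule sampled_chain_cong[OF \<alpha> substochastic_kernel[OF rates(2)]])
      fix l i assume "i \<in> {1..p}"
      then show "Q_matrix S n ?c l i = kernel n ?c l i"
        using c by (intro ext) (simp add: clock_kernel_def Q_matrix_def max_absorb2)
    qed
  qed
  have None_iff: "subordinated_chain p \<alpha> (Q_matrix S n ?c) Z U t \<omega>' = None \<longleftrightarrow> fast_chain \<omega> \<omega>' (Z t \<omega>') = None" for t \<omega>'
    by (simp add: subordinated_chain_def block_chain_def chain)
  have hit: "Inf {t. 0 \<le> t \<and> subordinated_chain p \<alpha> (Q_matrix S n ?c) Z U t \<omega>' = None} = hitting \<omega> \<omega>'" for \<omega>'
    unfolding None_iff hitting_def unfolding arrival_eq_arrival_time
    by (rule first_passage_time) (simp add: fast_chain_def persistent_sampled_chain)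
  have abs: "AE \<omega>' in M. \<exists>t\<ge>0. subordinated_chain p \<alpha> (Q_matrix S n ?c) Z U t \<omega>' = None"
    unfolding None_iff using elim(1) simple_Z
  proof eventually_elim
    case (elim \<omega>')
    then obtain l where "fast_chain \<omega> \<omega>' l = None" by blast
    then show ?case
      using simple_pathD(3,4)[OF elim(2), of l] by (intro exI[of _ "arrival_time (\<lambda>t. Z t \<omega>') l"]) simp
  qed
  have "phase_type (block_states p) (block_initial \<alpha>) (block_matrix S n ?c)
      (distr M borel (\<lambda>\<omega>'. Inf {t. 0 \<le> t \<and> subordinated_chain p \<alpha> (Q_matrix S n ?c) Z U t \<omega>' = None}))"
    by (rule subordinated_chain_phase_type[OF U indep_ZU Z n_pos \<alpha> q abs]) (simp only: hit hitting_measurable)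
  then show ?case by (simp only: hit conditional_law_def)
qed

end

section \<open>Algebras generated by the independent sources\<close>

lemma source_algebra_measurable:
  assumes f: "f \<in> measurable F L" and F: "space F = space P" "sets F = E i"
    and i: "i \<in> A" and E: "\<And>i. E i \<subseteq> Pow (space P)"
  shows "f \<in> measurable (source_algebra P E A) L"
proof (rule measurableI)
  show "f x \<in> space L" if "x \<in> space (source_algebra P E A)" for x
    using measurable_space[OF f] that F by simp
  fix B assume "B \<in> sets L"
  then have "f -` B \<inter> space P \<in> E i" using measurable_sets[OF f] F by simp
  then have "f -` B \<inter> space P \<in> (\<Union>i\<in>A. E i)" using i by blast
  moreover have "(\<Union>i\<in>A. E i) \<subseteq> Pow (space P)" using E by blast
  ultimately show "f -` B \<inter> space (source_algebra P E A) \<in> sets (source_algebra P E A)"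
    unfolding space_source_algebra unfolding source_algebra_def by (simp add: sigma_sets.Basic)
qed

lemma counting_process_source_algebra:
  assumes X: "counting_process P X" and E: "\<And>i. E i \<subseteq> Pow (space P)"
    and i: "i \<in> A" "E i = sets (natural_sigma P X)"
  shows "counting_process (source_algebra P E A) X"
  unfolding counting_process_def
proof (intro conjI allI impI ballI)
  fix t :: real assume "0 \<le> t"
  then have "X t \<in> measurable (natural_sigma P X) (count_space UNIV)"
    by (rule counting_process_measurable[OF counting_process_natural_sigma[OF X]])
  then show "X t \<in> measurable (source_algebra P E A) (count_space UNIV)"
    by (rule source_algebra_measurable) (use i E in simp_all)
qed (use counting_process_path[OF X] in simp)

text \<open>The map \<open>c\<close> embeds the indices of the processes into those of the independent sources.\<close>

lemma (in prob_space) poisson_increments_sum: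
  assumes E: "indep_sets E I" "\<And>i. i \<in> I \<Longrightarrow> Int_stable (E i)"
    and c: "inj c" "c ` K \<subseteq> I" and K: "finite K"
    and X: "\<And>k. k \<in> K \<Longrightarrow> poisson_increments M 1 (X k)"
    and m: "\<And>k A. k \<in> K \<Longrightarrow> c k \<in> A \<Longrightarrow> counting_process (source_algebra M E A) (X k)"
  shows "poisson_increments M (real (card K)) (\<lambda>t \<omega>. \<Sum>k\<in>K. X k t \<omega>)"
  using K c(2) X m
proof (induction K rule: finite_induct)
  case empty
  then show ?case using poisson_increments_zero by simp
next
  case (insert k K)
  have "c k \<notin> c ` K" using insert.hyps c(1) by (auto simp: inj_def)
  then have ind: "indep_algebras M (source_algebra M E {c k}) (source_algebra M E (c ` K))"
    using insert.prems(1) by (intro indep_algebras_source_algebra[OF E]) auto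
  have "poisson_increments M (1 + real (card K)) (\<lambda>t \<omega>. X k t \<omega> + (\<Sum>k\<in>K. X k t \<omega>))"
  proof (rule poisson_increments_add[OF ind])
    show "counting_process (source_algebra M E {c k}) (X k)" using insert.prems by auto
    show "poisson_increments M 1 (X k)" using insert.prems by auto
    show "counting_process (source_algebra M E (c ` K)) (\<lambda>t \<omega>. \<Sum>k\<in>K. X k t \<omega>)"
      by (rule counting_process_sum[OF insert.hyps(1)]) (use insert.prems in auto)
    show "poisson_increments M (real (card K)) (\<lambda>t \<omega>. \<Sum>k\<in>K. X k t \<omega>)"
      by (rule insert.IH) (use insert.prems in auto)
  qed
  then show ?case using insert.hyps by simp
qed

section \<open>The slow chain\<close>

lemma jump_chain_eq_sampled_chain:
  "jump_chain p \<alpha> S N U l \<omega> =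
    sampled_chain p \<alpha> (Q_matrix S (lambda0 p S) (\<lambda>l. arrival N l \<omega>)) (\<lambda>k. U k \<omega>) l"
  by (induction l) (auto simp: Q_matrix_def add.commute split: option.split)

lemma persistent_jump_chain: "persistent (\<lambda>l. jump_chain p \<alpha> S N U l \<omega>)"
  using persistent_sampled_chain[of p \<alpha> "Q_matrix S (lambda0 p S) (\<lambda>l. arrival N l \<omega>)" "\<lambda>k. U k \<omega>"]
  by (simp add: persistent_def jump_chain_eq_sampled_chain)

text \<open>At nonnegative jump times the corrections in \<open>clock_kernel\<close> have no effect.\<close>

lemma jump_chain_eq_clock_chain:
  assumes \<alpha>: "probability_vector p \<alpha>" and S: "subintensity_function p S" and l0: "0 < lambda0 p S"
    and bound: "\<And>t i. 0 \<le> t \<Longrightarrow> i \<in> {1..p} \<Longrightarrow> \<bar>S t i i\<bar> \<le> real (lambda0 p S)"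
    and times: "\<And>l. 0 \<le> arrival N l \<omega>"
  shows "jump_chain p \<alpha> S N U l \<omega> =
    sampled_chain p \<alpha> (clock_kernel p S (lambda0 p S) (\<lambda>l. arrival N l \<omega>)) (\<lambda>k. U k \<omega>) l"
  unfolding jump_chain_eq_sampled_chain
proof (rule sampled_chain_cong[OF \<alpha> substochastic_clock_kernel[OF S l0 bound]])
  fix l i assume "i \<in> {1..p}"
  then show "Q_matrix S (lambda0 p S) (\<lambda>l. arrival N l \<omega>) l i =
      clock_kernel p S (lambda0 p S) (\<lambda>l. arrival N l \<omega>) l i"
    using times by (intro ext) (simp add: clock_kernel_def Q_matrix_def max_absorb2)
qed

text \<open>The index zero is special: a process that starts in the absorbing state has absorption time zero, as an
  infimum that is not attained.\<close>

lemma absorption_time_J_process: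
  assumes x: "counting_path (\<lambda>t. N t \<omega>)"
  shows "absorption_time (J_process p \<alpha> S N U) \<omega> =
    (if \<exists>l. jump_chain p \<alpha> S N U l \<omega> = None
     then arrival N (LEAST l. jump_chain p \<alpha> S N U l \<omega> = None) \<omega> else Inf {})"
proof (cases "\<exists>l. jump_chain p \<alpha> S N U l \<omega> = None")
  case True
  define k where "k = (LEAST l. jump_chain p \<alpha> S N U l \<omega> = None)"
  have "jump_chain p \<alpha> S N U m \<omega> = None \<longleftrightarrow> k \<le> m" for m
    using first_None_exists[OF True] persistent_jump_chain[of p \<alpha> S N U \<omega>]
    unfolding persistent_def first_None_def k_def by (metis not_le)
  then have eq: "{t. 0 < t \<and> J_process p \<alpha> S N U t \<omega> = None} = {t. 0 < t \<and> k \<le> N t \<omega>}"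
    by (simp only: J_process_def)
  have "Inf {t. 0 < t \<and> k \<le> N t \<omega>} = arrival N k \<omega>"
  proof (cases "k = 0")
    case True
    have "{t::real. 0 < t \<and> k \<le> N t \<omega>} = {0<..}" using True by auto
    then show ?thesis using True by (simp add: arrival_eq_arrival_time)
  next
    case False
    have "{t. 0 < t \<and> k \<le> N t \<omega>} = {t. 0 \<le> t \<and> k \<le> N t \<omega>}"
    proof -
      have "N 0 \<omega> = 0" using x by (simp add: counting_path_def)
      then have "0 < t \<longleftrightarrow> 0 \<le> t" if "k \<le> N t \<omega>" for t
        using that False by (cases "t = 0") auto
      then show ?thesis by blast
    qed
    then show ?thesis by (simp add: arrival_def)
  qed
  then show ?thesis unfolding if_P[OF True] absorption_time_def eq k_def[symmetric] .
next
  case False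
  then have "{t. 0 < t \<and> J_process p \<alpha> S N U t \<omega> = None} = {}" by (auto simp: J_process_def)
  then show ?thesis unfolding if_not_P[OF False] absorption_time_def by (simp only:)
qed

text \<open>On paths with finitely many arrivals the arrival times have a default value, at which \<open>S\<close> need
  neither be a subintensity matrix nor depend measurably on time; as the default is the same for
  all these paths, the chain is measurable nevertheless.\<close>

lemma jump_chain_measurable:
  assumes N: "counting_process P N" and U: "\<And>k. U k \<in> borel_measurable P"
    and \<alpha>: "probability_vector p \<alpha>" and S: "subintensity_function p S" and l0: "0 < lambda0 p S"
    and bound: "\<And>t i. 0 \<le> t \<Longrightarrow> i \<in> {1..p} \<Longrightarrow> \<bar>S t i i\<bar> \<le> real (lambda0 p S)"
  shows "(\<lambda>\<omega>. jump_chain p \<alpha> S N U l \<omega>) \<in> measurable P (count_space UNIV)"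
proof -
  let ?reach = "\<lambda>l \<omega>. \<exists>t\<ge>0. l \<le> N t \<omega>"
  let ?kern = "\<lambda>\<omega>. clock_kernel p S (lambda0 p S) (\<lambda>l. arrival N l \<omega>)"
  \<comment> \<open>A version of the kernel that is measurable and gives the same chain: if there is no \<open>l\<close>-th arrival,
    then its arrival time is the constant \<open>Inf {}\<close>.\<close>
  define q where "q \<omega> l i j = (if ?reach l \<omega> then ?kern \<omega> l i j
    else Q_matrix S (lambda0 p S) (\<lambda>_. Inf {}) l i j)" for \<omega> l i j
  have sub: "substochastic p (?kern \<omega>)" for \<omega> by (rule substochastic_clock_kernel[OF S l0 bound])
  have eq: "jump_chain p \<alpha> S N U l \<omega> = sampled_chain p \<alpha> (q \<omega>) (\<lambda>k. U k \<omega>) l \<and>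
      (?reach l \<omega> \<longrightarrow> jump_chain p \<alpha> S N U l \<omega> \<in> insert None (Some ` {1..p}))" for l \<omega>
  proof (induction l)
    case 0
    have "sample p \<alpha> (U 0 \<omega>) \<in> insert None (Some ` {1..p})"
      using \<alpha> by (intro sample_range) (simp add: probability_vector_def)
    then show ?case by simp
  next
    case (Suc l)
    show ?case
    proof (cases "?reach (Suc l) \<omega>")
      case True
      then have "?reach l \<omega>" by (meson Suc_leD)
      then have IH: "jump_chain p \<alpha> S N U l \<omega> = sampled_chain p \<alpha> (q \<omega>) (\<lambda>k. U k \<omega>) l"
        "jump_chain p \<alpha> S N U l \<omega> \<in> insert None (Some ` {1..p})" using Suc by auto
      show ?thesis
      proof (cases "jump_chain p \<alpha> S N U l \<omega>")
        case None
        then show ?thesis using IH by simp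
      next
        case (Some i)
        then have i: "i \<in> {1..p}" using IH by auto
        have nn: "0 \<le> arrival N (Suc l) \<omega>"
          using arrival_time_nonneg[OF True] by (simp add: arrival_eq_arrival_time)
        have "Q_matrix S (lambda0 p S) (\<lambda>l. arrival N l \<omega>) (Suc l) i = ?kern \<omega> (Suc l) i"
          using i nn by (intro ext) (simp add: clock_kernel_def Q_matrix_def max_absorb2)
        moreover have "q \<omega> (Suc l) i = ?kern \<omega> (Suc l) i" using True by (intro ext) (simp only: q_def if_True)
        moreover have "sample p (?kern \<omega> (Suc l) i) (U (Suc l) \<omega>) \<in> insert None (Some ` {1..p})"
          by (rule sample_range) (rule substochasticD(1)[OF sub i])
        moreover have s1: "sampled_chain p \<alpha> (q \<omega>) (\<lambda>k. U k \<omega>) l = Some i" using IH(1) Some by simp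
        moreover have s2: "sampled_chain p \<alpha> (Q_matrix S (lambda0 p S) (\<lambda>l. arrival N l \<omega>)) (\<lambda>k. U k \<omega>) l = Some i"
          using Some unfolding jump_chain_eq_sampled_chain .
        ultimately show ?thesis
          unfolding jump_chain_eq_sampled_chain sampled_chain.simps s1 s2 option.case by (simp only: simp_thms)
      qed
    next
      case False
      then have "{t. 0 \<le> t \<and> Suc l \<le> N t \<omega>} = {}" by auto
      then have "arrival N (Suc l) \<omega> = Inf {}" unfolding arrival_def by (simp only:)
      then have "Q_matrix S (lambda0 p S) (\<lambda>l. arrival N l \<omega>) (Suc l) i = q \<omega> (Suc l) i" for i
        using False by (intro ext) (simp only: q_def if_False Q_matrix_def)
      then show ?thesis
        using Suc False unfolding jump_chain_eq_sampled_chain sampled_chain.simps by (simp only: simp_thms)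
    qed
  qed
  have "(\<lambda>\<omega>. q \<omega> l i j) \<in> borel_measurable P" if "j \<in> {1..p}" for l i j
  proof -
    note [measurable] = measurable_reached[OF N, of l]
      clock_kernel_measurable[OF S measurable_arrival[OF N] that, where n = "lambda0 p S" and l = l and i = i]
    show ?thesis unfolding q_def by measurable
  qed
  from sampled_chain_measurable[of p q P l "\<lambda>\<omega> k. U k \<omega>" \<alpha>, OF this U]
  show ?thesis using eq by simp
qed

lemma absorption_time_measurable:
  assumes N: "counting_process P N" and jc: "\<And>l. (\<lambda>\<omega>. jump_chain p \<alpha> S N U l \<omega>) \<in> measurable P (count_space UNIV)"
  shows "absorption_time (J_process p \<alpha> S N U) \<in> borel_measurable P"
proof -
  note [measurable] = jc
  have idx: "(\<lambda>\<omega>. LEAST l. jump_chain p \<alpha> S N U l \<omega> = None) \<in> measurable P (count_space UNIV)"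
    by measurable
  have [measurable]: "(\<lambda>\<omega>. arrival N (LEAST l. jump_chain p \<alpha> S N U l \<omega> = None) \<omega>) \<in> borel_measurable P"
    by (rule measurable_compose_countable[OF measurable_arrival[OF N] idx])
  have "(\<lambda>\<omega>. if \<exists>l. jump_chain p \<alpha> S N U l \<omega> = None
     then arrival N (LEAST l. jump_chain p \<alpha> S N U l \<omega> = None) \<omega> else Inf {}) \<in> borel_measurable P"
    by measurable
  moreover have "absorption_time (J_process p \<alpha> S N U) \<in> borel_measurable P \<longleftrightarrow>
      (\<lambda>\<omega>. if \<exists>l. jump_chain p \<alpha> S N U l \<omega> = None
     then arrival N (LEAST l. jump_chain p \<alpha> S N U l \<omega> = None) \<omega> else Inf {}) \<in> borel_measurable P"
    by (intro measurable_cong absorption_time_J_process counting_process_path[OF N])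
  ultimately show ?thesis by (simp only:)
qed

section \<open>The error of the approximation\<close>

text \<open>If \<open>\<tau> \<le> T\<close> and the fast clock has at most \<open>m\<close> arrivals up to time \<open>T\<close>, then the common index of \<open>\<tau>\<close> and
  of its approximation is at most \<open>m\<close>.  An index of zero causes no error.\<close>

lemma (in absorbed_clocks) approximation_error:
  assumes \<tau>: "\<tau> \<in> borel_measurable M"
    "AE \<omega> in M. \<tau> \<omega> = arrival X (LEAST k. chain \<omega> k = None) \<omega>"
    and \<delta>: "0 \<le> \<delta>" and T: "0 \<le> T" and m: "1 \<le> m"
  shows "prob {\<omega>\<in>space M. \<bar>\<tau> \<omega> - approximation \<omega>\<bar> > \<delta>} \<le>
    prob {\<omega>\<in>space M. Max ((\<lambda>l. \<bar>arrival Z l \<omega> - arrival Y l \<omega>\<bar>) ` {1..m}) \<ge> \<delta>} +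
    prob {\<omega>\<in>space M. m < Y T \<omega>} + prob {\<omega>\<in>space M. \<tau> \<omega> > T}"
proof -
  let ?max = "\<lambda>\<omega>. Max ((\<lambda>l. \<bar>arrival Z l \<omega> - arrival Y l \<omega>\<bar>) ` {1..m})"
  let ?A = "{\<omega>\<in>space M. ?max \<omega> \<ge> \<delta>}" and ?B = "{\<omega>\<in>space M. m < Y T \<omega>}" and ?C = "{\<omega>\<in>space M. \<tau> \<omega> > T}"
  note [measurable] = \<tau>(1) approximation_measurable measurable_arrival[OF counting_Z] measurable_arrival[OF counting_Y(1)]
    counting_process_measurable[OF counting_Y(1) T]
  have max: "?max \<omega> \<ge> \<delta> \<longleftrightarrow> (\<exists>l\<in>{1..m}. \<bar>arrival Z l \<omega> - arrival Y l \<omega>\<bar> \<ge> \<delta>)" for \<omega>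
    using m by (subst Max_ge_iff) auto
  have "{\<omega>\<in>space M. \<exists>l\<in>{1..m}. \<bar>arrival Z l \<omega> - arrival Y l \<omega>\<bar> \<ge> \<delta>} \<in> events"
  proof (rule sets.sets_Collect_finite_Ex)
    fix l
    have "(\<lambda>\<omega>. \<bar>arrival Z l \<omega> - arrival Y l \<omega>\<bar>) \<in> borel_measurable M"
      using measurable_arrival[OF counting_Z, of l] measurable_arrival[OF counting_Y(1), of l] by simp
    from measurable_sets[OF this, of "{\<delta>..}"]
    show "{\<omega>\<in>space M. \<bar>arrival Z l \<omega> - arrival Y l \<omega>\<bar> \<ge> \<delta>} \<in> events"
      by (simp add: vimage_def Int_def conj_commute)
  qed simp
  then have A: "?A \<in> events" by (simp only: max)
  have B: "?B \<in> events" by measurable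
  have C: "?C \<in> events" by measurable
  have "prob {\<omega>\<in>space M. \<bar>\<tau> \<omega> - approximation \<omega>\<bar> > \<delta>} \<le> prob (?A \<union> ?B \<union> ?C)"
  proof (rule finite_measure_mono_AE)
    show "?A \<union> ?B \<union> ?C \<in> events" using A B C by blast
    show "AE \<omega> in M. \<omega> \<in> {\<omega>\<in>space M. \<bar>\<tau> \<omega> - approximation \<omega>\<bar> > \<delta>} \<longrightarrow> \<omega> \<in> ?A \<union> ?B \<union> ?C"
      using \<tau>(2) fast_index_properties simple_X simple_Y
    proof eventually_elim
      case (elim \<omega>)
      show ?case
      proof (intro impI, rule ccontr)
        assume \<omega>: "\<omega> \<in> {\<omega>\<in>space M. \<bar>\<tau> \<omega> - approximation \<omega>\<bar> > \<delta>}" and no: "\<omega> \<notin> ?A \<union> ?B \<union> ?C"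
        let ?L = "fast_index \<omega>"
        have \<tau>L: "\<tau> \<omega> = arrival Y ?L \<omega>"
          using elim(1) elim(2)[THEN conjunct2, THEN conjunct2, THEN conjunct2] by (simp only:)
        have big: "\<bar>arrival Z ?L \<omega> - arrival Y ?L \<omega>\<bar> > \<delta>"
          using \<omega> \<tau>L by (simp add: approximation_def abs_minus_commute)
        have "?L \<noteq> 0"
        proof
          assume "?L = 0"
          then show False using big \<delta> by (simp add: arrival_eq_arrival_time)
        qed
        have "\<tau> \<omega> \<le> T" using no \<omega> by auto
        then have "?L \<le> Y T \<omega>"
          using simple_path_arrival_time_le_iff[OF elim(4) T, of ?L] \<tau>L by (simp add: arrival_eq_arrival_time)
        moreover have "Y T \<omega> \<le> m" using no \<omega> by auto
        ultimately have "?L \<in> {1..m}" using \<open>?L \<noteq> 0\<close> by auto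
        then have "?max \<omega> \<ge> \<delta>" unfolding max using big by (intro bexI[of _ ?L]) auto
        then show False using no \<omega> by blast
      qed
    qed
  qed
  also have "\<dots> \<le> prob (?A \<union> ?B) + prob ?C" by (rule measure_subadditive) (use A B C in auto)
  also have "prob (?A \<union> ?B) \<le> prob ?A + prob ?B" by (rule measure_subadditive) (use A B in auto)
  finally show ?thesis by simp
qed

lemma ln_one_minus_less: "0 < \<epsilon> \<Longrightarrow> \<epsilon> < 1 \<Longrightarrow> \<epsilon> + ln (1 - \<epsilon>) < (0::real)"
  using ln_le_minus_one[of "1 - \<epsilon>"] ln_eq_minus_one[of "1 - \<epsilon>"] by fastforce

text \<open>The fast clock, of intensity \<open>n\<close>, exceeds the mean number \<open>(1 - \<epsilon>) n powr (1 + \<epsilon>)\<close> of its arrivals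
  up to time \<open>(1 - \<epsilon>) n powr \<epsilon>\<close> by the factor \<open>z = 1 / (1 - \<epsilon>)\<close> with exponentially small probability.\<close>

lemma (in prob_space) poisson_excess_bound:
  assumes inc: "poisson_increments M (real n) X" and X: "counting_process M X"
    and \<epsilon>: "0 < \<epsilon>" "\<epsilon> < 1" and n: "0 < n"
  shows "prob {\<omega>\<in>space M. nat \<lfloor>real n powr (1 + \<epsilon>)\<rfloor> < X ((1 - \<epsilon>) * real n powr \<epsilon>) \<omega>} \<le>
    exp ((\<epsilon> + ln (1 - \<epsilon>)) * real n powr (1 + \<epsilon>))"
proof -
  let ?T = "(1 - \<epsilon>) * real n powr \<epsilon>" and ?c = "real n powr (1 + \<epsilon>)" and ?z = "1 / (1 - \<epsilon>)"
  have T: "0 \<le> ?T" using \<epsilon> by simp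
  have z: "1 \<le> ?z" using \<epsilon> by (simp add: field_simps)
  note [measurable] = counting_process_measurable[OF X T]
  have "prob {\<omega>\<in>space M. nat \<lfloor>?c\<rfloor> < X ?T \<omega>} \<le> prob {\<omega>\<in>space M. ?c \<le> real (X ?T \<omega>)}"
  proof (rule finite_measure_mono)
    have "?c \<le> real k" if "nat \<lfloor>?c\<rfloor> < k" for k using that by linarith
    then show "{\<omega>\<in>space M. nat \<lfloor>?c\<rfloor> < X ?T \<omega>} \<subseteq> {\<omega>\<in>space M. ?c \<le> real (X ?T \<omega>)}" by blast
  qed measurable
  also have "\<dots> \<le> ?z powr (- ?c) * exp (real n * ?T * (?z - 1))"
    using \<epsilon> T z by (intro poisson_tail_bound[OF _ inc X]) auto
  also have "?z powr (- ?c) = exp (ln (1 - \<epsilon>) * ?c)"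
    using \<epsilon> by (simp add: powr_def ln_div mult.commute)
  also have "real n * ?T * (?z - 1) = \<epsilon> * ?c"
  proof -
    have "?z - 1 = \<epsilon> / (1 - \<epsilon>)" using \<epsilon> by (simp add: field_simps)
    moreover have "?c = real n * real n powr \<epsilon>" using n by (simp add: powr_add)
    ultimately show ?thesis using \<epsilon> by (simp add: field_simps)
  qed
  also have "exp (ln (1 - \<epsilon>) * ?c) * exp (\<epsilon> * ?c) = exp ((\<epsilon> + ln (1 - \<epsilon>)) * ?c)"
    by (simp add: exp_add[symmetric] algebra_simps)
  finally show ?thesis .
qed

lemma exponential_smallo:
  assumes \<epsilon>: "0 < \<epsilon>" "\<epsilon> < (1::real)" and q: "0 < q"
  shows "(\<lambda>n::nat. exp ((\<epsilon> + ln (1 - \<epsilon>)) * real n powr (1 + \<epsilon>))) \<in> o(\<lambda>n. real n powr (- q))"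
proof -
  define d where "d = - (\<epsilon> + ln (1 - \<epsilon>))"
  have d: "0 < d" using ln_one_minus_less[OF \<epsilon>] by (simp add: d_def)
  have eq: "\<epsilon> + ln (1 - \<epsilon>) = - d" by (simp add: d_def)
  show ?thesis unfolding eq using d \<epsilon> q by real_asymp
qed

section \<open>Convergence of the approximations\<close>

lemma source_events_subset: "source_events P N M Nh Mh U s \<subseteq> Pow (space P)"
proof -
  have "sets (natural_sigma P X) \<subseteq> Pow (space P)" for X :: "real \<Rightarrow> 'a \<Rightarrow> nat"
    using sets.space_closed[of "natural_sigma P X"] by simp
  moreover have "sets (vimage_algebra (space P) V borel) \<subseteq> Pow (space P)" for V :: "'a \<Rightarrow> real"
    using sets.space_closed[of "vimage_algebra (space P) V borel"] by simp
  ultimately show ?thesis by (cases s) simp_all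
qed

lemma Int_stable_source_events: "Int_stable (source_events P N M Nh Mh U s)"
  by (cases s) (auto simp: Int_stable_def)

lemma variable_algebra_eq_source_algebra:
  "variable_algebra P U I = source_algebra P (source_events P N M Nh Mh U) (Src_U ` I)"
  by (simp add: variable_algebra_def source_algebra_def)

text \<open>All independence statements come from disjoint groups of sources: \<open>N\<close> alone, the clocks added to it, the
  other fast clock, and the uniform variables.\<close>

lemma absorbed_clocks_of_independent_sources:
  fixes P :: "'a measure" and S :: "real \<Rightarrow> nat \<Rightarrow> nat \<Rightarrow> real" and N M :: "real \<Rightarrow> 'a \<Rightarrow> nat"
    and p :: nat and Nh Mh :: "nat \<Rightarrow> real \<Rightarrow> 'a \<Rightarrow> nat" and U :: "nat \<Rightarrow> 'a \<Rightarrow> real"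
  defines "l0 \<equiv> lambda0 p S" and "G \<equiv> source_algebra P (source_events P N M Nh Mh U)"
  assumes P: "prob_space P" and \<alpha>: "probability_vector p \<alpha>" and S: "subintensity_function p S"
    and bdd: "uniformly_bounded p S" and indep: "independent_sources P l0 N M Nh Mh U" and n: "l0 \<le> n"
    and transient: "AE \<omega> in P. \<exists>t>0. J_process p \<alpha> S N U t \<omega> = None"
  shows "absorbed_clocks P p \<alpha> S l0 n N (\<lambda>t \<omega>. \<Sum>k\<in>{l0 + 1..n}. Nh k t \<omega>) (superpose M Mh l0 n) U
    (G {Src_N}) (G (Src_Nh ` {l0 + 1..n})) (G ({Src_N} \<union> Src_Nh ` {l0 + 1..n}))
    (G ({Src_N} \<union> Src_Nh ` {l0 + 1..n} \<union> range Src_U)) (G ({Src_M} \<union> Src_Mh ` {l0 + 1..n}))"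
proof -
  interpret prob_space P by (rule P)
  let ?E = "source_events P N M Nh Mh U"
  let ?I = "{Src_N, Src_M} \<union> Src_Nh ` {l0 + 1..} \<union> Src_Mh ` {l0 + 1..} \<union> range Src_U"
  let ?K = "{l0 + 1..n}"
  have E: "indep_sets ?E ?I" using indep by (simp add: independent_sources_def)
  note stable = Int_stable_source_events[of P N M Nh Mh U] and pow = source_events_subset[of P N M Nh Mh U]
  note ind = indep_algebras_source_algebra[OF E stable, folded G_def]
  have pois: "poisson_process P (real l0) N" "poisson_process P (real l0) M"
    "k \<ge> l0 + 1 \<Longrightarrow> poisson_process P 1 (Nh k)" "k \<ge> l0 + 1 \<Longrightarrow> poisson_process P 1 (Mh k)" for k
    using indep by (auto simp: independent_sources_def)
  note inc = poisson_process_increments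
  note cp = poisson_process_counting_process
  have l0: "0 < l0" using pois(1) by (simp add: poisson_process_def)
  have cN: "counting_process (G A) N" if "Src_N \<in> A" for A
    unfolding G_def by (rule counting_process_source_algebra[OF cp[OF pois(1)] pow that]) simp
  have cM: "counting_process (G A) M" if "Src_M \<in> A" for A
    unfolding G_def by (rule counting_process_source_algebra[OF cp[OF pois(2)] pow that]) simp
  have cNh: "counting_process (G A) (Nh k)" if "k \<in> ?K" "Src_Nh k \<in> A" for A k
    unfolding G_def by (rule counting_process_source_algebra[OF cp[OF pois(3)] pow that(2)]) (use that in simp_all)
  have cMh: "counting_process (G A) (Mh k)" if "k \<in> ?K" "Src_Mh k \<in> A" for A k
    unfolding G_def by (rule counting_process_source_algebra[OF cp[OF pois(4)] pow that(2)]) (use that in simp_all)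
  have card: "real (card ?K) = real n - real l0" using n by simp
  have sumN: "poisson_increments P (real n - real l0) (\<lambda>t \<omega>. \<Sum>k\<in>?K. Nh k t \<omega>)"
    unfolding card[symmetric]
    by (rule poisson_increments_sum[OF E stable, of Src_Nh])
       (use cNh in \<open>auto simp: inj_def G_def intro!: inc pois(3)\<close>)
  have sumM: "poisson_increments P (real n - real l0) (\<lambda>t \<omega>. \<Sum>k\<in>?K. Mh k t \<omega>)"
    unfolding card[symmetric]
    by (rule poisson_increments_sum[OF E stable, of Src_Mh])
       (use cMh in \<open>auto simp: inj_def G_def intro!: inc pois(4)\<close>)
  have csN: "counting_process (G A) (\<lambda>t \<omega>. \<Sum>k\<in>?K. Nh k t \<omega>)" if "Src_Nh ` ?K \<subseteq> A" for A
  proof (rule counting_process_sum[OF finite_atLeastAtMost])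
    fix k assume k: "k \<in> ?K"
    show "counting_process (G A) (Nh k)" by (rule cNh[OF k]) (use that k in blast)
  qed
  have csM: "counting_process (G A) (\<lambda>t \<omega>. \<Sum>k\<in>?K. Mh k t \<omega>)" if "Src_Mh ` ?K \<subseteq> A" for A
  proof (rule counting_process_sum[OF finite_atLeastAtMost])
    fix k assume k: "k \<in> ?K"
    show "counting_process (G A) (Mh k)" by (rule cMh[OF k]) (use that k in blast)
  qed
  have Meq: "superpose M Mh l0 n = (\<lambda>t \<omega>. M t \<omega> + (\<Sum>k\<in>?K. Mh k t \<omega>))"
    by (intro ext) (simp add: superpose_def)
  have indM: "indep_algebras P (G {Src_M}) (G (Src_Mh ` ?K))" by (rule ind) auto
  have poisM: "poisson_increments P (real n) (superpose M Mh l0 n)"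
  proof -
    have "poisson_increments P (real l0 + (real n - real l0)) (\<lambda>t \<omega>. M t \<omega> + (\<Sum>k\<in>?K. Mh k t \<omega>))"
      by (rule poisson_increments_add[OF indM cM inc[OF pois(2)] csM sumM]) auto
    then show ?thesis unfolding Meq by simp
  qed
  have UA: "variable_algebra P U I = G (Src_U ` I)" for I
    unfolding G_def by (rule variable_algebra_eq_source_algebra)
  have U: "iid_uniform P U"
    unfolding iid_uniform_def UA
  proof (intro conjI allI impI)
    show "U l \<in> borel_measurable P" "distr P borel (U l) = uniform_measure lborel {0<..<1}" for l
      using indep by (simp_all add: independent_sources_def)
    show "indep_algebras P (G (Src_U ` I)) (G (Src_U ` J))" if "I \<inter> J = {}" for I J
      by (rule ind) (use that in auto)
  qed
  have mono: "subalgebra (G B) (G A)" if "A \<subseteq> B" for A B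
    unfolding G_def by (rule source_algebra_mono[OF that pow])
  have bound: "\<bar>S t i i\<bar> \<le> real l0" if "0 \<le> t" "i \<in> {1..p}" for t i
    unfolding l0_def by (rule diagonal_le_lambda0[OF bdd that])
  have clocks: "coupled_clocks P p \<alpha> S l0 n N (\<lambda>t \<omega>. \<Sum>k\<in>?K. Nh k t \<omega>) (superpose M Mh l0 n) U
    (G {Src_N}) (G (Src_Nh ` ?K)) (G ({Src_N} \<union> Src_Nh ` ?K))
    (G ({Src_N} \<union> Src_Nh ` ?K \<union> range Src_U)) (G ({Src_M} \<union> Src_Mh ` ?K))"
  proof (intro coupled_clocks.intro coupled_clocks_axioms.intro P \<alpha> S bound l0 n U cN csN inc[OF pois(1)] sumN poisM)
    show "counting_process (G ({Src_M} \<union> Src_Mh ` ?K)) (superpose M Mh l0 n)"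
      unfolding Meq by (intro counting_process_add cM csM) auto
    show "indep_algebras P (G {Src_N}) (G (Src_Nh ` ?K))" by (rule ind) auto
    show "indep_algebras P (G ({Src_N} \<union> Src_Nh ` ?K)) (variable_algebra P U UNIV)"
      "indep_algebras P (G ({Src_M} \<union> Src_Mh ` ?K)) (variable_algebra P U UNIV)"
      unfolding UA by (rule ind; auto)+
    show "indep_algebras P (G ({Src_N} \<union> Src_Nh ` ?K \<union> range Src_U)) (G ({Src_M} \<union> Src_Mh ` ?K))"
      by (rule ind) auto
    show "subalgebra (G ({Src_N} \<union> Src_Nh ` ?K)) (G {Src_N})"
      "subalgebra (G ({Src_N} \<union> Src_Nh ` ?K)) (G (Src_Nh ` ?K))"
      "subalgebra (G ({Src_N} \<union> Src_Nh ` ?K \<union> range Src_U)) (G ({Src_N} \<union> Src_Nh ` ?K))"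
      by (rule mono; blast)+
    show "subalgebra (G ({Src_N} \<union> Src_Nh ` ?K \<union> range Src_U)) (variable_algebra P U UNIV)"
      unfolding UA by (rule mono) blast
  qed auto
  interpret coupled_clocks P p \<alpha> S l0 n N "\<lambda>t \<omega>. \<Sum>k\<in>?K. Nh k t \<omega>" "superpose M Mh l0 n" U
    "G {Src_N}" "G (Src_Nh ` ?K)" "G ({Src_N} \<union> Src_Nh ` ?K)"
    "G ({Src_N} \<union> Src_Nh ` ?K \<union> range Src_U)" "G ({Src_M} \<union> Src_Mh ` ?K)"
    by (rule clocks)
  show ?thesis
  proof (intro absorbed_clocks.intro absorbed_clocks_axioms.intro clocks)
    show "AE \<omega> in P. \<exists>k. chain \<omega> k = None"
      using transient simple_X
    proof eventually_elim
      case (elim \<omega>)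
      then obtain t where "jump_chain p \<alpha> S N U (N t \<omega>) \<omega> = None" by (auto simp: J_process_def)
      then have "chain \<omega> (N t \<omega>) = None"
        using jump_chain_eq_clock_chain[OF \<alpha> S l0[unfolded l0_def] bound[unfolded l0_def],
            where N = N and U = U and \<omega> = \<omega>, folded l0_def] simple_pathD(4)[OF elim(2)]
        by (simp add: chain_def arrival_eq_arrival_time)
      then show ?case by blast
    qed
  qed
qed

lemma (in prob_space) prob_exceeds_tendsto_0:
  assumes X: "X \<in> borel_measurable M" and c: "incseq c" "filterlim c at_top sequentially"
  shows "(\<lambda>n. prob {\<omega>\<in>space M. X \<omega> > (c n :: real)}) \<longlonglongrightarrow> 0"
proof -
  note [measurable] = X
  have "(\<lambda>n. prob {\<omega>\<in>space M. X \<omega> > c n}) \<longlonglongrightarrow> prob (\<Inter>n. {\<omega>\<in>space M. X \<omega> > c n})"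
  proof (rule finite_Lim_measure_decseq)
    show "decseq (\<lambda>n. {\<omega>\<in>space M. X \<omega> > c n})"
      unfolding decseq_def using incseqD[OF c(1)] by (auto intro: le_less_trans)
  qed auto
  moreover have "(\<Inter>n. {\<omega>\<in>space M. X \<omega> > c n}) = {}"
  proof -
    have "\<exists>n. X \<omega> \<le> c n" for \<omega>
      using c(2) unfolding filterlim_at_top eventually_sequentially by blast
    then show ?thesis by (auto simp: not_less[symmetric])
  qed
  ultimately show ?thesis by simp
qed

theorem theorem5:
  fixes P :: "'a measure" and p :: nat
    and S :: "real \<Rightarrow> nat \<Rightarrow> nat \<Rightarrow> real" and \<alpha> :: "nat \<Rightarrow> real"
    and N M :: "real \<Rightarrow> 'a \<Rightarrow> nat" and Nh Mh :: "nat \<Rightarrow> real \<Rightarrow> 'a \<Rightarrow> nat"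
    and U :: "nat \<Rightarrow> 'a \<Rightarrow> real" and \<kappa> :: "real \<Rightarrow> real \<Rightarrow> real"
  defines "l0 \<equiv> lambda0 p S"
    and "\<tau> \<equiv> absorption_time (J_process p \<alpha> S N U)"
    and "Nn \<equiv> superpose N Nh (lambda0 p S)"
    and "Mn \<equiv> superpose M Mh (lambda0 p S)"
  assumes "prob_space P" and "1 \<le> p"
    and "subintensity_function p S" and "uniformly_bounded p S"
    and "probability_vector p \<alpha>"
    and "independent_sources P l0 N M Nh Mh U"
    and transient: "AE \<omega> in P. \<exists>t>0. J_process p \<alpha> S N U t \<omega> = None"
    and kappa: "\<And>q \<epsilon>. 0 < q \<Longrightarrow> 0 < \<epsilon> \<Longrightarrow> \<epsilon> < 1 \<Longrightarrow>
      0 < \<kappa> q \<epsilon> \<and>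
      (\<lambda>n. measure P {\<omega>\<in>space P.
          Max ((\<lambda>l. \<bar>arrival (Mn n) l \<omega> - arrival (Nn n) l \<omega>\<bar>)
                 ` {1..nat \<lfloor>real n powr (1 + \<epsilon>)\<rfloor>})
            \<ge> rate_threshold (\<kappa> q \<epsilon>) \<epsilon> n})
        \<in> o(\<lambda>n. real n powr (- q))"
  shows "\<exists>\<tau>n :: nat \<Rightarrow> 'a \<Rightarrow> real.
      (\<forall>n\<ge>l0. \<tau>n n \<in> borel_measurable P) \<and>
      tendsto_in_probability P \<tau>n \<tau> \<and>
      (\<forall>n\<ge>l0. \<exists>K. regular_conditional_law P (natural_sigma P (Nn n)) (\<tau>n n) K \<and>
         (AE \<omega> in P. phase_type (block_states p) (block_initial \<alpha>)
            (block_matrix S n (\<lambda>l. arrival (Nn n) l \<omega>)) (K \<omega>))) \<and>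
      (\<forall>q \<epsilon>. 0 < q \<and> 0 < \<epsilon> \<and> \<epsilon> < 1 \<longrightarrow>
         (\<exists>r \<in> o(\<lambda>n. real n powr (- q)). \<forall>n\<ge>l0.
            measure P {\<omega>\<in>space P. \<bar>\<tau> \<omega> - \<tau>n n \<omega>\<bar> > rate_threshold (\<kappa> q \<epsilon>) \<epsilon> n}
              \<le> r n + measure P {\<omega>\<in>space P. \<tau> \<omega> > (1 - \<epsilon>) * real n powr \<epsilon>}))"
proof -
  interpret prob_space P by fact
  note S = \<open>subintensity_function p S\<close> and bdd = \<open>uniformly_bounded p S\<close>
    and \<alpha> = \<open>probability_vector p \<alpha>\<close> and sources = \<open>independent_sources P l0 N M Nh Mh U\<close>
  have poisson_N: "poisson_process P (real l0) N" and U: "U k \<in> borel_measurable P" for k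
    using sources by (auto simp: independent_sources_def)
  have l0: "0 < l0" using poisson_N by (simp add: poisson_process_def)
  note cN = poisson_process_counting_process[OF poisson_N]
  note bound = diagonal_le_lambda0[OF bdd]
  have \<tau>m: "\<tau> \<in> borel_measurable P"
    unfolding \<tau>_def
    by (rule absorption_time_measurable[OF cN jump_chain_measurable[OF cN U \<alpha> S l0[unfolded l0_def] bound]])
  \<comment> \<open>What is shown for every single \<open>n\<close> about a candidate \<open>T\<close> for the approximation.\<close>
  define good where "good n T \<longleftrightarrow> T \<in> borel_measurable P \<and>
      (\<exists>K. regular_conditional_law P (natural_sigma P (Nn n)) T K \<and>
         (AE \<omega> in P. phase_type (block_states p) (block_initial \<alpha>)
            (block_matrix S n (\<lambda>l. arrival (Nn n) l \<omega>)) (K \<omega>))) \<and>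
      (\<forall>\<delta> t m. 0 \<le> \<delta> \<longrightarrow> 0 \<le> t \<longrightarrow> 1 \<le> m \<longrightarrow> prob {\<omega>\<in>space P. \<bar>\<tau> \<omega> - T \<omega>\<bar> > \<delta>} \<le>
        prob {\<omega>\<in>space P. Max ((\<lambda>l. \<bar>arrival (Mn n) l \<omega> - arrival (Nn n) l \<omega>\<bar>) ` {1..m}) \<ge> \<delta>} +
        prob {\<omega>\<in>space P. m < Nn n t \<omega>} + prob {\<omega>\<in>space P. \<tau> \<omega> > t}) \<and>
      poisson_increments P (real n) (Nn n) \<and> counting_process P (Nn n)" for n T
  have ex_good: "\<exists>T. good n T" if n: "l0 \<le> n" for n
  proof -
    let ?G = "source_algebra P (source_events P N M Nh Mh U)"
    interpret absorbed_clocks P p \<alpha> S l0 n N "\<lambda>t \<omega>. \<Sum>k\<in>{l0 + 1..n}. Nh k t \<omega>" "Mn n" U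
      "?G {Src_N}" "?G (Src_Nh ` {l0 + 1..n})" "?G ({Src_N} \<union> Src_Nh ` {l0 + 1..n})"
      "?G ({Src_N} \<union> Src_Nh ` {l0 + 1..n} \<union> range Src_U)" "?G ({Src_M} \<union> Src_Mh ` {l0 + 1..n})"
      using absorbed_clocks_of_independent_sources[OF prob_space_axioms \<alpha> S bdd
          sources[unfolded l0_def] n[unfolded l0_def] transient]
      unfolding l0_def Mn_def .
    have Y: "Y = Nn n" unfolding Y_def[abs_def] unfolding Nn_def superpose_def[abs_def] l0_def ..
    have \<tau>_arrival: "AE \<omega> in P. \<tau> \<omega> = arrival N (LEAST k. chain \<omega> k = None) \<omega>"
      using absorbed simple_X AE_space
    proof eventually_elim
      case (elim \<omega>)
      have jc: "jump_chain p \<alpha> S N U l \<omega> = chain \<omega> l" for l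
        using jump_chain_eq_clock_chain[OF \<alpha> S l0[unfolded l0_def] diagonal_le_lambda0[OF bdd],
            where N = N and U = U and \<omega> = \<omega>, folded l0_def] simple_pathD(4)[OF elim(2)]
        by (simp add: chain_def arrival_eq_arrival_time)
      show ?case
        unfolding \<tau>_def absorption_time_J_process[where N = N and \<omega> = \<omega>, OF counting_process_path[OF cN elim(3)]] jc
        by (rule if_P[OF elim(1)])
    qed
    note error = approximation_error[OF \<tau>m \<tau>_arrival, unfolded Y]
    show ?thesis
      unfolding good_def
      using approximation_measurable regular_conditional_law_approximation[unfolded Y]
        phase_type_conditional_law[unfolded Y] error poisson_Y[unfolded Y] counting_Y(1)[unfolded Y] by blast
  qed
  define \<tau>n where "\<tau>n n = (SOME T. good n T)" for n
  note \<tau>n = someI_ex[OF ex_good, folded \<tau>n_def, unfolded good_def]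
  \<comment> \<open>The probability of a large deviation between the two clocks, plus that of too many arrivals.\<close>
  define r where "r q \<epsilon> n = prob {\<omega>\<in>space P.
      Max ((\<lambda>l. \<bar>arrival (Mn n) l \<omega> - arrival (Nn n) l \<omega>\<bar>) ` {1..nat \<lfloor>real n powr (1 + \<epsilon>)\<rfloor>})
        \<ge> rate_threshold (\<kappa> q \<epsilon>) \<epsilon> n} + exp ((\<epsilon> + ln (1 - \<epsilon>)) * real n powr (1 + \<epsilon>))" for q \<epsilon> n
  have r: "r q \<epsilon> \<in> o(\<lambda>n. real n powr (- q))" if "0 < q" "0 < \<epsilon>" "\<epsilon> < 1" for q \<epsilon>
    unfolding r_def[abs_def]
    by (intro sum_in_smallo exponential_smallo) (use kappa[OF that] that in auto)
  have rate: "prob {\<omega>\<in>space P. \<bar>\<tau> \<omega> - \<tau>n n \<omega>\<bar> > rate_threshold (\<kappa> q \<epsilon>) \<epsilon> n} \<le>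
      r q \<epsilon> n + prob {\<omega>\<in>space P. \<tau> \<omega> > (1 - \<epsilon>) * real n powr \<epsilon>}"
    if q: "0 < q" "0 < \<epsilon>" "\<epsilon> < 1" and n: "l0 \<le> n" for q \<epsilon> n
  proof -
    have n1: "1 \<le> real n" using n l0 by simp
    have thr: "0 \<le> rate_threshold (\<kappa> q \<epsilon>) \<epsilon> n"
      using kappa[OF q] n1 by (simp add: rate_threshold_def)
    have t: "0 \<le> (1 - \<epsilon>) * real n powr \<epsilon>" using q by simp
    have "1 \<le> real n powr (1 + \<epsilon>)" using n1 q by (intro ge_one_powr_ge_zero) auto
    then have m: "1 \<le> nat \<lfloor>real n powr (1 + \<epsilon>)\<rfloor>" by linarith
    have "prob {\<omega>\<in>space P. nat \<lfloor>real n powr (1 + \<epsilon>)\<rfloor> < Nn n ((1 - \<epsilon>) * real n powr \<epsilon>) \<omega>} \<le>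
        exp ((\<epsilon> + ln (1 - \<epsilon>)) * real n powr (1 + \<epsilon>))"
      using \<tau>n[OF n] q n l0 by (intro poisson_excess_bound) auto
    moreover note \<tau>n[OF n, THEN conjunct2, THEN conjunct2, THEN conjunct1, rule_format, OF thr t m]
    ultimately show ?thesis unfolding r_def by linarith
  qed
  have "tendsto_in_probability P \<tau>n \<tau>"
    unfolding tendsto_in_probability_def
  proof (intro allI impI)
    fix e :: real assume e: "0 < e"
    \<comment> \<open>Any \<open>q > 0\<close> and \<open>0 < \<epsilon> < 1\<close> will do here: the threshold tends to zero and its time bound to infinity.\<close>
    let ?thr = "\<lambda>n. rate_threshold (\<kappa> 1 (1 / 2)) (1 / 2) n"
    let ?b = "\<lambda>n. r 1 (1 / 2) n + prob {\<omega>\<in>space P. \<tau> \<omega> > (1 - 1 / 2) * real n powr (1 / 2)}"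
    have "?thr \<longlonglongrightarrow> 0"
      unfolding rate_threshold_def[abs_def] by real_asymp
    then have thr: "\<forall>\<^sub>F n in sequentially. ?thr n < e" using e by (rule order_tendstoD)
    have r0: "r 1 (1 / 2) \<longlonglongrightarrow> 0"
    proof -
      have "r 1 (1 / 2) \<in> o(\<lambda>n. real n powr (- 1))" by (rule r) auto
      also have "(\<lambda>n. real n powr (- 1)) \<in> O(\<lambda>_. 1)" by real_asymp
      finally show ?thesis using smalloD_tendsto[of "r 1 (1 / 2)" sequentially "\<lambda>_. 1"] by simp
    qed
    have "(\<lambda>n. prob {\<omega>\<in>space P. \<tau> \<omega> > (1 - 1 / 2) * real n powr (1 / 2)}) \<longlonglongrightarrow> 0"
    proof (rule prob_exceeds_tendsto_0[OF \<tau>m])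
      show "incseq (\<lambda>n. (1 - 1 / 2) * real n powr (1 / 2))"
        by (intro incseq_SucI mult_left_mono powr_mono2) auto
      show "filterlim (\<lambda>n. (1 - 1 / 2) * real n powr (1 / 2)) at_top sequentially" by real_asymp
    qed
    from tendsto_add[OF r0 this] have b: "?b \<longlonglongrightarrow> 0" by simp
    show "(\<lambda>n. prob {\<omega>\<in>space P. \<bar>\<tau>n n \<omega> - \<tau> \<omega>\<bar> > e}) \<longlonglongrightarrow> 0"
    proof (rule tendsto_sandwich[OF _ _ tendsto_const b])
      show "\<forall>\<^sub>F n in sequentially. 0 \<le> prob {\<omega>\<in>space P. \<bar>\<tau>n n \<omega> - \<tau> \<omega>\<bar> > e}" by simp
      show "\<forall>\<^sub>F n in sequentially. prob {\<omega>\<in>space P. \<bar>\<tau>n n \<omega> - \<tau> \<omega>\<bar> > e} \<le> ?b n"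
        using thr eventually_ge_at_top[of l0]
      proof eventually_elim
        case (elim n)
        have "\<tau>n n \<in> borel_measurable P" using \<tau>n[OF elim(2)] by blast
        note [measurable] = \<tau>m this
        have "prob {\<omega>\<in>space P. \<bar>\<tau>n n \<omega> - \<tau> \<omega>\<bar> > e} \<le> prob {\<omega>\<in>space P. \<bar>\<tau> \<omega> - \<tau>n n \<omega>\<bar> > ?thr n}"
          by (rule finite_measure_mono) (use elim(1) in \<open>auto simp: abs_minus_commute\<close>)
        also have "\<dots> \<le> ?b n" by (rule rate[OF _ _ _ elim(2)]) auto
        finally show ?case .
      qed
    qed
  qed
  moreover have "\<exists>r \<in> o(\<lambda>n. real n powr (- q)). \<forall>n\<ge>l0.
      prob {\<omega>\<in>space P. \<bar>\<tau> \<omega> - \<tau>n n \<omega>\<bar> > rate_threshold (\<kappa> q \<epsilon>) \<epsilon> n}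
        \<le> r n + prob {\<omega>\<in>space P. \<tau> \<omega> > (1 - \<epsilon>) * real n powr \<epsilon>}"
    if "0 < q" "0 < \<epsilon>" "\<epsilon> < 1" for q \<epsilon>
    using r[OF that] rate[OF that] by blast
  ultimately show ?thesis using \<tau>n by blast
qed

end
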